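(* Let $N\ge 1$, let ${\mathbb T}^N$ be the unit torus, and let $A_0\in L^\infty({\mathbb T}^N;{\mathbb R}^{N\times N})$ and $\rho_0\in L^\infty({\mathbb T}^N)$ satisfy: $A_0(y)$ is symmetric for a.e. $y$ and uniformly coercive (there is $\alpha>0$ with $A_0(y)\xi\cdot\xi\ge\alpha|\xi|^2$ for all $\xi\in{\mathbb R}^N$ and a.e. $y$), and $\rho_0(y)\ge\rho_{\min}>0$ for a.e. $y$. For $\theta\in[0,1[^N$ let $\lambda_1(\theta)\le\lambda_2(\theta)\le\cdots$ be the eigenvalues (repeated with multiplicity) of the Bloch cell problem defined in the context. Fix $\theta_0\in[0,1[^N$ and $n\in{\mathbb N}$ such that $\lambda_n(\theta_0)$ is a simple eigenvalue and $\lambda_n(\theta_0)>0$. Define the group velocity $$\mathcal V:=-\nabla_\theta\omega_n(\theta_0)=\frac{-\nabla_\theta\lambda_n(\theta_0)}{4\pi\sqrt{\lambda_n(\theta_0)}},$$ where $\omega_n(\theta)\ge 0$ is given by $4\pi^2\omega_n(\theta)^2=\lambda_n(\theta)$. Then $$|\mathcal V|\le c_{max}.$$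
   Context: Bloch cell problem: for $\theta\in[0,1[^N$, find $\lambda\in{\mathbb R}$ and $\psi\in H^1({\mathbb T}^N;{\mathbb C})$, $\psi\neq0$, with $$-(\operatorname{div}_y+2i\pi\theta)\big(A_0(y)(\nabla_y+2i\pi\theta)\psi\big)=\lambda\,\rho_0(y)\,\psi\quad\text{in }{\mathbb T}^N$$ (in the weak sense), where $(\operatorname{div}_y+2i\pi\theta)F=\operatorname{div}_yF+2i\pi\theta\cdot F$. Its eigenvalues form a nondecreasing sequence $\lambda_n(\theta)\ge0$ tending to $+\infty$; a simple eigenvalue $\lambda_n$ depends analytically on $\theta$ near $\theta_0$, so $\nabla_\theta\lambda_n(\theta_0)$ exists. Local speed: for $y\in{\mathbb T}^N$, $c(y)=\max_{1\le j\le N}\sqrt{\lambda_j(y)}$, where $\lambda_1(y),\dots,\lambda_N(y)$ are the roots in $\lambda$ of $\det(A_0(y)-\lambda\rho_0(y)I)=0$ (equivalently the eigenvalues of $A_0(y)/\rho_0(y)$). Maximal speed: $c_{max}=\operatorname{ess\,sup}_{y\in{\mathbb T}^N}c(y)$. *)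

theory Defs
  imports "HOL-Analysis.Analysis" "HOL-Probability.Essential_Supremum"
begin

text \<open>The torus T^N is represented by Z^N-periodic functions on real^'n; integrals
  are taken over the unit cell [0,1]^N.\<close>

definition cube :: "(real^'n) set" where
  "cube = cbox 0 One"

definition periodic :: "(real^'n \<Rightarrow> 'b) \<Rightarrow> bool" where
  "periodic f \<longleftrightarrow> (\<forall>y k. (\<forall>i. k$i \<in> \<int>) \<longrightarrow> f (y + k) = f y)"

definition L2 :: "(real^'n \<Rightarrow> 'b::euclidean_space) \<Rightarrow> bool" where
  "L2 f \<longleftrightarrow> f \<in> borel_measurable (lebesgue_on cube)
      \<and> integrable (lebesgue_on cube) (\<lambda>y. (norm (f y))^2)"

definition test_fun :: "(real^'n \<Rightarrow> real) \<Rightarrow> (real^'n \<Rightarrow> real^'n) \<Rightarrow> bool" where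
  "test_fun phi Dphi \<longleftrightarrow> periodic phi \<and> continuous_on UNIV Dphi
      \<and> (\<forall>y. (phi has_derivative (\<lambda>h. Dphi y \<bullet> h)) (at y))"

definition weak_grad :: "(real^'n \<Rightarrow> complex) \<Rightarrow> (real^'n \<Rightarrow> complex^'n) \<Rightarrow> bool" where
  "weak_grad psi G \<longleftrightarrow> (\<forall>phi Dphi. test_fun phi Dphi \<longrightarrow> (\<forall>j.
      (LINT y|lebesgue_on cube. psi y * complex_of_real (Dphi y $ j))
      = - (LINT y|lebesgue_on cube. G y $ j * complex_of_real (phi y))))"

definition H1_grad :: "(real^'n \<Rightarrow> complex) \<Rightarrow> (real^'n \<Rightarrow> complex^'n) \<Rightarrow> bool" where
  "H1_grad psi G \<longleftrightarrow> periodic psi \<and> L2 psi \<and> periodic G \<and> L2 G \<and> weak_grad psi G"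

text \<open>(nabla + 2 i pi theta) psi, given the gradient G of psi.\<close>
definition tgrad :: "real^'n \<Rightarrow> (real^'n \<Rightarrow> complex) \<Rightarrow> (real^'n \<Rightarrow> complex^'n) \<Rightarrow> real^'n \<Rightarrow> complex^'n" where
  "tgrad theta psi G y = (\<chi> i. G y $ i + 2 * \<i> * complex_of_real pi * complex_of_real (theta $ i) * psi y)"

definition cmatvec :: "real^'n^'n \<Rightarrow> complex^'n \<Rightarrow> complex^'n" where
  "cmatvec M v = (\<chi> i. \<Sum>j\<in>UNIV. complex_of_real (M$i$j) * v$j)"

definition cdot :: "complex^'n \<Rightarrow> complex^'n \<Rightarrow> complex" where
  "cdot u v = (\<Sum>i\<in>UNIV. u$i * cnj (v$i))"

definition bloch_eig :: "(real^'n \<Rightarrow> real^'n^'n) \<Rightarrow> (real^'n \<Rightarrow> real) \<Rightarrow> real^'n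
    \<Rightarrow> real \<Rightarrow> (real^'n \<Rightarrow> complex) \<Rightarrow> bool" where
  "bloch_eig A rho theta lam psi \<longleftrightarrow> (\<exists>G. H1_grad psi G
     \<and> \<not> (AE y in lebesgue_on cube. psi y = 0)
     \<and> (\<forall>phi Gphi. H1_grad phi Gphi \<longrightarrow>
          (LINT y|lebesgue_on cube. cdot (cmatvec (A y) (tgrad theta psi G y)) (tgrad theta phi Gphi y))
          = complex_of_real lam * (LINT y|lebesgue_on cube. complex_of_real (rho y) * psi y * cnj (phi y))))"

definition ae_indep :: "nat \<Rightarrow> (nat \<Rightarrow> real^'n \<Rightarrow> complex) \<Rightarrow> bool" where
  "ae_indep k psi \<longleftrightarrow> (\<forall>c::nat \<Rightarrow> complex.
     (AE y in lebesgue_on cube. (\<Sum>i<k. c i * psi i y) = 0) \<longrightarrow> (\<forall>i<k. c i = 0))"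

text \<open>n-th eigenvalue (n \<ge> 1), counted with multiplicity in nondecreasing order:
  the least lam such that there are n linearly independent eigenfunctions with
  eigenvalues \<le> lam.\<close>
definition bloch_ev :: "(real^'n \<Rightarrow> real^'n^'n) \<Rightarrow> (real^'n \<Rightarrow> real) \<Rightarrow> real^'n \<Rightarrow> nat \<Rightarrow> real" where
  "bloch_ev A rho theta n = Inf {lam. \<exists>psi mu. (\<forall>i<n. bloch_eig A rho theta (mu i) (psi i) \<and> mu i \<le> lam)
       \<and> ae_indep n psi}"

definition simple_eig :: "(real^'n \<Rightarrow> real^'n^'n) \<Rightarrow> (real^'n \<Rightarrow> real) \<Rightarrow> real^'n \<Rightarrow> real \<Rightarrow> bool" where
  "simple_eig A rho theta lam \<longleftrightarrow> (\<exists>psi. bloch_eig A rho theta lam psi)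
     \<and> \<not> (\<exists>psi. (\<forall>i<2. bloch_eig A rho theta lam (psi i)) \<and> ae_indep 2 psi)"

definition local_speed :: "(real^'n \<Rightarrow> real^'n^'n) \<Rightarrow> (real^'n \<Rightarrow> real) \<Rightarrow> real^'n \<Rightarrow> real" where
  "local_speed A rho y = Max {sqrt l | l. det (A y - (l * rho y) *\<^sub>R mat 1) = 0}"

definition c_max :: "(real^'n \<Rightarrow> real^'n^'n) \<Rightarrow> (real^'n \<Rightarrow> real) \<Rightarrow> ereal" where
  "c_max A rho = esssup (lebesgue_on (cube :: (real^'n) set)) (\<lambda>y. ereal (local_speed A rho y))"

end

theory Submission
  imports Defs "HOL-Library.Function_Algebras" "HOL-Complex_Analysis.Great_Picard"
begin

text \<open>
  The square root of the Rayleigh quotient of the Bloch operator is the ratio of the seminorm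
  \<open>(\<integral> A\<^sub>0 F \<cdot> F)\<^sup>1\<^sup>/\<^sup>2\<close> of \<open>F = (\<nabla> + 2\<i>\<pi>\<theta>)\<psi>\<close> to the norm \<open>(\<integral> \<rho>\<^sub>0 |\<psi>|\<^sup>2)\<^sup>1\<^sup>/\<^sup>2\<close>. Since \<open>A\<^sub>0 \<xi> \<cdot> \<xi> \<le> c\<^sub>m\<^sub>a\<^sub>x\<^sup>2 \<rho>\<^sub>0 |\<xi>|\<^sup>2\<close>
  almost everywhere, Minkowski's inequality shows that for fixed \<open>\<psi>\<close> this ratio is Lipschitz in \<open>\<theta>\<close>
  with constant \<open>2\<pi>c\<^sub>m\<^sub>a\<^sub>x\<close>. By the min-max principle the same holds for the square root of the
  \<open>n\<close>-th eigenvalue, and this bounds its gradient. The min-max principle rests on the existence of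
  minimizers of the Rayleigh quotient, which follows from Rellich's theorem: by Fourier series for
  the compactness, and by the parallelogram law for the convergence of minimizing sequences in \<open>H\<^sup>1\<close>.
\<close>

section \<open>Hermitian forms\<close>

text \<open>\<open>bloch_ev\<close> is an infimum over families of genuine eigenfunctions, not a
  min-max value. A trial space with small Rayleigh quotient at \<theta> therefore says nothing by
  itself: eigenfunctions at \<theta> have to be produced from it, and this is what calls for
  compactness and completeness. Upper bounds are transported from one parameter to another, in both
  directions. Functions that agree almost everywhere are not identified, and periodicity is demanded
  at every point. All forms are hence semidefinite on plain function spaces, vectors of length 0 are
  handled by Cauchy-Schwarz, and limits are picked as actual functions. The constants fit together
  because the gradient of \<lambda> is 2 sqrt \<lambda> times that of sqrt \<lambda>; the Lipschitz
  constant turns this into the bound 4 \<pi> c_max sqrt \<lambda>, whose factor 4 \<pi> sqrt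
  \<lambda> is the normalization of the group velocity. The 2 \<pi> comes from the shift 2 i \<pi>
  \<theta>.\<close>

definition qf :: "('v \<Rightarrow> 'v \<Rightarrow> complex) \<Rightarrow> 'v \<Rightarrow> real" where
  "qf s u = Re (s u u)"

definition qcauchy :: "('v::ab_group_add \<Rightarrow> real) \<Rightarrow> (nat \<Rightarrow> 'v) \<Rightarrow> bool" where
  "qcauchy q f \<longleftrightarrow> (\<forall>e>0. \<exists>N. \<forall>m\<ge>N. \<forall>n\<ge>N. q (f m - f n) < e)"

text \<open>Positivity is only semidefinite and lives on a subspace \<open>X\<close>: functions that
  agree almost everywhere stay distinct, so nonzero vectors of length 0 occur.\<close>

locale hform = vector_space sc for sc :: "complex \<Rightarrow> 'v::ab_group_add \<Rightarrow> 'v" +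
  fixes X :: "'v set" and s :: "'v \<Rightarrow> 'v \<Rightarrow> complex"
  assumes sub: "subspace X"
    and add_left: "u \<in> X \<Longrightarrow> v \<in> X \<Longrightarrow> w \<in> X \<Longrightarrow> s (u + v) w = s u w + s v w"
    and scale_left: "u \<in> X \<Longrightarrow> w \<in> X \<Longrightarrow> s (sc c u) w = c * s u w"
    and herm: "u \<in> X \<Longrightarrow> v \<in> X \<Longrightarrow> s v u = cnj (s u v)"
    and nonneg: "u \<in> X \<Longrightarrow> 0 \<le> qf s u"
begin

lemmas inX = subspace_0[OF sub] subspace_add[OF sub] subspace_diff[OF sub]
  subspace_scale[OF sub] subspace_sum[OF sub] subspace_neg[OF sub]

lemma add_right: "u \<in> X \<Longrightarrow> v \<in> X \<Longrightarrow> w \<in> X \<Longrightarrow> s w (u + v) = s w u + s w v"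
  using herm[of u w] herm[of v w] herm[of "u + v" w] by (simp add: add_left inX)

lemma scale_right: "u \<in> X \<Longrightarrow> w \<in> X \<Longrightarrow> s w (sc c u) = cnj c * s w u"
  using herm[of u w] herm[of "sc c u" w] by (simp add: scale_left inX)

lemma zero_left [simp]: "u \<in> X \<Longrightarrow> s 0 u = 0"
  using scale_left[of u u 0] by simp

lemma zero_right [simp]: "u \<in> X \<Longrightarrow> s u 0 = 0"
  using scale_right[of u u 0] by simp

lemma minus_left: "u \<in> X \<Longrightarrow> w \<in> X \<Longrightarrow> s (- u) w = - s u w"
  using scale_left[of u w "-1"] by (simp add: scale_minus_left)

lemma minus_right: "u \<in> X \<Longrightarrow> w \<in> X \<Longrightarrow> s w (- u) = - s w u"
  using scale_right[of u w "-1"] by (simp add: scale_minus_left)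

lemma diff_left: "u \<in> X \<Longrightarrow> v \<in> X \<Longrightarrow> w \<in> X \<Longrightarrow> s (u - v) w = s u w - s v w"
  using add_left[of u "- v" w] by (simp add: inX minus_left)

lemma diff_right: "u \<in> X \<Longrightarrow> v \<in> X \<Longrightarrow> w \<in> X \<Longrightarrow> s w (u - v) = s w u - s w v"
  using add_right[of u "- v" w] by (simp add: inX minus_right)

lemma sum_left:
  assumes "\<And>i. i \<in> I \<Longrightarrow> f i \<in> X" "w \<in> X"
  shows "s (\<Sum>i\<in>I. f i) w = (\<Sum>i\<in>I. s (f i) w)"
  using assms
proof (induction I rule: infinite_finite_induct)
  case (insert x F)
  then show ?case by (simp add: add_left inX)
qed auto

lemma sum_right:
  assumes "\<And>i. i \<in> I \<Longrightarrow> f i \<in> X" "w \<in> X"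
  shows "s w (\<Sum>i\<in>I. f i) = (\<Sum>i\<in>I. s w (f i))"
  using assms
proof (induction I rule: infinite_finite_induct)
  case (insert x F)
  then show ?case by (simp add: add_right inX)
qed auto

lemma self: "u \<in> X \<Longrightarrow> s u u = of_real (qf s u)"
  using herm[of u u] by (simp add: qf_def complex_eq_iff)

lemma q_scale:
  assumes "u \<in> X"
  shows "qf s (sc c u) = (cmod c)\<^sup>2 * qf s u"
proof -
  have "s (sc c u) (sc c u) = of_real ((cmod c)\<^sup>2 * qf s u)"
    unfolding of_real_mult complex_norm_square self[OF assms, symmetric]
    using assms by (simp add: scale_left scale_right inX)
  then show ?thesis by (simp add: qf_def)
qed

lemma q_add: "u \<in> X \<Longrightarrow> v \<in> X \<Longrightarrow> qf s (u + v) = qf s u + qf s v + 2 * Re (s u v)"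
  unfolding qf_def using herm[of u v] by (simp add: add_left add_right inX)

lemma q_diff: "u \<in> X \<Longrightarrow> v \<in> X \<Longrightarrow> qf s (u - v) = qf s u + qf s v - 2 * Re (s u v)"
  unfolding qf_def using herm[of u v] by (simp add: diff_left diff_right inX)

lemma q_minus: "u \<in> X \<Longrightarrow> qf s (- u) = qf s u"
  unfolding qf_def by (simp add: minus_left minus_right inX)

lemma q_diff_commute: "u \<in> X \<Longrightarrow> v \<in> X \<Longrightarrow> qf s (u - v) = qf s (v - u)"
  using q_minus[of "u - v"] by (simp add: inX)

text \<open>Subtracting from \<open>u\<close> multiples of \<open>v\<close> along the phase of
  \<open>s u v\<close> makes the test quantity a real quadratic in \<open>t\<close>. When
  \<open>v\<close> has length 0 the quadratic degenerates to an affine function bounded below, so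
  its slope vanishes; this case later turns length 0 into orthogonality to everything.\<close>

lemma Cauchy_Schwarz:
  assumes u: "u \<in> X" and v: "v \<in> X"
  shows "(cmod (s u v))\<^sup>2 \<le> qf s u * qf s v"
proof -
  let ?c = "s u v"
  have key: "0 \<le> qf s u - 2 * t * (cmod ?c)\<^sup>2 + t\<^sup>2 * (cmod ?c)\<^sup>2 * qf s v" for t :: real
  proof -
    have "Re (cnj (of_real t * ?c) * ?c) = t * (cmod ?c)\<^sup>2"
      unfolding cmod_power2 by (simp add: power2_eq_square algebra_simps)
    then have "qf s (u - sc (of_real t * ?c) v) = qf s u - 2 * t * (cmod ?c)\<^sup>2 + t\<^sup>2 * (cmod ?c)\<^sup>2 * qf s v"
      using u v by (simp add: q_diff inX q_scale scale_right norm_mult power_mult_distrib)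
    then show ?thesis using nonneg[of "u - sc (of_real t * ?c) v"] u v by (simp add: inX)
  qed
  show ?thesis
  proof (cases "qf s v = 0")
    case True
    have "(cmod ?c)\<^sup>2 \<le> 0"
    proof (rule ccontr)
      assume "\<not> ?thesis"
      then have p: "(cmod ?c)\<^sup>2 > 0" by simp
      \<comment> \<open>This \<open>t\<close> is large enough to push the affine bound below
        zero.\<close>
      have "0 \<le> qf s u - 2 * (qf s u / (cmod ?c)\<^sup>2 + 1) * (cmod ?c)\<^sup>2"
        using key[of "qf s u / (cmod ?c)\<^sup>2 + 1"] True by simp
      also have "\<dots> = - qf s u - 2 * (cmod ?c)\<^sup>2" using p by (simp add: field_simps)
      finally show False using nonneg[OF u] p by simp
    qed
    then show ?thesis using True by simp
  next
    case False
    then have p: "qf s v > 0" using nonneg[OF v] by simp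
    have "0 \<le> qf s u - 2 * (1 / qf s v) * (cmod ?c)\<^sup>2 + (1 / qf s v)\<^sup>2 * (cmod ?c)\<^sup>2 * qf s v"
      by (rule key)
    also have "\<dots> = qf s u - (cmod ?c)\<^sup>2 / qf s v" using p by (simp add: field_simps power2_eq_square)
    finally show ?thesis using p by (simp add: field_simps)
  qed
qed

lemma Cauchy_Schwarz_sqrt:
  assumes u: "u \<in> X" and v: "v \<in> X"
  shows "cmod (s u v) \<le> sqrt (qf s u) * sqrt (qf s v)"
  using real_le_rsqrt[OF Cauchy_Schwarz[OF u v]] by (simp add: real_sqrt_mult)

lemma triangle:
  assumes u: "u \<in> X" and v: "v \<in> X"
  shows "sqrt (qf s (u + v)) \<le> sqrt (qf s u) + sqrt (qf s v)"
proof (rule real_le_lsqrt)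
  have "Re (s u v) \<le> sqrt (qf s u) * sqrt (qf s v)"
    using Cauchy_Schwarz_sqrt[OF u v] complex_Re_le_cmod[of "s u v"] by linarith
  then show "qf s (u + v) \<le> (sqrt (qf s u) + sqrt (qf s v))\<^sup>2"
    using nonneg[OF u] nonneg[OF v] u v by (simp add: q_add power2_sum)
qed (use nonneg u v in auto)

lemma q_le_double:
  assumes u: "u \<in> X" and v: "v \<in> X"
  shows "qf s (u + v) \<le> 2 * qf s u + 2 * qf s v"
  using nonneg[of "u - v"] u v by (simp add: q_diff q_add inX)

lemma tendsto_q:
  assumes f: "\<And>n::nat. f n \<in> X" and g: "g \<in> X" and lim: "(\<lambda>n. qf s (f n - g)) \<longlonglongrightarrow> 0"
  shows "(\<lambda>n. qf s (f n)) \<longlonglongrightarrow> qf s g"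
proof -
  have d: "(\<lambda>n. sqrt (qf s (f n - g))) \<longlonglongrightarrow> 0" using tendsto_real_sqrt[OF lim] by simp
  have "\<bar>sqrt (qf s (f n)) - sqrt (qf s g)\<bar> \<le> sqrt (qf s (f n - g))" for n
  proof -
    have "sqrt (qf s (f n)) \<le> sqrt (qf s (f n - g)) + sqrt (qf s g)"
      using triangle[of "f n - g" g] f g by (simp add: inX)
    moreover have "sqrt (qf s g) \<le> sqrt (qf s (g - f n)) + sqrt (qf s (f n))"
      using triangle[of "g - f n" "f n"] f g by (simp add: inX)
    ultimately show ?thesis using q_diff_commute[OF f[of n] g] by simp
  qed
  then have "(\<lambda>n. sqrt (qf s (f n)) - sqrt (qf s g)) \<longlonglongrightarrow> 0"
    by (intro Lim_null_comparison[OF _ d]) auto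
  then have "(\<lambda>n. sqrt (qf s (f n))) \<longlonglongrightarrow> sqrt (qf s g)" by (simp add: LIM_zero_iff)
  from tendsto_power[OF this, of 2] show ?thesis using nonneg f g by simp
qed

lemma tendsto_left:
  assumes f: "\<And>n::nat. f n \<in> X" and g: "g \<in> X" and w: "w \<in> X" and lim: "(\<lambda>n. qf s (f n - g)) \<longlonglongrightarrow> 0"
  shows "(\<lambda>n. s (f n) w) \<longlonglongrightarrow> s g w"
proof -
  have d: "(\<lambda>n. sqrt (qf s (f n - g)) * sqrt (qf s w)) \<longlonglongrightarrow> 0"
    using tendsto_mult[OF tendsto_real_sqrt[OF lim] tendsto_const[of "sqrt (qf s w)"]] by simp
  have "(\<lambda>n. s (f n) w - s g w) \<longlonglongrightarrow> 0"
    using Cauchy_Schwarz_sqrt[OF inX(3)[OF f g] w] f g w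
    by (intro Lim_null_comparison[OF _ d]) (auto simp: diff_left)
  then show ?thesis by (simp add: LIM_zero_iff)
qed

lemma q_orthonormal_sum:
  assumes F: "finite F" and E: "\<And>k. k \<in> F \<Longrightarrow> E k \<in> X"
    and on: "\<And>k l. k \<in> F \<Longrightarrow> l \<in> F \<Longrightarrow> s (E k) (E l) = (if k = l then 1 else 0)"
  shows "qf s (\<Sum>k\<in>F. sc (c k) (E k)) = (\<Sum>k\<in>F. (cmod (c k))\<^sup>2)"
proof -
  have "s (\<Sum>k\<in>F. sc (c k) (E k)) (\<Sum>k\<in>F. sc (c k) (E k))
      = (\<Sum>k\<in>F. c k * (\<Sum>l\<in>F. cnj (c l) * s (E k) (E l)))"
    using E by (subst sum_left) (auto simp: sum_right inX scale_left scale_right sum_distrib_left ac_simps intro!: sum.cong)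
  also have "\<dots> = (\<Sum>k\<in>F. c k * (\<Sum>l\<in>F. if k = l then cnj (c l) else 0))"
    by (intro sum.cong refl arg_cong2[where f="(*)"]) (simp add: on)
  also have "\<dots> = (\<Sum>k\<in>F. of_real ((cmod (c k))\<^sup>2))"
    using F by (simp add: complex_norm_square del: of_real_power)
  finally show ?thesis by (simp add: qf_def)
qed

lemma bessel_identity:
  assumes F: "finite F" and E: "\<And>k. k \<in> F \<Longrightarrow> E k \<in> X" and f: "f \<in> X"
    and on: "\<And>k l. k \<in> F \<Longrightarrow> l \<in> F \<Longrightarrow> s (E k) (E l) = (if k = l then 1 else 0)"
  shows "qf s (f - (\<Sum>k\<in>F. sc (s f (E k)) (E k))) = qf s f - (\<Sum>k\<in>F. (cmod (s f (E k)))\<^sup>2)"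
proof -
  have "s f (\<Sum>k\<in>F. sc (s f (E k)) (E k)) = (\<Sum>k\<in>F. of_real ((cmod (s f (E k)))\<^sup>2))"
    using E f by (simp add: sum_right inX scale_right complex_norm_square ac_simps del: of_real_power)
  then show ?thesis
    using E f q_orthonormal_sum[OF F E on, of "\<lambda>k. s f (E k)"] by (simp add: q_diff inX)
qed

lemma bessel:
  assumes F: "finite F" and E: "\<And>k. k \<in> F \<Longrightarrow> E k \<in> X" and f: "f \<in> X"
    and on: "\<And>k l. k \<in> F \<Longrightarrow> l \<in> F \<Longrightarrow> s (E k) (E l) = (if k = l then 1 else 0)"
  shows "(\<Sum>k\<in>F. (cmod (s f (E k)))\<^sup>2) \<le> qf s f"
proof -
  have "0 \<le> qf s (f - (\<Sum>k\<in>F. sc (s f (E k)) (E k)))"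
    by (intro nonneg inX f E)
  then show ?thesis using bessel_identity[OF F E f on] by simp
qed

text \<open>Finite index sets whose Bessel sums approach their supremum give a Cauchy sequence of
  projections of \<open>f\<close>. Its limit \<open>g\<close> has the same coefficients as
  \<open>f\<close>, so totality leaves \<open>f - g\<close> with length 0. One finite set with error
  \<open>e\<close> stands in for a sum over all of \<open>K\<close>.\<close>

lemma parseval_le:
  assumes complete: "\<And>h. (\<And>n. h n \<in> X) \<Longrightarrow> qcauchy (qf s) h \<Longrightarrow> \<exists>g\<in>X. (\<lambda>n. qf s (h n - g)) \<longlonglongrightarrow> 0"
    and E: "\<And>k. k \<in> K \<Longrightarrow> E k \<in> X"
    and on: "\<And>k l. k \<in> K \<Longrightarrow> l \<in> K \<Longrightarrow> s (E k) (E l) = (if k = l then 1 else 0)"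
    and total: "\<And>g. g \<in> X \<Longrightarrow> (\<And>k. k \<in> K \<Longrightarrow> s g (E k) = 0) \<Longrightarrow> qf s g = 0"
    and f: "f \<in> X" and e: "e > 0"
  shows "\<exists>F. finite F \<and> F \<subseteq> K \<and> qf s f \<le> (\<Sum>k\<in>F. (cmod (s f (E k)))\<^sup>2) + e"
proof -
  let ?S = "\<lambda>F. \<Sum>k\<in>F. (cmod (s f (E k)))\<^sup>2"
  let ?P = "\<lambda>F. \<Sum>k\<in>F. sc (s f (E k)) (E k)"
  define T where "T = ?S ` {F. finite F \<and> F \<subseteq> K}"
  have bs: "?S F \<le> qf s f" if "finite F" "F \<subseteq> K" for F
    by (rule bessel[OF that(1) _ f]) (use that E on in \<open>auto simp: subset_iff\<close>)
  have bdd: "bdd_above T" unfolding T_def by (rule bdd_aboveI[of _ "qf s f"]) (auto intro: bs)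
  have ne: "T \<noteq> {}" by (auto simp: T_def)
  have S_le: "?S F \<le> Sup T" if "finite F" "F \<subseteq> K" for F
    by (rule cSup_upper[OF _ bdd]) (use that in \<open>auto simp: T_def\<close>)
  have "\<exists>F. finite F \<and> F \<subseteq> K \<and> Sup T - inverse (real (Suc m)) < ?S F" for m
    using less_cSup_iff[OF ne bdd, of "Sup T - inverse (real (Suc m))"] by (auto simp: T_def)
  then obtain G where G: "\<And>m. finite (G m)" "\<And>m. G m \<subseteq> K" "\<And>m. Sup T - inverse (real (Suc m)) < ?S (G m)"
    by metis
  \<comment> \<open>Unions make the sets increase, so that the difference of two projections is
    again an orthonormal sum, whose squared length is the difference of two Bessel sums.\<close>
  define F where "F m = (\<Union>i\<le>m. G i)" for m
  have F: "finite (F m)" "F m \<subseteq> K" for m using G by (auto simp: F_def)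
  have Fmono: "F m \<subseteq> F n" if "m \<le> n" for m n using that by (fastforce simp: F_def)
  have SF: "Sup T - inverse (real (Suc m)) < ?S (F m)" for m
  proof -
    have "?S (G m) \<le> ?S (F m)" by (rule sum_mono2) (use F in \<open>auto simp: F_def\<close>)
    then show ?thesis using G(3)[of m] by linarith
  qed
  have PX: "?P (F m) \<in> X" for m by (intro inX E) (use F in auto)
  have diff: "qf s (?P (F n) - ?P (F m)) < inverse (real (Suc m))" if "m \<le> n" for m n
  proof -
    have "?P (F n) - ?P (F m) = ?P (F n - F m)"
      using F Fmono[OF that] by (simp add: sum_diff)
    moreover have "qf s (?P (F n - F m)) = ?S (F n - F m)"
      by (rule q_orthonormal_sum) (use F(1)[of n] F(2)[of n] E on in \<open>auto simp: subset_iff\<close>)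
    moreover have "?S (F n - F m) = ?S (F n) - ?S (F m)"
      using F Fmono[OF that] by (simp add: sum_diff)
    ultimately show ?thesis using S_le[OF F, of n] SF[of m] by simp
  qed
  have "qcauchy (qf s) (\<lambda>m. ?P (F m))" unfolding qcauchy_def
  proof (intro allI impI)
    fix e :: real assume "e > 0"
    then obtain N where N: "inverse (real (Suc N)) < e" using reals_Archimedean by blast
    show "\<exists>N. \<forall>m\<ge>N. \<forall>n\<ge>N. qf s (?P (F m) - ?P (F n)) < e"
    proof (intro exI[of _ N] allI impI)
      fix m n assume mn: "N \<le> m" "N \<le> n"
      have *: "qf s (?P (F m) - ?P (F n)) < e" if "n \<le> m" "N \<le> n" for m n
      proof -
        have "inverse (real (Suc n)) \<le> inverse (real (Suc N))" using that by (simp add: field_simps)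
        then show ?thesis using diff[OF that(1)] N by linarith
      qed
      show "qf s (?P (F m) - ?P (F n)) < e"
        using *[of n m] *[of m n] mn q_diff_commute[OF PX[of m] PX[of n]] by (cases "n \<le> m") auto
    qed
  qed
  then obtain g where g: "g \<in> X" "(\<lambda>m. qf s (?P (F m) - g)) \<longlonglongrightarrow> 0"
    using complete[of "\<lambda>m. ?P (F m)"] PX by blast
  have inv0: "(\<lambda>m. inverse (real (Suc m))) \<longlonglongrightarrow> 0" by (rule LIMSEQ_inverse_real_of_nat)
  have coef: "s (f - g) (E k) = 0" if k: "k \<in> K" for k
  proof -
    have lim: "(\<lambda>m. s (?P (F m)) (E k)) \<longlonglongrightarrow> s g (E k)"
      by (rule tendsto_left) (use PX g E k in auto)
    have val: "s (?P (F m)) (E k) = (if k \<in> F m then s f (E k) else 0)" for m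
    proof -
      have "s (?P (F m)) (E k) = (\<Sum>l\<in>F m. s f (E l) * s (E l) (E k))"
        using F[of m] E k f by (subst sum_left) (auto simp: scale_left inX subset_iff)
      also have "\<dots> = (\<Sum>l\<in>F m. if l = k then s f (E k) else 0)"
        by (intro sum.cong refl) (use F[of m] on k in \<open>auto simp: subset_iff\<close>)
      finally show ?thesis using F(1)[of m] by simp
    qed
    have "s g (E k) = s f (E k)"
    proof (cases "\<exists>m. k \<in> F m")
      case True
      then obtain m where "k \<in> F m" ..
      then have "eventually (\<lambda>n. s (?P (F n)) (E k) = s f (E k)) sequentially"
        unfolding eventually_sequentially val using Fmono by (intro exI[of _ m]) auto
      then show ?thesis using tendsto_eventually tendsto_unique[OF _ lim] by fastforce
    next
      case False
      then have "s g (E k) = 0" using lim by (simp add: val LIMSEQ_const_iff)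
      \<comment> \<open>An index outside every \<open>F m\<close> can be added to each of them
        without exceeding the supremum, which is already nearly attained, so its coefficient
        vanishes.\<close>
      moreover have "(cmod (s f (E k)))\<^sup>2 \<le> inverse (real (Suc m))" for m
      proof -
        have "?S (insert k (F m)) \<le> Sup T" by (rule S_le) (use F k in auto)
        then show ?thesis using SF[of m] False F by simp
      qed
      then have "(cmod (s f (E k)))\<^sup>2 \<le> 0" by (intro LIMSEQ_le_const[OF inv0]) auto
      ultimately show ?thesis by simp
    qed
    then show ?thesis using f g E k by (simp add: diff_left)
  qed
  have z: "qf s (f - g) = 0" by (rule total) (use coef f g inX in auto)
  have *: "qf s (?P (F m) - f) \<le> 2 * qf s (?P (F m) - g)" for m
    using q_le_double[of "?P (F m) - g" "g - f"] PX g f z q_diff_commute[OF f g(1)] by (simp add: inX)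
  obtain m where mg: "qf s (?P (F m) - g) < e / 2"
    using order_tendstoD(2)[OF g(2), of "e/2"] e by (auto simp: eventually_sequentially)
  have m: "qf s (?P (F m) - f) < e" using *[of m] mg by linarith
  have "qf s (f - ?P (F m)) = qf s f - ?S (F m)"
    by (rule bessel_identity[OF F(1) _ f]) (use F(2)[of m] E on in \<open>auto simp: subset_iff\<close>)
  then show ?thesis
    using m F[of m] q_diff_commute[OF f PX[of m]] by (intro exI[of _ "F m"]) auto
qed

end

section \<open>Eigenvectors from trial spaces: the min-max principle\<close>

text \<open>Gaussian elimination, by induction on the number of equations. It supplies a nontrivial
  combination of n trial vectors that is orthogonal to k < n given vectors.\<close>

lemma nontrivial_solution:
  fixes M :: "nat \<Rightarrow> nat \<Rightarrow> 'a::field"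
  assumes "k < n"
  shows "\<exists>c. (\<exists>j<n. c j \<noteq> 0) \<and> (\<forall>i<k. (\<Sum>j<n. M i j * c j) = 0)"
  using assms
proof (induction k arbitrary: n M)
  case 0
  then show ?case by (intro exI[of _ "\<lambda>_. 1"]) auto
next
  case (Suc k)
  then obtain m where n: "n = Suc m" "k < m" by (metis Suc_lessE)
  show ?case
  proof (cases "\<exists>p<n. M k p \<noteq> 0")
    case False
    obtain c where c: "\<exists>j<n. c j \<noteq> 0" "\<forall>i<k. (\<Sum>j<n. M i j * c j) = 0"
      using Suc.IH[of n M] Suc.prems by auto
    then show ?thesis using False by (intro exI[of _ c]) (auto simp: less_Suc_eq)
  next
    case True
    then obtain p where p: "p < n" "M k p \<noteq> 0" by blast
    define t where "t = Transposition.transpose p m"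
    have bij: "bij_betw t {..<n} {..<n}"
      using p n unfolding t_def by (simp add: bij_betw_transpose_iff)
    \<comment> \<open>Column \<open>p\<close> holds the pivot of row \<open>k\<close> and is swapped
      to the last position. \<open>M'\<close> is what remains after eliminating that unknown, and
      \<open>d\<close> below recovers it from row \<open>k\<close>.\<close>
    define M' where "M' i j = M i (t j) - M i p * (M k (t j) / M k p)" for i j
    obtain c where c: "\<exists>j<m. c j \<noteq> 0" "\<forall>i<k. (\<Sum>j<m. M' i j * c j) = 0"
      using Suc.IH[of m M'] n by auto
    define d where "d j = (if j < m then c j else - (\<Sum>l<m. M k (t l) / M k p * c l))" for j
    have re: "(\<Sum>j<n. M i j * d (t j)) = (\<Sum>j<m. M i (t j) * c j) - M i p * (\<Sum>l<m. M k (t l) / M k p * c l)" for i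
    proof -
      have "(\<Sum>j<n. M i j * d (t j)) = (\<Sum>j<n. M i (t j) * d (t (t j)))"
        using sum.reindex_bij_betw[OF bij, of "\<lambda>j. M i j * d (t j)"] by simp
      also have "\<dots> = (\<Sum>j<n. M i (t j) * d j)" by (simp add: t_def)
      also have "\<dots> = (\<Sum>j<m. M i (t j) * d j) + M i (t m) * d m" by (simp add: n)
      also have "t m = p" by (simp add: t_def)
      finally show ?thesis by (simp add: d_def)
    qed
    have "\<exists>j<n. d (t j) \<noteq> 0"
    proof -
      obtain j where j: "j < m" "c j \<noteq> 0" using c by blast
      have "t j < n" using bij j n by (metis bij_betw_apply lessThan_iff less_SucI)
      moreover have "d (t (t j)) \<noteq> 0" using j by (simp add: t_def d_def)
      ultimately show ?thesis by blast
    qed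
    moreover have "(\<Sum>j<n. M i j * d (t j)) = 0" if "i < Suc k" for i
    proof (cases "i = k")
      case True
      then show ?thesis using p by (simp add: re sum_distrib_left mult.assoc[symmetric])
    next
      case False
      then have "(\<Sum>j<m. M' i j * c j) = 0" using c that by auto
      then show ?thesis
        by (simp add: re M'_def algebra_simps sum_subtractf sum_distrib_left)
    qed
    ultimately show ?thesis by (intro exI[of _ "\<lambda>j. d (t j)"]) auto
  qed
qed

text \<open>Here \<open>a\<close> is the energy and \<open>b\<close> the mass.
  \<open>compact\<close> expresses a compact embedding without naming a limit; the limit comes from
  \<open>complete\<close>, for the seminorm whose square is \<open>a + b\<close>.\<close>

locale hpair = A: hform sc X a + B: hform sc X b
  for sc :: "complex \<Rightarrow> 'v::ab_group_add \<Rightarrow> 'v" and X a b +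
  assumes compact: "\<And>f C. (\<And>n. f n \<in> X) \<Longrightarrow> (\<And>n. qf a (f n) + qf b (f n) \<le> C)
      \<Longrightarrow> \<exists>r::nat \<Rightarrow> nat. strict_mono r \<and> qcauchy (qf b) (\<lambda>n. f (r n))"
    and complete: "\<And>f. (\<And>n. f n \<in> X) \<Longrightarrow> qcauchy (\<lambda>u. qf a u + qf b u) f
      \<Longrightarrow> \<exists>g\<in>X. (\<lambda>n. qf a (f n - g) + qf b (f n - g)) \<longlonglongrightarrow> 0"
begin

lemmas inX = A.inX

text \<open>Direct method for the Rayleigh quotient under orthogonality constraints. Compactness
  makes a minimizing sequence Cauchy for \<open>b\<close>; the parallelogram law makes it Cauchy for
  \<open>a\<close>, since sums of its members lie in \<open>W\<close> and their energy is at least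
  \<open>\<mu>\<close> times their mass. Minimality turns \<open>a - \<mu> b\<close> into a
  semidefinite form on \<open>W\<close>, whose Cauchy-Schwarz inequality yields the weak
  equation.\<close>

lemma minimizer:
  fixes e :: "nat \<Rightarrow> 'v"
  assumes e: "\<And>i. i < k \<Longrightarrow> e i \<in> X"
  defines "W \<equiv> {w \<in> X. \<forall>i<k. b w (e i) = 0}"
  assumes v: "v \<in> W" "qf b v > 0" "qf a v \<le> L * qf b v"
  shows "\<exists>u\<in>W. \<exists>\<mu>\<le>L. qf b u = 1 \<and> (\<forall>w\<in>W. a u w = of_real \<mu> * b u w)"
proof -
  have WX: "w \<in> X" if "w \<in> W" for w using that by (simp add: W_def)
  have W_add: "x + y \<in> W" if "x \<in> W" "y \<in> W" for x y
    using that e by (auto simp: W_def inX B.add_left)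
  have W_scale: "sc c x \<in> W" if "x \<in> W" for x c
    using that e by (auto simp: W_def inX B.scale_left)
  have Wsub: "A.subspace W"
    unfolding A.subspace_def using e W_add W_scale by (auto simp: W_def inX)
  define R where "R = qf a ` {w \<in> W. qf b w = 1}"
  have norm1: "qf b (sc (of_real (1 / sqrt (qf b w))) w) = 1"
      "qf a (sc (of_real (1 / sqrt (qf b w))) w) = qf a w / qf b w" if "w \<in> W" "qf b w > 0" for w
    using that WX[OF that(1)] by (simp_all add: A.q_scale B.q_scale norm_divide power_divide)
  have inR: "qf a w / qf b w \<in> R" if "w \<in> W" "qf b w > 0" for w
    unfolding R_def using norm1[OF that] W_scale[OF that(1)]
    by (intro image_eqI[where x="sc (of_real (1 / sqrt (qf b w))) w"]) auto
  have bdd: "bdd_below R"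
    by (rule bdd_belowI[of _ 0]) (auto simp: R_def intro!: A.nonneg WX)
  have ne: "R \<noteq> {}" using inR[OF v(1,2)] by auto
  define \<mu> where "\<mu> = Inf R"
  have "\<mu> \<le> qf a v / qf b v" unfolding \<mu>_def by (rule cInf_lower[OF inR[OF v(1,2)] bdd])
  also have "\<dots> \<le> L" using v by (simp add: field_simps)
  finally have muL: "\<mu> \<le> L" .
  have mu0: "\<mu> \<ge> 0" unfolding \<mu>_def by (rule cInf_greatest[OF ne]) (auto simp: R_def intro!: A.nonneg WX)
  have ge: "\<mu> * qf b w \<le> qf a w" if w: "w \<in> W" for w
  proof (cases "qf b w > 0")
    case True
    have "\<mu> \<le> qf a w / qf b w" unfolding \<mu>_def by (rule cInf_lower[OF inR[OF w True] bdd])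
    then show ?thesis using True by (simp add: field_simps)
  next
    case False
    then have "qf b w = 0" using B.nonneg[OF WX[OF w]] by simp
    then show ?thesis using A.nonneg[OF WX[OF w]] by simp
  qed
  have "\<exists>w\<in>W. qf b w = 1 \<and> qf a w < \<mu> + inverse (real (Suc m))" for m
    using cInf_less_iff[OF ne bdd, of "\<mu> + inverse (real (Suc m))"] by (auto simp: \<mu>_def R_def)
  then obtain f where f: "\<And>m. f m \<in> W" "\<And>m. qf b (f m) = 1" "\<And>m. qf a (f m) < \<mu> + inverse (real (Suc m))"
    by metis
  have fX: "f m \<in> X" for m using WX f by blast
  have "qf a (f m) + qf b (f m) \<le> \<mu> + 2" for m
  proof -
    have "inverse (real (Suc m)) \<le> 1" by (simp add: field_simps)
    then show ?thesis using f(2,3)[of m] by simp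
  qed
  then have "\<exists>r::nat \<Rightarrow> nat. strict_mono r \<and> qcauchy (qf b) (\<lambda>n. f (r n))"
    by (rule compact[OF fX])
  then obtain r :: "nat \<Rightarrow> nat" where r: "strict_mono r" "qcauchy (qf b) (\<lambda>n. f (r n))"
    by (elim exE conjE)
  define x where "x n = f (r n)" for n
  have x: "x m \<in> W" "x m \<in> X" "qf b (x m) = 1" for m unfolding x_def by (rule f fX)+
  have x_a: "qf a (x m) < \<mu> + inverse (real (Suc m))" for m
  proof -
    have "inverse (real (Suc (r m))) \<le> inverse (real (Suc m))"
      using seq_suble[OF r(1), of m] by (simp add: field_simps)
    then show ?thesis using f(3)[of "r m"] unfolding x_def by linarith
  qed
  have "qcauchy (\<lambda>u. qf a u + qf b u) x" unfolding qcauchy_def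
  proof (intro allI impI)
    fix \<epsilon> :: real assume \<epsilon>: "\<epsilon> > 0"
    \<comment> \<open>With d the mass of a difference, the parallelogram law bounds its energy plus
      mass by \<epsilon>/2 + (\<mu> + 1) d; the first term is four times the excess \<epsilon>/8 of
      each energy over \<mu>.\<close>
    then have "\<epsilon> / (2 * (\<mu> + 1)) > 0" using mu0 by simp
    then obtain N1 where N1: "\<And>m n. N1 \<le> m \<Longrightarrow> N1 \<le> n \<Longrightarrow> qf b (x m - x n) < \<epsilon> / (2 * (\<mu> + 1))"
      using r(2) unfolding qcauchy_def x_def by blast
    obtain N2 where N2: "inverse (real (Suc N2)) < \<epsilon> / 8" using reals_Archimedean[of "\<epsilon> / 8"] \<epsilon> by auto
    show "\<exists>N. \<forall>m\<ge>N. \<forall>n\<ge>N. qf a (x m - x n) + qf b (x m - x n) < \<epsilon>"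
    proof (intro exI[of _ "max N1 N2"] allI impI)
      fix m n assume mn: "max N1 N2 \<le> m" "max N1 N2 \<le> n"
      have small: "qf a (x m) < \<mu> + \<epsilon> / 8" if "N2 \<le> m" for m
      proof -
        have "inverse (real (Suc m)) \<le> inverse (real (Suc N2))" using that by (simp add: field_simps)
        then show ?thesis using x_a[of m] N2 by linarith
      qed
      let ?d = "qf b (x m - x n)"
      have "qf b (x m + x n) = 4 - ?d" using x by (simp add: B.q_add B.q_diff)
      then have "\<mu> * (4 - ?d) \<le> qf a (x m + x n)" using ge[OF W_add[OF x(1) x(1)]] by metis
      moreover have "qf a (x m - x n) = 2 * qf a (x m) + 2 * qf a (x n) - qf a (x m + x n)"
        using x by (simp add: A.q_add A.q_diff)
      moreover have "qf a (x m) < \<mu> + \<epsilon> / 8" "qf a (x n) < \<mu> + \<epsilon> / 8" using mn by (auto intro: small)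
      moreover have "(\<mu> + 1) * ?d < \<epsilon> / 2"
        using N1[of m n] mn mu0 by (simp add: field_simps)
      ultimately show "qf a (x m - x n) + qf b (x m - x n) < \<epsilon>"
        by (simp add: algebra_simps)
    qed
  qed
  then obtain u where u: "u \<in> X" and lim: "(\<lambda>n. qf a (x n - u) + qf b (x n - u)) \<longlonglongrightarrow> 0"
    using complete[of x] x by blast
  have xu: "x n - u \<in> X" for n using x u by (simp add: inX)
  have la: "(\<lambda>n. qf a (x n - u)) \<longlonglongrightarrow> 0"
    by (rule Lim_null_comparison[OF _ lim]) (use A.nonneg[OF xu] B.nonneg[OF xu] in auto)
  have lb: "(\<lambda>n. qf b (x n - u)) \<longlonglongrightarrow> 0"
    by (rule Lim_null_comparison[OF _ lim]) (use A.nonneg[OF xu] B.nonneg[OF xu] in auto)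
  have bu: "qf b u = 1"
    using B.tendsto_q[OF x(2) u lb] by (simp add: x LIMSEQ_const_iff)
  have "(\<lambda>n. \<mu> + inverse (real (Suc n))) \<longlonglongrightarrow> \<mu> + 0"
    by (intro tendsto_intros LIMSEQ_inverse_real_of_nat)
  then have "qf a u \<le> \<mu>"
    using LIMSEQ_le[OF A.tendsto_q[OF x(2) u la], of "\<lambda>n. \<mu> + inverse (real (Suc n))" \<mu>] x_a
    by (auto intro: less_imp_le)
  have uW: "u \<in> W"
  proof -
    have "b u (e i) = 0" if "i < k" for i
    proof -
      have "b (x n) (e i) = 0" for n using x(1)[of n] that by (simp add: W_def)
      then show ?thesis using B.tendsto_left[OF x(2) u e[OF that] lb] by (simp add: LIMSEQ_const_iff)
    qed
    then show ?thesis using u by (simp add: W_def)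
  qed
  have qq: "qf (\<lambda>x y. a x y - of_real \<mu> * b x y) w = qf a w - \<mu> * qf b w" for w by (simp add: qf_def)
  interpret Q: hform sc W "\<lambda>x y. a x y - of_real \<mu> * b x y"
  proof unfold_locales
    show "A.subspace W" by (rule Wsub)
  next
    fix x y z assume "x \<in> W" "y \<in> W" "z \<in> W"
    then show "a (x + y) z - of_real \<mu> * b (x + y) z = a x z - of_real \<mu> * b x z + (a y z - of_real \<mu> * b y z)"
      by (simp add: WX A.add_left B.add_left algebra_simps)
  next
    fix x z c assume "x \<in> W" "z \<in> W"
    then show "a (sc c x) z - of_real \<mu> * b (sc c x) z = c * (a x z - of_real \<mu> * b x z)"
      by (simp add: WX A.scale_left B.scale_left algebra_simps)
  next
    fix x y assume "x \<in> W" "y \<in> W"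
    then show "a y x - of_real \<mu> * b y x = cnj (a x y - of_real \<mu> * b x y)"
      using A.herm[of x y] B.herm[of x y] by (simp add: WX)
  next
    fix w assume "w \<in> W"
    then show "0 \<le> qf (\<lambda>x y. a x y - of_real \<mu> * b x y) w" using ge by (simp add: qq)
  qed
  \<comment> \<open>\<open>u\<close> has length 0 for the shifted form, hence is orthogonal to
    \<open>W\<close> for it.\<close>
  have "a u w = of_real \<mu> * b u w" if w: "w \<in> W" for w
  proof -
    have "qf (\<lambda>x y. a x y - of_real \<mu> * b x y) u = 0"
      using ge[OF uW] \<open>qf a u \<le> \<mu>\<close> bu unfolding qq by simp
    then show ?thesis using Q.Cauchy_Schwarz[OF uW w] by simp
  qed
  then show ?thesis using uW muL bu by blast
qed

text \<open>The half of the min-max principle that creates eigenvectors. Each minimization takes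
  place on the \<open>b\<close>-orthogonal complement of the k < n eigenvectors found so far; by
  dimension the trial space contains a vector of that complement, and this keeps the minimum at most
  \<open>L\<close>. The last hypothesis is independence modulo vectors of length 0.\<close>

theorem eigenvectors:
  fixes n :: nat
  assumes v: "\<And>i. i < n \<Longrightarrow> v i \<in> X"
    and le: "\<And>c. qf a (\<Sum>i<n. sc (c i) (v i)) \<le> L * qf b (\<Sum>i<n. sc (c i) (v i))"
    and indep: "\<And>c. qf b (\<Sum>i<n. sc (c i) (v i)) = 0 \<Longrightarrow> \<forall>i<n. c i = 0"
  shows "\<exists>e \<mu>. (\<forall>i<n. e i \<in> X \<and> \<mu> i \<le> L \<and> (\<forall>w\<in>X. a (e i) w = of_real (\<mu> i) * b (e i) w))
      \<and> (\<forall>i<n. \<forall>j<n. b (e i) (e j) = (if i = j then 1 else 0))"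
proof -
  have "\<exists>e \<mu>. (\<forall>i<k. e i \<in> X \<and> \<mu> i \<le> L \<and> (\<forall>w\<in>X. a (e i) w = of_real (\<mu> i) * b (e i) w))
      \<and> (\<forall>i<k. \<forall>j<k. b (e i) (e j) = (if i = j then 1 else 0))" if "k \<le> n" for k
    using that
  proof (induction k)
    case (Suc k)
    have "\<exists>e \<mu>. (\<forall>i<k. e i \<in> X \<and> \<mu> i \<le> L \<and> (\<forall>w\<in>X. a (e i) w = of_real (\<mu> i) * b (e i) w))
      \<and> (\<forall>i<k. \<forall>j<k. b (e i) (e j) = (if i = j then 1 else 0))"
      by (rule Suc.IH) (use Suc.prems in simp)
    then obtain e and \<mu> :: "nat \<Rightarrow> real"
      where IH: "\<forall>i<k. e i \<in> X \<and> \<mu> i \<le> L \<and> (\<forall>w\<in>X. a (e i) w = of_real (\<mu> i) * b (e i) w)"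
        and on: "\<And>i j. i < k \<Longrightarrow> j < k \<Longrightarrow> b (e i) (e j) = (if i = j then 1 else 0)"
      by (elim exE conjE) simp
    then have e: "\<And>i. i < k \<Longrightarrow> e i \<in> X" "\<And>i. i < k \<Longrightarrow> \<mu> i \<le> L"
        "\<And>i w. i < k \<Longrightarrow> w \<in> X \<Longrightarrow> a (e i) w = of_real (\<mu> i) * b (e i) w"
      by simp_all
    define W where "W = {w \<in> X. \<forall>i<k. b w (e i) = 0}"
    obtain c where c: "\<exists>j<n. c j \<noteq> 0" "\<And>i. i < k \<Longrightarrow> (\<Sum>j<n. b (v j) (e i) * c j) = 0"
      using nontrivial_solution[of k n "\<lambda>i j. b (v j) (e i)"] Suc.prems by auto
    define z where "z = (\<Sum>j<n. sc (c j) (v j))"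
    have zX: "z \<in> X" unfolding z_def by (intro inX v) auto
    have "b z (e i) = 0" if "i < k" for i
    proof -
      have "b z (e i) = (\<Sum>j<n. b (v j) (e i) * c j)"
        unfolding z_def using v e(1)[OF that] by (subst B.sum_left) (auto simp: inX B.scale_left mult.commute)
      then show ?thesis using c(2)[OF that] by simp
    qed
    then have zW: "z \<in> W" using zX by (simp add: W_def)
    have "qf b z \<noteq> 0" using indep[of c] c(1) by (auto simp: z_def)
    then have zb: "qf b z > 0" using B.nonneg[OF zX] by simp
    have za: "qf a z \<le> L * qf b z" unfolding z_def by (rule le)
    obtain u m where u: "u \<in> W" "m \<le> L" "qf b u = 1" "\<And>w. w \<in> W \<Longrightarrow> a u w = of_real m * b u w"
      using minimizer[where e=e and k=k and v=z and L=L, folded W_def, OF e(1) zW zb za] by blast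
    have uX: "u \<in> X" and ue: "\<And>i. i < k \<Longrightarrow> b u (e i) = 0" using u(1) by (auto simp: W_def)
    have eu: "b (e i) u = 0" if "i < k" for i
      using B.herm[OF uX e(1)[OF that]] ue[OF that] by simp
    have aue: "a u (e i) = 0" if "i < k" for i
      using A.herm[OF e(1)[OF that] uX] e(3)[OF that uX] eu[OF that] by simp
    have eig: "a u w = of_real m * b u w" if w: "w \<in> X" for w
    proof -
      \<comment> \<open>Splitting off the projection \<open>p\<close> extends the equation from the
        complement to all of \<open>X\<close>: the earlier eigenvectors are orthogonal to
        \<open>u\<close> for \<open>b\<close> by the constraint, and for \<open>a\<close> because
        they are eigenvectors.\<close>
      define p where "p = (\<Sum>i<k. sc (b w (e i)) (e i))"
      have pX: "p \<in> X" unfolding p_def by (intro inX e) auto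
      have "a u p = 0" unfolding p_def
        using e(1) uX aue by (subst A.sum_right) (auto simp: inX A.scale_right)
      moreover have "b u p = 0" unfolding p_def
        using e(1) uX ue by (subst B.sum_right) (auto simp: inX B.scale_right)
      moreover have "w - p \<in> W"
      proof -
        have "b p (e j) = b w (e j)" if j: "j < k" for j
        proof -
          have "b p (e j) = (\<Sum>i<k. b w (e i) * b (e i) (e j))" unfolding p_def
            using e(1) j by (subst B.sum_left) (auto simp: inX B.scale_left)
          also have "\<dots> = (\<Sum>i<k. if i = j then b w (e j) else 0)"
            by (intro sum.cong refl) (use j in \<open>auto simp: on\<close>)
          finally show ?thesis using j by simp
        qed
        then show ?thesis using w pX e(1) by (simp add: W_def inX B.diff_left)
      qed
      ultimately show ?thesis
        using u(4)[of "w - p"] w pX uX by (simp add: A.diff_right B.diff_right)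
    qed
    show ?case
      by (intro exI[of _ "e(k := u)"] exI[of _ "\<mu>(k := m)"])
        (use e u(2) uX eig on eu ue u(3) B.self[OF uX] in \<open>auto simp: less_Suc_eq\<close>)
  qed auto
  then show ?thesis by blast
qed

text \<open>The converse half. Eigenvectors with distinct eigenvalues are
  \<open>b\<close>-orthogonal, while those sharing an eigenvalue may have any position. Weighting
  the i-th coefficient with \<open>sqrt (L - \<mu> i)\<close> exhibits \<open>L b - a\<close> on the
  span as a value of \<open>qf b\<close>.\<close>

lemma eigen_span_le:
  fixes n :: nat
  assumes v: "\<And>i. i < n \<Longrightarrow> v i \<in> X" and \<mu>: "\<And>i. i < n \<Longrightarrow> \<mu> i \<le> L"
    and eig: "\<And>i w. i < n \<Longrightarrow> w \<in> X \<Longrightarrow> a (v i) w = of_real (\<mu> i) * b (v i) w"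
  shows "qf a (\<Sum>i<n. sc (c i) (v i)) \<le> L * qf b (\<Sum>i<n. sc (c i) (v i))"
proof -
  define d where "d i = of_real (sqrt (L - \<mu> i)) * c i" for i
  have orth: "b (v i) (v j) = 0" if "i < n" "j < n" "\<mu> i \<noteq> \<mu> j" for i j
  proof -
    have "of_real (\<mu> j) * b (v j) (v i) = cnj (of_real (\<mu> i) * b (v i) (v j))"
      using A.herm[OF v[OF that(1)] v[OF that(2)]] eig v that by simp
    also have "\<dots> = of_real (\<mu> i) * b (v j) (v i)"
      using B.herm[OF v[OF that(1)] v[OF that(2)]] by simp
    finally have "b (v j) (v i) = 0" using that by simp
    then show ?thesis using B.herm[OF v[OF that(2)] v[OF that(1)]] by simp
  qed
  have expand: "s (\<Sum>i<n. sc (x i) (v i)) (\<Sum>i<n. sc (x i) (v i)) = (\<Sum>i<n. \<Sum>j<n. x i * cnj (x j) * s (v i) (v j))"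
    if "hform sc X s" for s x
  proof -
    interpret S: hform sc X s by fact
    have VX: "(\<Sum>i<n. sc (x i) (v i)) \<in> X" by (intro inX v) auto
    have "s (\<Sum>i<n. sc (x i) (v i)) (\<Sum>i<n. sc (x i) (v i)) = (\<Sum>i<n. x i * s (v i) (\<Sum>i<n. sc (x i) (v i)))"
      using v VX by (subst S.sum_left) (auto simp: S.scale_left inX)
    also have "\<dots> = (\<Sum>i<n. x i * (\<Sum>j<n. cnj (x j) * s (v i) (v j)))"
      by (intro sum.cong refl arg_cong2[where f="(*)"], subst S.sum_right) (use v in \<open>auto simp: S.scale_right inX\<close>)
    finally show ?thesis by (simp add: sum_distrib_left mult.assoc)
  qed
  have "complex_of_real (L * qf b (\<Sum>i<n. sc (c i) (v i)) - qf a (\<Sum>i<n. sc (c i) (v i)))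
     = of_real L * b (\<Sum>i<n. sc (c i) (v i)) (\<Sum>i<n. sc (c i) (v i)) - a (\<Sum>i<n. sc (c i) (v i)) (\<Sum>i<n. sc (c i) (v i))"
  proof -
    have VX: "(\<Sum>i<n. sc (c i) (v i)) \<in> X" by (intro inX v) auto
    show ?thesis using A.self[OF VX] B.self[OF VX] by simp
  qed
  also have "\<dots> = (\<Sum>i<n. \<Sum>j<n. of_real (L - \<mu> i) * (c i * cnj (c j) * b (v i) (v j)))"
    unfolding expand[OF A.hform_axioms] expand[OF B.hform_axioms] sum_distrib_left sum_subtractf[symmetric]
    by (intro sum.cong refl) (simp add: eig v algebra_simps)
  also have "\<dots> = (\<Sum>i<n. \<Sum>j<n. d i * cnj (d j) * b (v i) (v j))"
  proof (intro sum.cong refl)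
    fix i j assume ij: "i \<in> {..<n}" "j \<in> {..<n}"
    show "of_real (L - \<mu> i) * (c i * cnj (c j) * b (v i) (v j)) = d i * cnj (d j) * b (v i) (v j)"
    \<comment> \<open>For equal eigenvalues the two square roots multiply back to
      \<open>L - \<mu> i\<close>; otherwise orthogonality makes both sides vanish.\<close>
    proof (cases "\<mu> i = \<mu> j")
      case True
      have "complex_of_real (L - \<mu> i) = of_real (sqrt (L - \<mu> i)) * of_real (sqrt (L - \<mu> j))"
        using \<mu>[of i] ij True by (simp flip: of_real_mult)
      then show ?thesis by (simp only: d_def) (simp add: ac_simps)
    next
      case False
      then show ?thesis using orth ij by simp
    qed
  qed
  also have "\<dots> = b (\<Sum>i<n. sc (d i) (v i)) (\<Sum>i<n. sc (d i) (v i))"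
    unfolding expand[OF B.hform_axioms] ..
  also have "\<dots> = of_real (qf b (\<Sum>i<n. sc (d i) (v i)))" by (intro B.self inX v) auto
  finally have "L * qf b (\<Sum>i<n. sc (c i) (v i)) - qf a (\<Sum>i<n. sc (c i) (v i)) = qf b (\<Sum>i<n. sc (d i) (v i))"
    using of_real_eq_iff by blast
  moreover have "0 \<le> qf b (\<Sum>i<n. sc (d i) (v i))" by (intro B.nonneg inX v) auto
  ultimately show ?thesis by linarith
qed

end

section \<open>Square integrable functions on the cell\<close>

lemma norm_add_square_le:
  fixes a b :: "'b::real_inner"
  shows "(norm (a + b))\<^sup>2 \<le> 2 * (norm a)\<^sup>2 + 2 * (norm b)\<^sup>2"
proof -
  have "(norm (a + b))\<^sup>2 + (norm (a - b))\<^sup>2 = 2 * (norm a)\<^sup>2 + 2 * (norm b)\<^sup>2"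
    by (simp add: power2_norm_eq_inner inner_add_left inner_add_right inner_diff_left inner_diff_right)
  then show ?thesis using zero_le_power2[of "norm (a - b)"] by linarith
qed

lemma integrable_norm_diff_square:
  fixes f g :: "'a \<Rightarrow> 'b::euclidean_space"
  assumes [measurable]: "f \<in> borel_measurable M" "g \<in> borel_measurable M"
    and "integrable M (\<lambda>x. (norm (f x))\<^sup>2)" "integrable M (\<lambda>x. (norm (g x))\<^sup>2)"
  shows "integrable M (\<lambda>x. (norm (f x - g x))\<^sup>2)"
proof (rule Bochner_Integration.integrable_bound)
  show "integrable M (\<lambda>x. 2 * (norm (f x))\<^sup>2 + 2 * (norm (g x))\<^sup>2)" using assms by simp
  show "AE x in M. norm ((norm (f x - g x))\<^sup>2) \<le> norm (2 * (norm (f x))\<^sup>2 + 2 * (norm (g x))\<^sup>2)"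
  proof (rule AE_I2)
    fix x show "norm ((norm (f x - g x))\<^sup>2) \<le> norm (2 * (norm (f x))\<^sup>2 + 2 * (norm (g x))\<^sup>2)"
      using norm_add_square_le[of "f x" "- g x"] by simp
  qed
qed measurable

text \<open>The limit is a pointwise limit of a subsequence, so that it inherits periodicity.\<close>
lemma square_integrable_complete:
  fixes u :: "nat \<Rightarrow> 'a \<Rightarrow> 'b::euclidean_space"
  assumes meas[measurable]: "\<And>n. u n \<in> borel_measurable M"
    and int: "\<And>n. integrable M (\<lambda>x. (norm (u n x))\<^sup>2)"
    and cauchy: "\<And>e. e > 0 \<Longrightarrow> \<exists>N. \<forall>m\<ge>N. \<forall>n\<ge>N. (LINT x|M. (norm (u m x - u n x))\<^sup>2) < e"
  obtains r :: "nat \<Rightarrow> nat" and g where "g = (\<lambda>x. lim (\<lambda>k. u (r k) x))" "g \<in> borel_measurable M"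
    "integrable M (\<lambda>x. (norm (g x))\<^sup>2)" "(\<lambda>n. LINT x|M. (norm (u n x - g x))\<^sup>2) \<longlonglongrightarrow> 0"
proof -
  have intd: "integrable M (\<lambda>x. (norm (u m x - u n x))\<^sup>2)" for m n
    by (rule integrable_norm_diff_square[OF meas meas int int])
  have nnd: "(\<integral>\<^sup>+x. ennreal ((norm (u m x - u n x))\<^sup>2) \<partial>M) = ennreal (LINT x|M. (norm (u m x - u n x))\<^sup>2)" for m n
    by (rule nn_integral_eq_integral[OF intd]) simp
  \<comment> \<open>The rate 16^-k leaves a summable 4^-k once the squared increments are weighted
    by 4^k.\<close>
  have "\<exists>N. \<forall>k. \<forall>m\<ge>N k. \<forall>n\<ge>N k. (LINT x|M. (norm (u m x - u n x))\<^sup>2) < (1/16)^k"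
    by (intro choice allI cauchy) simp
  then obtain N where N: "\<And>k m n. m \<ge> N k \<Longrightarrow> n \<ge> N k \<Longrightarrow> (LINT x|M. (norm (u m x - u n x))\<^sup>2) < (1/16)^k"
    by blast
  \<comment> \<open>Adding \<open>k\<close> and all earlier \<open>N i\<close> ensures both
    \<open>r k \<ge> k\<close> and \<open>r j \<ge> N k\<close> for every
    \<open>j \<ge> k\<close>.\<close>
  define r where "r k = k + (\<Sum>i\<le>k. N i)" for k
  have rN: "r j \<ge> N k" if "k \<le> j" for j k
    using member_le_sum[of k "{..j}" N] that by (simp add: r_def)
  have r_ge: "r k \<ge> k" for k by (simp add: r_def)
  define d where "d k x = u (r (Suc k)) x - u (r k) x" for k x
  have [measurable]: "d k \<in> borel_measurable M" for k unfolding d_def by measurable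
  have "(\<integral>\<^sup>+x. ennreal (4^k * (norm (d k x))\<^sup>2) \<partial>M) \<le> ennreal ((1/4)^k)" for k
  proof -
    have "(LINT x|M. (norm (d k x))\<^sup>2) \<le> (1/16)^k"
      unfolding d_def using N[of k "r (Suc k)" "r k"] rN[of k "Suc k"] rN[of k k] by simp
    then have "4^k * (LINT x|M. (norm (d k x))\<^sup>2) \<le> 4^k * (1/16)^k" by (intro mult_left_mono) auto
    also have "4^k * (1/16)^k = ((1/4)^k :: real)" by (simp flip: power_mult_distrib)
    finally have "4^k * (LINT x|M. (norm (d k x))\<^sup>2) \<le> (1/4)^k" .
    moreover have "(\<integral>\<^sup>+x. ennreal (4^k * (norm (d k x))\<^sup>2) \<partial>M) = ennreal (4^k * (LINT x|M. (norm (d k x))\<^sup>2))"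
      using intd[of "r (Suc k)" "r k"] by (subst nn_integral_eq_integral) (auto simp: d_def)
    ultimately show ?thesis by (simp add: ennreal_leI)
  qed
  then have "(\<integral>\<^sup>+x. (\<Sum>k. ennreal (4^k * (norm (d k x))\<^sup>2)) \<partial>M) \<le> (\<Sum>k. ennreal ((1/4)^k))"
    by (subst nn_integral_suminf) (auto intro!: suminf_le)
  also have "\<dots> < \<infinity>"
    by (subst suminf_ennreal2) (auto intro!: summable_geometric)
  finally have "AE x in M. (\<Sum>k. ennreal (4^k * (norm (d k x))\<^sup>2)) \<noteq> \<infinity>"
    by (intro nn_integral_PInf_AE) auto
  then have conv: "AE x in M. convergent (\<lambda>k. u (r k) x)"
  proof (rule AE_mp, intro AE_I2 impI)
    fix x assume "(\<Sum>k. ennreal (4^k * (norm (d k x))\<^sup>2)) \<noteq> \<infinity>"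
    then have sm: "summable (\<lambda>k. 4^k * (norm (d k x))\<^sup>2)"
      by (intro summable_suminf_not_top) auto
    have "norm (norm (d k x)) \<le> (4^k * (norm (d k x))\<^sup>2) + (1/4)^k" for k
    proof -
      \<comment> \<open>The weight is spent here: completing the square bounds the norm of an
        increment by its weighted square plus 4^-k, so the telescoping series converges
        absolutely.\<close>
      have "0 \<le> (2^k * norm (d k x) - (1/2)^k)\<^sup>2" by simp
      also have "\<dots> = 4^k * (norm (d k x))\<^sup>2 + (1/4)^k - 2 * (2^k * (1/2)^k) * norm (d k x)"
        by (simp add: power2_diff power_mult_distrib flip: power_mult power_even_eq)
           (simp add: power_mult power2_eq_square flip: power_mult_distrib)
      also have "2^k * (1/2)^k = (1::real)" by (simp flip: power_mult_distrib)
      finally have "2 * norm (d k x) \<le> 4^k * (norm (d k x))\<^sup>2 + (1/4)^k" by simp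
      then show ?thesis unfolding real_norm_def abs_norm_cancel using norm_ge_zero[of "d k x"] by linarith
    qed
    then have "summable (\<lambda>k. norm (d k x))"
      by (intro summable_comparison_test'[OF summable_add[OF sm summable_geometric[of "1/4"]]]) auto
    then have "summable (\<lambda>k. d k x)" by (rule summable_norm_cancel)
    then have "convergent (\<lambda>n. \<Sum>k<n. d k x)" by (simp add: summable_iff_convergent)
    then have "convergent (\<lambda>n. u (r n) x - u (r 0) x)"
      using sum_lessThan_telescope[of "\<lambda>k. u (r k) x"] by (simp add: d_def)
    then show "convergent (\<lambda>k. u (r k) x)" by (simp add: convergent_diff_const_right_iff)
  qed
  define g where "g x = lim (\<lambda>k. u (r k) x)" for x
  have [measurable]: "g \<in> borel_measurable M" unfolding g_def by measurable
  have limg: "AE x in M. (\<lambda>k. u (r k) x) \<longlonglongrightarrow> g x"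
    using conv by eventually_elim (simp add: g_def convergent_LIMSEQ_iff)
  \<comment> \<open>Fatou's lemma passes the Cauchy estimate to the limit in the second argument,
    before \<open>g\<close> is known to be square integrable.\<close>
  have fatou: "(\<integral>\<^sup>+x. ennreal ((norm (u n x - g x))\<^sup>2) \<partial>M) \<le> ennreal e"
    if "e > 0" and M: "\<And>m. m \<ge> M0 \<Longrightarrow> (LINT x|M. (norm (u n x - u m x))\<^sup>2) < e" for n e M0
  proof -
    have "(\<integral>\<^sup>+x. ennreal ((norm (u n x - g x))\<^sup>2) \<partial>M)
        = (\<integral>\<^sup>+x. liminf (\<lambda>k. ennreal ((norm (u n x - u (r k) x))\<^sup>2)) \<partial>M)"
    proof (rule nn_integral_cong_AE, use limg in eventually_elim)
      case (elim x)
      have "(\<lambda>k. ennreal ((norm (u n x - u (r k) x))\<^sup>2)) \<longlonglongrightarrow> ennreal ((norm (u n x - g x))\<^sup>2)"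
        by (intro tendsto_intros elim)
      then show ?case by (rule lim_imp_Liminf[OF trivial_limit_sequentially, symmetric])
    qed
    also have "\<dots> \<le> liminf (\<lambda>k. \<integral>\<^sup>+x. ennreal ((norm (u n x - u (r k) x))\<^sup>2) \<partial>M)"
      by (rule nn_integral_liminf) measurable
    also have "\<dots> = liminf (\<lambda>k. ennreal (LINT x|M. (norm (u n x - u (r k) x))\<^sup>2))" by (simp add: nnd)
    also have "\<dots> \<le> liminf (\<lambda>k. ennreal e)"
    proof (rule Liminf_mono, unfold eventually_sequentially, intro exI[of _ M0] allI impI)
      fix k assume "M0 \<le> k"
      then have "M0 \<le> r k" using r_ge[of k] by simp
      then show "ennreal (LINT x|M. (norm (u n x - u (r k) x))\<^sup>2) \<le> ennreal e"
        using M[of "r k"] by (intro ennreal_leI) simp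
    qed
    also have "\<dots> = ennreal e" by (simp add: Liminf_const)
    finally show ?thesis .
  qed
  have intdg: "integrable M (\<lambda>x. (norm (u n x - g x))\<^sup>2)" if "n \<ge> N 0" for n
  proof -
    have "(\<integral>\<^sup>+x. ennreal ((norm (u n x - g x))\<^sup>2) \<partial>M) \<le> ennreal 1"
      by (rule fatou[of _ "N 0"]) (use that N[of 0] in auto)
    then show ?thesis by (intro integrableI_bounded) (auto simp: ennreal_one_less_top intro: le_less_trans)
  qed
  have intg: "integrable M (\<lambda>x. (norm (g x))\<^sup>2)"
    using integrable_norm_diff_square[OF _ _ int[of "N 0"] intdg[of "N 0"]] by simp
  have "(\<lambda>n. LINT x|M. (norm (u n x - g x))\<^sup>2) \<longlonglongrightarrow> 0"
  proof (rule LIMSEQ_I)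
    fix e :: real assume e: "e > 0"
    then obtain N1 where N1: "\<forall>m\<ge>N1. \<forall>n\<ge>N1. (LINT x|M. (norm (u m x - u n x))\<^sup>2) < e / 2"
      using cauchy[of "e/2"] by auto
    show "\<exists>no. \<forall>n\<ge>no. norm ((LINT x|M. (norm (u n x - g x))\<^sup>2) - 0) < e"
    proof (intro exI[of _ "max N1 (N 0)"] allI impI)
      fix n assume n: "max N1 (N 0) \<le> n"
      have "(\<integral>\<^sup>+x. ennreal ((norm (u n x - g x))\<^sup>2) \<partial>M) \<le> ennreal (e / 2)"
        by (rule fatou[of _ N1]) (use e N1 n in auto)
      moreover have "(\<integral>\<^sup>+x. ennreal ((norm (u n x - g x))\<^sup>2) \<partial>M) = ennreal (LINT x|M. (norm (u n x - g x))\<^sup>2)"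
        by (rule nn_integral_eq_integral[OF intdg]) (use n in auto)
      ultimately have "(LINT x|M. (norm (u n x - g x))\<^sup>2) \<le> e / 2" using e by simp
      moreover have "(LINT x|M. (norm (u n x - g x))\<^sup>2) \<ge> 0" by (rule Bochner_Integration.integral_nonneg) simp
      ultimately show "norm ((LINT x|M. (norm (u n x - g x))\<^sup>2) - 0) < e" using e by simp
    qed
  qed
  then show thesis using that[of g r] intg by (simp add: g_def[abs_def])
qed

section \<open>Lebesgue measure on the unit cell\<close>

abbreviation cell :: "(real^'n) measure" where
  "cell \<equiv> lebesgue_on cube"

lemma cube_lebesgue [simp, intro]: "cube \<in> sets lebesgue"
  by (simp add: cube_def)

lemma emeasure_cell: "emeasure cell (cube :: (real^'n) set) = 1"
  by (simp add: cube_def emeasure_restrict_space emeasure_lborel_cbox_eq)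

lemma finite_measure_cell [simp]: "finite_measure (cell :: (real^'n) measure)"
  by (rule finite_measureI) (simp add: emeasure_cell)

lemma AE_cell: "AE y in lebesgue. P y \<Longrightarrow> AE y in cell. P y"
  by (simp add: AE_restrict_space_iff, erule eventually_mono) simp

lemma AE_cell_cube: "AE y in (cell :: (real^'n) measure). y \<in> cube"
  by (rule AE_I2) simp

lemma borel_measurable_cell: "f \<in> borel_measurable lebesgue \<Longrightarrow> f \<in> borel_measurable cell"
  by (rule measurable_restrict_space1)

lemma continuous_borel_measurable_cell:
  fixes f :: "real^'n \<Rightarrow> 'b::euclidean_space"
  shows "continuous_on UNIV f \<Longrightarrow> f \<in> borel_measurable cell"
  by (intro borel_measurable_cell measurable_completion) (simp add: borel_measurable_continuous_onI)

lemma L2_bilinear_integrable: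
  fixes h :: "real^'n \<Rightarrow> 'c::{banach,second_countable_topology}"
  assumes f: "L2 f" and g: "L2 g" and [measurable]: "h \<in> borel_measurable cell"
    and le: "AE y in cell. norm (h y) \<le> C * norm (f y) * norm (g y)"
  shows "integrable cell h"
proof (rule Bochner_Integration.integrable_bound)
  show "integrable cell (\<lambda>y. \<bar>C\<bar> * ((norm (f y))\<^sup>2 + (norm (g y))\<^sup>2))"
    using f g by (auto simp: L2_def)
  show "AE y in cell. norm (h y) \<le> norm (\<bar>C\<bar> * ((norm (f y))\<^sup>2 + (norm (g y))\<^sup>2))"
    using le
  proof eventually_elim
    case (elim y)
    have "norm (f y) * norm (g y) \<le> (norm (f y))\<^sup>2 + (norm (g y))\<^sup>2"
      using sum_squares_bound[of "norm (f y)" "norm (g y)"] mult_nonneg_nonneg[OF norm_ge_zero norm_ge_zero, of "f y" "g y"]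
      by linarith
    then have "\<bar>C\<bar> * (norm (f y) * norm (g y)) \<le> \<bar>C\<bar> * ((norm (f y))\<^sup>2 + (norm (g y))\<^sup>2)"
      by (intro mult_left_mono) auto
    moreover have "C * (norm (f y) * norm (g y)) \<le> \<bar>C\<bar> * (norm (f y) * norm (g y))"
      by (intro mult_right_mono) auto
    ultimately show ?case using elim by (simp add: mult.assoc)
  qed
qed measurable

lemma L2_add: "L2 f \<Longrightarrow> L2 g \<Longrightarrow> L2 (\<lambda>y. f y + g y)"
  unfolding L2_def using integrable_norm_diff_square[of f cell "\<lambda>y. - g y"]
  by (simp add: borel_measurable_add)

lemma L2_bound:
  fixes f :: "real^'n \<Rightarrow> 'b::euclidean_space" and h :: "real^'n \<Rightarrow> 'c::euclidean_space"
  assumes f: "L2 f" and m: "h \<in> borel_measurable cell" and le: "AE y in cell. norm (h y) \<le> C * norm (f y)"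
  shows "L2 h"
  unfolding L2_def
proof (intro conjI m)
  show "integrable cell (\<lambda>y. (norm (h y))\<^sup>2)"
  proof (rule L2_bilinear_integrable[OF f f])
    show "AE y in cell. norm ((norm (h y))\<^sup>2) \<le> C\<^sup>2 * norm (f y) * norm (f y)"
      using le
    proof eventually_elim
      case (elim y)
      then have "(norm (h y))\<^sup>2 \<le> (C * norm (f y))\<^sup>2" by (intro power_mono) auto
      then show ?case by (simp add: power_mult_distrib power2_eq_square ac_simps)
    qed
  qed (use m in measurable)
qed

lemma L2_const: "L2 (\<lambda>y::real^'n. c::'b::euclidean_space)"
  using finite_measure.integrable_const[OF finite_measure_cell] by (simp add: L2_def)

lemma L2_bounded:
  fixes h :: "real^'n \<Rightarrow> 'c::euclidean_space"
  assumes m: "h \<in> borel_measurable cell" and le: "AE y in cell. norm (h y) \<le> C"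
  shows "L2 h"
  by (rule L2_bound[OF L2_const[of "1::real"] m]) (use le in simp)

lemma L2_integrable:
  fixes f :: "real^'n \<Rightarrow> 'c::euclidean_space"
  assumes "L2 f"
  shows "integrable cell f"
  by (rule L2_bilinear_integrable[where g="\<lambda>_. 1::real" and C=1, OF assms L2_const])
    (use assms in \<open>simp_all add: L2_def\<close>)

lemma L2_complete:
  fixes u :: "nat \<Rightarrow> real^'n \<Rightarrow> 'b::euclidean_space"
  assumes u: "\<And>n. L2 (u n)"
    and cauchy: "\<And>e. e > 0 \<Longrightarrow> \<exists>N. \<forall>m\<ge>N. \<forall>n\<ge>N. (LINT x|cell. (norm (u m x - u n x))\<^sup>2) < e"
  obtains g where "L2 g" "(\<forall>n. periodic (u n)) \<Longrightarrow> periodic g" "(\<lambda>n. LINT x|cell. (norm (u n x - g x))\<^sup>2) \<longlonglongrightarrow> 0"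
proof -
  obtain r g where g: "g = (\<lambda>x. lim (\<lambda>k. u (r k) x))" "g \<in> borel_measurable cell"
    "integrable cell (\<lambda>x. (norm (g x))\<^sup>2)" "(\<lambda>n. LINT x|cell. (norm (u n x - g x))\<^sup>2) \<longlonglongrightarrow> 0"
    by (rule square_integrable_complete[OF _ _ cauchy]) (use u in \<open>auto simp: L2_def\<close>)
  have "periodic g" if "\<forall>n. periodic (u n)"
    using that unfolding periodic_def g(1) by simp
  then show thesis using g that[of g] by (simp add: L2_def)
qed

section \<open>Fourier series on the torus\<close>

definition lattice :: "(real^'n) set" where
  "lattice = {k. \<forall>i. k$i \<in> \<int>}"

definition chr :: "real^'n \<Rightarrow> real^'n \<Rightarrow> complex" where
  "chr k y = cis (2 * pi * (k \<bullet> y))"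

lemma lattice_inner: "k \<in> lattice \<Longrightarrow> m \<in> lattice \<Longrightarrow> k \<bullet> m \<in> \<int>"
  by (auto simp: lattice_def inner_vec_def intro!: Ints_sum Ints_mult)

lemma lattice_closed:
  "k \<in> lattice \<Longrightarrow> l \<in> lattice \<Longrightarrow> k + l \<in> lattice"
  "k \<in> lattice \<Longrightarrow> - k \<in> lattice"
  "0 \<in> lattice"
  "axis i 1 \<in> lattice"
  by (auto simp: lattice_def axis_def)

lemma chr_add: "chr (k + l) y = chr k y * chr l y"
  by (simp add: chr_def inner_add_left ring_distribs cis_mult)

lemma chr_uminus: "chr (- k) y = cnj (chr k y)"
  by (simp add: chr_def cis_cnj)

lemma chr_0 [simp]: "chr 0 y = 1"
  by (simp add: chr_def)

lemma norm_chr [simp]: "cmod (chr k y) = 1"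
  by (simp add: chr_def)

lemma periodic_chr: "k \<in> lattice \<Longrightarrow> periodic (chr k)"
  using lattice_inner[of k]
  by (auto simp: periodic_def chr_def inner_add_right ring_distribs lattice_def simp flip: cis_mult)

lemma continuous_chr [continuous_intros]: "continuous_on S (chr k)"
  unfolding chr_def by (intro continuous_intros)

lemma chr_measurable [measurable]: "chr k \<in> borel_measurable cell"
  by (rule continuous_borel_measurable_cell[OF continuous_chr])

lemma L2_chr: "L2 (chr k)"
  by (rule L2_bounded[where C=1]) auto

lemma has_bochner_integral_cis:
  assumes "m \<in> \<int>"
  shows "has_bochner_integral lborel (\<lambda>t. indicator {0..1} t *\<^sub>R cis (2 * pi * m * t)) (if m = 0 then 1 else 0)"
proof (cases "m = 0")
  case True
  have "has_bochner_integral lborel (\<lambda>t::real. indicator {0..1} t *\<^sub>R (1::complex)) (of_real 1 - of_real 0)"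
    by (rule has_bochner_integral_FTC_Icc) (auto intro!: derivative_eq_intros)
  then show ?thesis using True by simp
next
  case False
  let ?c = "2 * pi * m"
  let ?F = "\<lambda>t::real. exp (\<i> * of_real ?c * of_real t) / (\<i> * of_real ?c)"
  have "((\<lambda>z. exp (\<i> * of_real ?c * z) / (\<i> * of_real ?c)) has_field_derivative cis (?c * t)) (at (of_real t))" for t
    using False by (auto intro!: derivative_eq_intros simp: cis_conv_exp mult.assoc)
  then have "(?F has_vector_derivative cis (?c * t)) (at t within {0..1})" for t
    by (intro has_vector_derivative_real_field has_vector_derivative_at_within)
  then have "has_bochner_integral lborel (\<lambda>t. indicator {0..1} t *\<^sub>R cis (?c * t)) (?F 1 - ?F 0)"
    by (intro has_bochner_integral_FTC_Icc) (auto intro!: continuous_intros)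
  moreover have "exp (\<i> * of_real ?c) = 1"
    using cis_multiple_2pi[OF assms] by (simp add: cis_conv_exp)
  ultimately show ?thesis using False by simp
qed

text \<open>A character factorizes over the coordinates, and Lebesgue measure is the image of a
  product measure, so the integral is a product of one-dimensional ones. A single nonzero frequency
  makes it vanish.\<close>

lemma integral_chr:
  fixes k :: "real^'n"
  assumes k: "k \<in> lattice"
  shows "(LINT y|cell. chr k y) = (if k = 0 then 1 else 0)"
proof -
  define G where "G b t = indicator {0..1} t *\<^sub>R cis (2 * pi * (k \<bullet> b) * t)" for b and t :: real
  have kb: "k \<bullet> b \<in> \<int>" if "b \<in> Basis" for b
    using that k by (auto simp: Basis_vec_def lattice_def inner_axis)
  have split: "indicator cube y *\<^sub>R chr k y = (\<Prod>b\<in>Basis. G b (y \<bullet> b))" for y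
  proof -
    have "chr k y = cis (\<Sum>b\<in>Basis. 2 * pi * (k \<bullet> b) * (y \<bullet> b))"
      by (simp add: chr_def euclidean_inner[of k y] sum_distrib_left mult.assoc)
    also have "\<dots> = (\<Prod>b\<in>Basis. cis (2 * pi * (k \<bullet> b) * (y \<bullet> b)))"
      by (simp add: cis_conv_exp exp_sum[symmetric] sum_distrib_left)
    finally show ?thesis
      by (auto simp: G_def cube_def mem_box indicator_def prod_zero_iff)
  qed
  have [measurable]: "G b \<in> borel_measurable borel" for b
    unfolding G_def cis_conv_exp by measurable
  interpret product_sigma_finite "\<lambda>b::real^'n. lborel :: real measure" by standard
  have "(LINT y|cell. chr k y) = (LINT y|lborel. indicator cube y *\<^sub>R chr k y)"
  proof -
    have "(\<lambda>y. indicator cube y *\<^sub>R chr k y) \<in> borel_measurable lborel"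
      unfolding split by measurable
    then show ?thesis by (simp add: integral_restrict_space integral_completion)
  qed
  also have "\<dots> = (LINT y|distr (\<Pi>\<^sub>M b\<in>(Basis::(real^'n) set). lborel) borel (\<lambda>f. \<Sum>b\<in>Basis. f b *\<^sub>R b). (\<Prod>b\<in>Basis. G b (y \<bullet> b)))"
    by (simp only: split lborel_eq[symmetric])
  also have "\<dots> = (LINT f|(\<Pi>\<^sub>M b\<in>(Basis::(real^'n) set). lborel). (\<Prod>b\<in>Basis. G b ((\<Sum>b\<in>Basis. f b *\<^sub>R b) \<bullet> b)))"
    by (rule integral_distr) measurable
  also have "\<dots> = (LINT f|(\<Pi>\<^sub>M b\<in>(Basis::(real^'n) set). lborel). (\<Prod>b\<in>Basis. G b (f b)))"
    by simp
  also have "\<dots> = (\<Prod>b\<in>Basis. LINT t|lborel. G b t)"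
    by (rule product_integral_prod)
      (use has_bochner_integral_cis[OF kb] in \<open>auto simp: G_def has_bochner_integral_iff\<close>)
  also have "\<dots> = (\<Prod>b\<in>Basis. if k \<bullet> b = 0 then 1 else 0)"
    by (intro prod.cong refl) (use has_bochner_integral_cis[OF kb] in \<open>simp add: G_def has_bochner_integral_iff\<close>)
  also have "\<dots> = (if k = 0 then 1 else 0)"
    using euclidean_all_zero_iff[of k] by auto
  finally show ?thesis .
qed

section \<open>Trigonometric polynomials and uniqueness of Fourier coefficients\<close>

inductive trig_poly :: "(real^'n \<Rightarrow> complex) \<Rightarrow> bool" where
  chr: "k \<in> lattice \<Longrightarrow> trig_poly (chr k)"
| add: "trig_poly p \<Longrightarrow> trig_poly q \<Longrightarrow> trig_poly (\<lambda>y. p y + q y)"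
| scale: "trig_poly p \<Longrightarrow> trig_poly (\<lambda>y. c * p y)"

lemma trig_poly_mult:
  assumes "trig_poly p" "trig_poly q"
  shows "trig_poly (\<lambda>y. p y * q y)"
  using assms
proof (induction p rule: trig_poly.induct)
  case (chr k)
  from chr(2,1) show ?case
  proof (induction q rule: trig_poly.induct)
    case (chr l)
    then show ?case using trig_poly.chr[of "k + l"] by (simp add: lattice_closed chr_add[abs_def])
  next
    case (add p q)
    then show ?case using trig_poly.add by (fastforce simp: ring_distribs)
  next
    case (scale p c)
    then show ?case using trig_poly.scale[of "\<lambda>y. chr k y * p y" c] by (simp add: ac_simps)
  qed
next
  case (add p q)
  then show ?case using trig_poly.add by (fastforce simp: ring_distribs)
next
  case (scale p c)
  then show ?case using trig_poly.scale[of "\<lambda>y. p y * q y" c] by (simp add: ac_simps)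
qed

lemma trig_poly_sum: 
  assumes "\<And>i. i \<in> I \<Longrightarrow> trig_poly (p i)"
  shows "trig_poly (\<lambda>y. \<Sum>i\<in>I. p i y)"
proof -
  have z: "trig_poly (\<lambda>y. 0)" using trig_poly.scale[OF trig_poly.chr[OF lattice_closed(3)], of 0] by simp
  show ?thesis using assms
    by (induction I rule: infinite_finite_induct) (auto intro: z trig_poly.add)
qed

lemma trig_poly_continuous: "trig_poly p \<Longrightarrow> continuous_on UNIV p"
  by (induction rule: trig_poly.induct) (auto intro!: continuous_intros)

text \<open>Opposite faces of the cell are glued, so continuous functions on the compact image
  correspond to continuous functions on the torus.\<close>

definition torus_embed :: "real^'n \<Rightarrow> complex^'n" where
  "torus_embed y = (\<chi> i. cis (2 * pi * y$i))"

lemma continuous_torus_embed [continuous_intros]: "continuous_on S torus_embed"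
  unfolding torus_embed_def by (intro continuous_intros)

text \<open>Real and imaginary parts of the coordinates are cosines and sines, that is combinations
  of the characters of plus and minus a unit vector; sums and products stay trigonometric because
  characters multiply to characters.\<close>

lemma real_polynomial_trig_poly:
  fixes q :: "complex^'n \<Rightarrow> real"
  assumes "real_polynomial_function q"
  shows "trig_poly (\<lambda>y. complex_of_real (q (torus_embed y)))"
  using assms
proof (induction q rule: real_polynomial_function.induct)
  case (linear q)
  interpret bounded_linear q by fact
  have ex: "z = (\<Sum>i\<in>UNIV. Re (z$i) *\<^sub>R axis i 1 + Im (z$i) *\<^sub>R axis i \<i>)" for z :: "complex^'n"
    by (simp add: vec_eq_iff complex_eq_iff axis_def if_distrib cong: if_cong)
  have "q z = (\<Sum>i\<in>UNIV. q (axis i 1) * Re (z$i) + q (axis i \<i>) * Im (z$i))" for z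
    by (subst ex) (simp add: sum add scaleR mult.commute)
  note eq = this[of "torus_embed y" for y]
  have re: "complex_of_real (Re (torus_embed y $ i)) = 1/2 * (chr (axis i 1) y + chr (- axis i 1) y)"
    and im: "complex_of_real (Im (torus_embed y $ i)) = 1/(2 * \<i>) * (chr (axis i 1) y + - 1 * chr (- axis i 1) y)" for y i
    by (simp_all add: torus_embed_def chr_def inner_axis' complex_eq_iff)
  show ?case
    unfolding eq of_real_sum of_real_add of_real_mult re im
    by (intro trig_poly_sum trig_poly.intros lattice_closed)
next
  case (const c)
  show ?case using trig_poly.scale[OF trig_poly.chr[OF lattice_closed(3)], of "of_real c"] by simp
next
  case (add f g)
  then show ?case using trig_poly.add by fastforce
next
  case (mult f g)
  then show ?case using trig_poly_mult by fastforce
qed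

lemma integrable_mult_bounded:
  fixes f :: "real^'n \<Rightarrow> complex"
  assumes f: "integrable cell f" and h: "h \<in> borel_measurable cell" "\<And>y. y \<in> cube \<Longrightarrow> cmod (h y) \<le> C"
  shows "integrable cell (\<lambda>y. f y * h y)"
proof (rule Bochner_Integration.integrable_bound)
  show "integrable cell (\<lambda>y. C * norm (f y))" using f by simp
  show "AE y in cell. norm (f y * h y) \<le> norm (C * norm (f y))"
    using AE_cell_cube
  proof eventually_elim
    case (elim y)
    have "norm (f y) * norm (h y) \<le> norm (f y) * \<bar>C\<bar>" 
      by (intro mult_left_mono) (use h(2)[OF elim] in auto)
    then show ?case by (simp add: norm_mult abs_mult mult.commute)
  qed
qed (use f h in measurable)

lemma integral_trig_poly_0:
  fixes f :: "real^'n \<Rightarrow> complex"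
  assumes f: "integrable cell f" and 0: "\<And>k. k \<in> lattice \<Longrightarrow> (LINT y|cell. f y * cnj (chr k y)) = 0"
    and p: "trig_poly p"
  shows "(LINT y|cell. f y * p y) = 0"
proof -
  have "integrable cell (\<lambda>y. f y * p y) \<and> (LINT y|cell. f y * p y) = 0"
    using p
  proof (induction p rule: trig_poly.induct)
    case (chr k)
    then show ?case using 0[of "- k"] f
      by (auto simp: lattice_closed chr_uminus intro!: integrable_mult_bounded[where C=1])
  next
    case (add p q)
    then show ?case by (simp add: ring_distribs)
  next
    case (scale p c)
    then have "integrable cell (\<lambda>y. c * (f y * p y))" "(LINT y|cell. c * (f y * p y)) = 0" by auto
    then show ?case by (simp add: ac_simps)
  qed
  then show ?thesis ..
qed

lemma compact_cube: "compact cube"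
  by (simp add: cube_def)

text \<open>Stone--Weierstrass on the image of the torus turns the hypothesis on characters into one on
  continuous functions of \<open>torus_embed\<close>.\<close>
lemma integral_continuous_0:
  fixes f :: "real^'n \<Rightarrow> complex" and h :: "complex^'n \<Rightarrow> real"
  assumes f: "integrable cell f" and 0: "\<And>k. k \<in> lattice \<Longrightarrow> (LINT y|cell. f y * cnj (chr k y)) = 0"
    and h: "continuous_on UNIV h"
  shows "(LINT y|cell. f y * of_real (h (torus_embed y))) = 0"
proof -
  have comp: "compact (torus_embed ` (cube :: (real^'n) set))"
    by (intro compact_continuous_image continuous_intros compact_cube)
  have hc: "continuous_on UNIV (\<lambda>y::real^'n. complex_of_real (h (torus_embed y)))"
    by (intro continuous_intros continuous_on_compose2[OF h]) auto
  have "bounded ((\<lambda>y::real^'n. complex_of_real (h (torus_embed y))) ` cube)"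
    by (intro compact_imp_bounded compact_continuous_image continuous_on_subset[OF hc] compact_cube) auto
  then obtain C where C: "\<And>y::real^'n. y \<in> cube \<Longrightarrow> cmod (of_real (h (torus_embed y))) \<le> C"
    unfolding bounded_iff by blast
  have ih: "integrable cell (\<lambda>y. f y * of_real (h (torus_embed y)))"
    by (rule integrable_mult_bounded[OF f continuous_borel_measurable_cell[OF hc] C])
  have "cmod (LINT y|cell. f y * of_real (h (torus_embed y))) \<le> e * (LINT y|cell. cmod (f y))" if "e > 0" for e
  proof -
    obtain q where q: "polynomial_function q" "\<And>z. z \<in> torus_embed ` (cube :: (real^'n) set) \<Longrightarrow> norm (h z - q z) < e"
      using Stone_Weierstrass_polynomial_function[OF comp continuous_on_subset[OF h] \<open>e > 0\<close>] by auto
    have tp: "trig_poly (\<lambda>y::real^'n. complex_of_real (q (torus_embed y)))"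
      using real_polynomial_trig_poly q(1) by (simp add: real_polynomial_function_eq)
    have dc: "continuous_on UNIV (\<lambda>y::real^'n. complex_of_real (h (torus_embed y)) - of_real (q (torus_embed y)))"
      by (intro continuous_intros hc trig_poly_continuous[OF tp])
    have db: "cmod (of_real (h (torus_embed y)) - of_real (q (torus_embed y))) \<le> e" if "y \<in> cube" for y :: "real^'n"
      using q(2)[of "torus_embed y"] that by (simp flip: of_real_diff)
    have id: "integrable cell (\<lambda>y. f y * (of_real (h (torus_embed y)) - of_real (q (torus_embed y))))"
      by (rule integrable_mult_bounded[OF f continuous_borel_measurable_cell[OF dc] db])
    have "(LINT y|cell. f y * of_real (h (torus_embed y)))
        = (LINT y|cell. f y * of_real (h (torus_embed y))) - (LINT y|cell. f y * of_real (q (torus_embed y)))"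
      using integral_trig_poly_0[OF f 0 tp] by simp
    also have "\<dots> = (LINT y|cell. f y * (of_real (h (torus_embed y)) - of_real (q (torus_embed y))))"
      using Bochner_Integration.integrable_diff[OF ih id] ih
      by (subst Bochner_Integration.integral_diff[symmetric]) (auto simp: algebra_simps)
    also have "cmod \<dots> \<le> (LINT y|cell. e * cmod (f y))"
    proof (rule Bochner_Integration.integral_norm_bound_integral[OF id])
      show "integrable cell (\<lambda>y. e * cmod (f y))" using f by simp
      fix y :: "real^'n" assume "y \<in> space cell"
      then have "cmod (f y) * cmod (of_real (h (torus_embed y)) - of_real (q (torus_embed y))) \<le> cmod (f y) * e"
        by (intro mult_left_mono db) auto
      then show "cmod (f y * (of_real (h (torus_embed y)) - of_real (q (torus_embed y)))) \<le> e * cmod (f y)"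
        by (simp add: norm_mult mult.commute)
    qed
    finally show ?thesis by simp
  qed note le = this
  define I where "I = (LINT y|cell. cmod (f y))"
  have I: "I \<ge> 0" unfolding I_def by (rule Bochner_Integration.integral_nonneg) simp
  have "cmod (LINT y|cell. f y * of_real (h (torus_embed y))) \<le> 0"
  proof (rule field_le_epsilon)
    fix d :: real assume d: "d > 0"
    \<comment> \<open>The 1 added to \<open>I\<close> allows for \<open>I = 0\<close>.\<close>
    have "cmod (LINT y|cell. f y * of_real (h (torus_embed y))) \<le> d / (I + 1) * I"
      unfolding I_def by (intro le divide_pos_pos add_nonneg_pos d I[unfolded I_def]) simp
    also have "\<dots> \<le> 0 + d" using d I by (simp add: field_simps)
    finally show "cmod (LINT y|cell. f y * of_real (h (torus_embed y))) \<le> 0 + d" .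
  qed
  then show ?thesis by simp
qed

lemma One_nth: "(\<Sum>b\<in>Basis. (b :: real^'n) $ i) = 1"
proof -
  have "(\<Sum>b\<in>Basis. (b :: real^'n) $ i) = One \<bullet> (axis i 1 :: real^'n)"
    by (simp add: cart_eq_inner_axis inner_sum_left)
  also have "\<dots> = 1" by (rule inner_sum_Basis) (simp add: axis_in_Basis_iff)
  finally show ?thesis .
qed

text \<open>Coordinates with equal image differ by an integer, and the difference is below 1 in
  absolute value as soon as one of the points is interior. On the faces injectivity fails, which is
  why later compact sets stay in the open box.\<close>

lemma torus_embed_inj:
  assumes y: "y \<in> cube" and c: "c \<in> box 0 One" and eq: "torus_embed y = torus_embed c"
  shows "y = c"
proof -
  have "y $ i = c $ i" for i
  proof -
    have "cis (2 * pi * y $ i) = cis (2 * pi * c $ i)"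
      using eq by (simp add: torus_embed_def vec_eq_iff)
    then have "cis (2 * pi * (y $ i - c $ i)) = 1"
      by (simp add: right_diff_distrib flip: cis_divide)
    then have "cos (2 * pi * (y $ i - c $ i)) = 1" by (simp add: complex_eq_iff)
    then obtain n :: int where "2 * pi * (y $ i - c $ i) = n * 2 * pi"
      by (auto simp: cos_one_2pi_int)
    then have n: "y $ i - c $ i = of_int n" by simp
    have "0 \<le> y $ i" "y $ i \<le> 1" "0 < c $ i" "c $ i < 1"
      using y c by (auto simp: cube_def mem_box_cart One_nth)
    then have "\<bar>real_of_int n\<bar> < 1" unfolding n[symmetric] by linarith
    then have "n = 0" by linarith
    then show ?thesis using n by simp
  qed
  then show ?thesis by (simp add: vec_eq_iff)
qed

text \<open>The indicator of \<open>C\<close> is the pullback of that of its image \<open>D\<close>,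
  as no other point of the cell is glued to a point of the open box. The latter indicator is a limit
  of continuous functions of the distance to \<open>D\<close>, and dominated convergence applies
  with bound |f|.\<close>

lemma integral_compact_0:
  fixes f :: "real^'n \<Rightarrow> complex"
  assumes f: "integrable cell f" and 0: "\<And>k. k \<in> lattice \<Longrightarrow> (LINT y|cell. f y * cnj (chr k y)) = 0"
    and C: "compact C" "C \<subseteq> box 0 One"
  shows "(LINT y|cell. f y * indicator C y) = 0"
proof (cases "C = {}")
  case False
  define D where "D = torus_embed ` C"
  have D: "closed D" "D \<noteq> {}"
    using C False by (auto simp: D_def intro!: compact_imp_closed compact_continuous_image continuous_intros)
  define h where "h m z = max 0 (1 - real m * infdist z D)" for m z
  have hc: "continuous_on UNIV (h m)" for m unfolding h_def by (intro continuous_intros)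
  have h01: "0 \<le> h m z" "h m z \<le> 1" for m z by (auto simp: h_def infdist_nonneg)
  have ind: "indicator D (torus_embed y) = (indicator C y :: real)" if "y \<in> cube" for y
    using that C(2) torus_embed_inj[OF that] by (auto simp: D_def indicator_def)
  have lim: "(\<lambda>m. h m z) \<longlonglongrightarrow> indicator D z" for z
  proof (cases "z \<in> D")
    case True
    then show ?thesis by (simp add: h_def)
  next
    case False
    then have p: "infdist z D > 0" using infdist_pos_not_in_closed[OF D] by simp
    obtain m0 :: nat where m0: "1 / infdist z D < real m0" using reals_Archimedean2 by blast
    have "h m z = 0" if "m0 \<le> m" for m
    proof -
      have "1 / infdist z D < real m" using m0 that by simp
      then show ?thesis using p by (simp add: h_def field_simps)
    qed
    then show ?thesis using False
      by (intro tendsto_eventually) (auto simp: eventually_sequentially)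
  qed
  have [measurable]: "f \<in> borel_measurable cell" using f by auto
  have [measurable]: "C \<in> sets borel" using C(1) by (intro borel_compact)
  have "(\<lambda>m. LINT y|cell. f y * of_real (h m (torus_embed y))) \<longlonglongrightarrow> (LINT y|cell. f y * of_real (indicator C y))"
  proof (rule integral_dominated_convergence[where w="\<lambda>y. cmod (f y)"])
    show "integrable cell (\<lambda>y. cmod (f y))" using f by simp
    show "(\<lambda>y. f y * complex_of_real (h m (torus_embed y))) \<in> borel_measurable cell" for m
    proof -
      have "(\<lambda>y. complex_of_real (h m (torus_embed y))) \<in> borel_measurable (cell :: (real^'n) measure)"
        by (intro continuous_borel_measurable_cell continuous_intros continuous_on_compose2[OF hc]) auto
      then show ?thesis by measurable
    qed
    show "(\<lambda>y. f y * complex_of_real (indicator C y)) \<in> borel_measurable cell"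
    proof -
      have "(\<lambda>y. complex_of_real (indicator C y)) \<in> borel_measurable cell"
        by (intro borel_measurable_cell measurable_completion) measurable
      then show ?thesis by measurable
    qed
    show "AE y in cell. (\<lambda>m. f y * of_real (h m (torus_embed y))) \<longlonglongrightarrow> f y * of_real (indicator C y)"
      using AE_cell_cube
    proof eventually_elim
      case (elim y)
      show ?case unfolding ind[OF elim, symmetric] by (intro tendsto_intros lim)
    qed
    show "AE y in cell. norm (f y * of_real (h m (torus_embed y))) \<le> cmod (f y)" for m
      using h01 by (intro AE_I2) (auto simp: norm_mult abs_le_iff intro!: mult_left_le)
  qed
  then have "(LINT y|cell. f y * of_real (indicator C y)) = 0"
    using integral_continuous_0[OF f 0 hc] by (simp add: LIMSEQ_const_iff)
  moreover have "complex_of_real (indicator C y) = indicator C y" for y by (simp add: indicator_def)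
  ultimately show ?thesis by simp
qed simp

text \<open>Inner regularity. On a compact subset of {g \<ge> 1/(m+1)} inside the open box the
  integral is 0 but at least 1/(m+1) times the measure, so the subset is null, and so is the level
  set, which such subsets exhaust up to any \<epsilon>. The faces of the cell are null.\<close>

lemma AE_zero_if_integral_compact_0:
  fixes g :: "real^'n \<Rightarrow> real"
  assumes g: "integrable cell g"
    and 0: "\<And>C. compact C \<Longrightarrow> C \<subseteq> box 0 One \<Longrightarrow> (LINT y|cell. g y * indicator C y) = 0"
  shows "AE y in cell. g y \<le> 0"
proof -
  have [measurable]: "g \<in> borel_measurable cell" using g by auto
  define S where "S m = {y \<in> cube. g y \<ge> inverse (real (Suc m))} \<inter> box 0 One" for m
  have Scell: "{y \<in> cube. g y \<ge> inverse (real (Suc m))} \<in> sets cell" for m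
    using measurable_sets[of g cell borel "{inverse (real (Suc m))..}"]
    by (simp add: vimage_def Int_def conj_commute)
  then have Smeas: "S m \<in> sets lebesgue" for m
    unfolding S_def by (intro sets.Int) (auto simp: sets_restrict_space_iff)
  have null: "S m \<in> null_sets lebesgue" for m
  proof -
    have "emeasure lebesgue (S m) \<le> ennreal e" if "e > 0" for e
    proof -
      obtain T where T: "closed T" "T \<subseteq> S m" "S m - T \<in> lmeasurable" "emeasure lebesgue (S m - T) < ennreal e"
        using sets_lebesgue_inner_closed[OF Smeas \<open>e > 0\<close>] by metis
      have Tbox: "T \<subseteq> box 0 One" using T(2) by (auto simp: S_def)
      then have Tc: "compact T"
        using T(1) bounded_subset[OF bounded_box] by (auto simp: compact_eq_bounded_closed)
      then have [measurable]: "T \<in> sets borel" by (rule borel_compact)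
      then have TL: "T \<in> sets lebesgue" by (simp add: sets_completionI_sets)
      have Tcube: "T \<subseteq> cube" using T(2) by (auto simp: S_def)
      have Tcell: "T \<in> sets cell" using Tcube by (simp add: sets_restrict_space_iff)
      have Tfin: "emeasure cell T < \<infinity>"
        using finite_measure.emeasure_finite[OF finite_measure_cell, of T] by (simp add: less_top)
      have gT: "integrable cell (\<lambda>y. g y * indicator T y)"
        using integrable_real_mult_indicator[OF Tcell g] .
      have "inverse (real (Suc m)) * measure cell T = (LINT y|cell. inverse (real (Suc m)) * indicator T y)"
        using Tcell Tcube by (simp add: Int_absorb2)
      also have "\<dots> \<le> (LINT y|cell. g y * indicator T y)"
      proof (rule integral_mono[OF _ gT])
        show "integrable cell (\<lambda>y. inverse (real (Suc m)) * indicator T y)"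
          using Tcell Tfin by (intro integrable_mult_right integrable_real_indicator) auto
        fix y show "inverse (real (Suc m)) * indicator T y \<le> g y * indicator T y"
          using T(2) by (auto simp: S_def indicator_def)
      qed
      also have "\<dots> = 0" by (rule 0[OF Tc Tbox])
      finally have "measure cell T \<le> 0" by (simp add: mult_le_0_iff field_simps)
      then have "emeasure cell T = 0" using Tfin by (simp add: measure_le_0_iff measure_eq_emeasure_eq_ennreal emeasure_eq_ennreal_measure less_top)
      then have T0: "emeasure lebesgue T = 0" using Tcube by (simp add: emeasure_restrict_space)
      have "emeasure lebesgue (S m) \<le> emeasure lebesgue ((S m - T) \<union> T)"
        by (intro emeasure_mono sets.Un fmeasurableD[OF T(3)] TL) auto
      also have "\<dots> \<le> emeasure lebesgue (S m - T) + emeasure lebesgue T"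
        by (rule emeasure_subadditive[OF fmeasurableD[OF T(3)] TL])
      finally show ?thesis using T0 T(4) by simp
    qed
    note le = this
    have "emeasure lebesgue (S m) \<le> 0"
    proof (rule ennreal_le_epsilon)
      fix e :: real assume "0 < e"
      then show "emeasure lebesgue (S m) \<le> 0 + ennreal e" using le by simp
    qed
    then show ?thesis using Smeas by (auto simp: null_sets_def)
  qed
  have bd: "cube - box 0 One \<in> null_sets (lebesgue :: (real^'n) measure)"
    unfolding cube_def by (metis negligible_frontier_interval negligible_iff_null_sets)
  have "(\<Union>m. S m) \<union> (cube - box 0 One) \<in> null_sets lebesgue"
    using null bd by auto
  then have "AE y in lebesgue. y \<notin> (\<Union>m. S m) \<union> (cube - box 0 One)" by (rule AE_not_in)
  from AE_cell[OF this] AE_cell_cube show ?thesis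
  proof eventually_elim
    case (elim y)
    show ?case
    proof (rule ccontr)
      assume "\<not> g y \<le> 0"
      then obtain m where "inverse (real (Suc m)) < g y" using reals_Archimedean[of "g y"] by auto
      then have "y \<in> S m" using elim by (auto simp: S_def)
      then show False using elim by blast
    qed
  qed
qed

text \<open>The one-sided real statement above is applied to both signs of the real and of the
  imaginary part.\<close>

theorem fourier_unique:
  fixes f :: "real^'n \<Rightarrow> complex"
  assumes f: "integrable cell f" and 0: "\<And>k. k \<in> lattice \<Longrightarrow> (LINT y|cell. f y * cnj (chr k y)) = 0"
  shows "AE y in cell. f y = 0"
proof -
  have c: "(LINT y|cell. f y * indicator C y) = 0" if "compact C" "C \<subseteq> box 0 One" for C
    by (rule integral_compact_0[OF f 0 that])
  have fi: "integrable cell (\<lambda>y. f y * indicator C y)" if "compact C" for C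
  proof (rule integrable_mult_bounded[OF f, where C=1])
    have [measurable]: "C \<in> sets borel" by (rule borel_compact[OF that])
    show "indicator C \<in> borel_measurable cell"
      by (intro borel_measurable_cell measurable_completion) measurable
  qed (auto simp: indicator_def)
  have re: "(LINT y|cell. Re (f y) * indicator C y) = 0"
    and im: "(LINT y|cell. Im (f y) * indicator C y) = 0" if C: "compact C" "C \<subseteq> box 0 One" for C
  proof -
    have "Re (f y * indicator C y) = Re (f y) * indicator C y" "Im (f y * indicator C y) = Im (f y) * indicator C y" for y
      by (auto simp: indicator_def)
    then show "(LINT y|cell. Re (f y) * indicator C y) = 0" "(LINT y|cell. Im (f y) * indicator C y) = 0"
      using integral_Re[OF fi[OF C(1)]] integral_Im[OF fi[OF C(1)]] c[OF C] by auto
  qed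
  have "AE y in cell. Re (f y) \<le> 0" "AE y in cell. - Re (f y) \<le> 0"
    "AE y in cell. Im (f y) \<le> 0" "AE y in cell. - Im (f y) \<le> 0"
    by (rule AE_zero_if_integral_compact_0; use f re im in simp)+
  then show ?thesis by eventually_elim (simp add: complex_eq_iff)
qed

section \<open>The Sobolev space and Rellich's theorem\<close>

definition fscale :: "complex \<Rightarrow> ('a \<Rightarrow> complex) \<Rightarrow> 'a \<Rightarrow> complex" where
  "fscale c f = (\<lambda>y. c * f y)"

definition l2form :: "(real^'n \<Rightarrow> complex) \<Rightarrow> (real^'n \<Rightarrow> complex) \<Rightarrow> complex" where
  "l2form f g = (LINT y|cell. f y * cnj (g y))"

definition coeff :: "(real^'n \<Rightarrow> complex) \<Rightarrow> real^'n \<Rightarrow> complex" where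
  "coeff f k = (LINT y|cell. f y * cnj (chr k y))"

lemma L2_measurable: "L2 f \<Longrightarrow> f \<in> borel_measurable cell"
  by (simp add: L2_def)

lemma L2_scale: "L2 f \<Longrightarrow> L2 (\<lambda>y. (c::complex) * f y)"
proof (rule L2_bound[where C="cmod c" and f=f])
  assume "L2 f"
  then have [measurable]: "f \<in> borel_measurable cell" by (rule L2_measurable)
  show "(\<lambda>y. c * f y) \<in> borel_measurable cell" by measurable
qed (simp_all add: norm_mult)

lemma L2_mult_integrable:
  assumes "L2 f" "L2 (g :: real^'n \<Rightarrow> complex)"
  shows "integrable cell (\<lambda>y. f y * cnj (g y))"
proof (rule L2_bilinear_integrable[OF assms, where C=1])
  have [measurable]: "f \<in> borel_measurable cell" "g \<in> borel_measurable cell"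
    using assms by (auto intro: L2_measurable)
  have "(\<lambda>y. cnj (g y)) \<in> borel_measurable cell"
    by (rule borel_measurable_continuous_on[OF continuous_on_cnj[OF continuous_on_id]]) measurable
  then show "(\<lambda>y. f y * cnj (g y)) \<in> borel_measurable cell" by measurable
qed (simp add: norm_mult)

lemma vector_space_fscale: "vector_space fscale"
  by unfold_locales (auto simp: fscale_def fun_eq_iff algebra_simps)

lemma qf_l2form: "qf l2form f = (LINT y|cell. (cmod (f y))\<^sup>2)"
proof -
  have "l2form f f = (LINT y|cell. complex_of_real ((cmod (f y))\<^sup>2))"
    by (simp only: l2form_def complex_norm_square)
  then show ?thesis by (simp only: qf_def integral_complex_of_real Re_complex_of_real)
qed

lemma hform_l2: "hform fscale {f::real^'n \<Rightarrow> complex. L2 f} l2form"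
proof -
  interpret vector_space "fscale :: complex \<Rightarrow> (real^'n \<Rightarrow> complex) \<Rightarrow> _" by (rule vector_space_fscale)
  show ?thesis
  proof
    show "subspace {f::real^'n \<Rightarrow> complex. L2 f}"
      by (auto simp: subspace_def fscale_def zero_fun_def plus_fun_def L2_const L2_add L2_scale)
  next
    fix u v w :: "real^'n \<Rightarrow> complex" assume "u \<in> {f. L2 f}" "v \<in> {f. L2 f}" "w \<in> {f. L2 f}"
    then show "l2form (u + v) w = l2form u w + l2form v w"
      by (simp add: l2form_def ring_distribs L2_mult_integrable)
  next
    fix u w :: "real^'n \<Rightarrow> complex" and c
    show "l2form (fscale c u) w = c * l2form u w"
      by (simp add: l2form_def fscale_def mult.assoc)
  next
    fix u v :: "real^'n \<Rightarrow> complex"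
    have "cnj (l2form u v) = (LINT y|cell. cnj (u y * cnj (v y)))"
      by (simp only: l2form_def Bochner_Integration.integral_cnj)
    then show "l2form v u = cnj (l2form u v)" by (simp add: l2form_def mult.commute)
  next
    fix u :: "real^'n \<Rightarrow> complex"
    show "0 \<le> qf l2form u" unfolding qf_l2form by (rule Bochner_Integration.integral_nonneg) simp
  qed
qed

lemma l2form_chr:
  assumes "k \<in> lattice" "l \<in> lattice"
  shows "l2form (chr k) (chr l) = (if k = l then 1 else 0)"
proof -
  have "k + - l \<in> lattice" using assms by (intro lattice_closed)
  from integral_chr[OF this] show ?thesis
    unfolding l2form_def chr_add chr_uminus by simp
qed

lemma bessel_coeff:
  assumes f: "L2 f" and F: "finite F" "F \<subseteq> lattice"
  shows "(\<Sum>k\<in>F. (cmod (coeff f k))\<^sup>2) \<le> (LINT y|cell. (cmod (f y))\<^sup>2)"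
  using hform.bessel[OF hform_l2 F(1), of chr f] f F(2)
  by (auto simp: L2_chr l2form_chr subset_iff qf_l2form coeff_def l2form_def[symmetric])

lemma L2_complete_l2form:
  assumes "\<And>n. L2 (h n :: real^'n \<Rightarrow> complex)" "qcauchy (qf l2form) h"
  shows "\<exists>g. L2 g \<and> (\<lambda>n. qf l2form (h n - g)) \<longlonglongrightarrow> 0"
proof -
  obtain g where "L2 g" "(\<lambda>n. LINT x|cell. (norm (h n x - g x))\<^sup>2) \<longlonglongrightarrow> 0"
    by (rule L2_complete[of h]) (use assms in \<open>auto simp: qcauchy_def qf_l2form\<close>)
  then show ?thesis by (auto simp: qf_l2form)
qed

text \<open>Uniqueness of Fourier coefficients is the totality of the characters that the abstract
  Parseval estimate asks for.\<close>

lemma parseval_coeff: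
  assumes f: "L2 (f :: real^'n \<Rightarrow> complex)" and e: "e > 0"
  shows "\<exists>F. finite F \<and> F \<subseteq> lattice \<and> (LINT y|cell. (cmod (f y))\<^sup>2) \<le> (\<Sum>k\<in>F. (cmod (coeff f k))\<^sup>2) + e"
proof -
  have "\<exists>F. finite F \<and> F \<subseteq> lattice \<and> qf l2form f \<le> (\<Sum>k\<in>F. (cmod (l2form f (chr k)))\<^sup>2) + e"
  proof (rule hform.parseval_le[OF hform_l2])
    show "\<exists>g\<in>{f. L2 f}. (\<lambda>n. qf l2form (h n - g)) \<longlonglongrightarrow> 0"
      if "\<And>n. h n \<in> {f. L2 f}" "qcauchy (qf l2form) h" for h :: "nat \<Rightarrow> real^'n \<Rightarrow> complex"
      using L2_complete_l2form[of h] that by auto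
    show "qf l2form g = 0" if g: "g \<in> {f. L2 f}" and 0: "\<And>k. k \<in> lattice \<Longrightarrow> l2form g (chr k) = 0"
      for g :: "real^'n \<Rightarrow> complex"
    proof -
      have "AE y in cell. g y = 0"
        using fourier_unique[OF L2_integrable[of g]] g 0 by (auto simp: l2form_def)
      then have "AE y in cell. (cmod (g y))\<^sup>2 = 0" by eventually_elim simp
      then show ?thesis unfolding qf_l2form by (rule integral_eq_zero_AE)
    qed
  qed (use f e in \<open>auto simp: L2_chr l2form_chr\<close>)
  then show ?thesis by (simp add: qf_l2form coeff_def l2form_def)
qed

lemma finite_lattice_ball: "finite {k \<in> (lattice :: (real^'n) set). norm k \<le> K}"
proof -
  define S where "S = real_of_int ` {\<lfloor>-K\<rfloor>..\<lceil>K\<rceil>}"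
  have "{k \<in> (lattice :: (real^'n) set). norm k \<le> K} \<subseteq> vec_lambda ` (UNIV \<rightarrow>\<^sub>E S)"
  proof
    fix k :: "real^'n" assume k: "k \<in> {k \<in> lattice. norm k \<le> K}"
    have "k $ i \<in> S" for i
    proof -
      obtain z where z: "k $ i = of_int z" using k by (auto simp: lattice_def Ints_def)
      have "\<bar>k $ i\<bar> \<le> K" using component_le_norm_cart[of k i] k by auto
      then have "z \<in> {\<lfloor>-K\<rfloor>..\<lceil>K\<rceil>}" unfolding z by (auto simp: floor_le_iff le_ceiling_iff)
      then show ?thesis by (auto simp: S_def z)
    qed
    then show "k \<in> vec_lambda ` (UNIV \<rightarrow>\<^sub>E S)"
      by (intro image_eqI[where x="\<lambda>i. k $ i"]) auto
  qed
  then show ?thesis by (rule finite_subset) (auto simp: S_def intro!: finite_PiE)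
qed

lemma countable_lattice: "countable (lattice :: (real^'n) set)"
proof -
  have "(lattice :: (real^'n) set) = (\<Union>m::nat. {k \<in> lattice. norm k \<le> real m})"
    using real_arch_simple by auto
  moreover have "countable (\<Union>m::nat. {k \<in> (lattice :: (real^'n) set). norm k \<le> real m})"
    by (rule countable_UN) (simp_all add: countable_finite[OF finite_lattice_ball])
  ultimately show ?thesis by simp
qed

lemma test_fun_bounded:
  fixes phi :: "real^'n \<Rightarrow> real"
  assumes "test_fun phi Dphi"
  shows "L2 (\<lambda>y. complex_of_real (phi y))" "L2 (\<lambda>y. complex_of_real (Dphi y $ j))"
proof -
  have *: "L2 (\<lambda>y. complex_of_real (f y))" if f: "continuous_on UNIV f" for f :: "real^'n \<Rightarrow> real"
  proof -
    have "bounded (f ` cube)"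
      by (intro compact_imp_bounded compact_continuous_image continuous_on_subset[OF f] compact_cube) auto
    then obtain C where C: "\<And>y. y \<in> cube \<Longrightarrow> \<bar>f y\<bar> \<le> C" unfolding bounded_iff by auto
    show ?thesis
    proof (rule L2_bounded[where C=C])
      show "(\<lambda>y. complex_of_real (f y)) \<in> borel_measurable cell"
        by (rule continuous_borel_measurable_cell[OF continuous_on_of_real[OF f]])
      show "AE y in cell. cmod (complex_of_real (f y)) \<le> C"
        using AE_cell_cube by eventually_elim (simp add: C)
    qed
  qed
  have "continuous_on UNIV phi"
    using assms by (intro has_derivative_continuous_on[of UNIV phi "\<lambda>y h. Dphi y \<bullet> h"]) (simp add: test_fun_def)
  then show "L2 (\<lambda>y. complex_of_real (phi y))" by (rule *)
  show "L2 (\<lambda>y. complex_of_real (Dphi y $ j))"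
    by (rule *, rule continuous_on_component) (use assms in \<open>simp add: test_fun_def\<close>)
qed

lemma L2_nth: "L2 G \<Longrightarrow> L2 (\<lambda>y. (G y :: complex^'n) $ j)"
proof (rule L2_bound[where C=1 and f=G])
  assume "L2 G"
  then have [measurable]: "G \<in> borel_measurable cell" by (rule L2_measurable)
  show "(\<lambda>y. G y $ j) \<in> borel_measurable cell"
    by (rule borel_measurable_continuous_on[OF continuous_on_component[OF continuous_on_id]]) measurable
qed (auto simp: component_le_norm_cart Finite_Cartesian_Product.norm_nth_le)

text \<open>Test functions are real and so unaffected by the conjugation in \<open>l2form\<close>;
  both sides become values of a form, with its linearity and continuity.\<close>

lemma weak_grad_form:
  "weak_grad psi G \<longleftrightarrow> (\<forall>phi Dphi j. test_fun phi Dphi \<longrightarrow>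
     l2form psi (\<lambda>y. complex_of_real (Dphi y $ j)) = - l2form (\<lambda>y. G y $ j) (\<lambda>y. complex_of_real (phi y)))"
  by (auto simp: weak_grad_def l2form_def)

text \<open>The character is no admissible test function, being complex. Its cosine and sine are
  tested separately, and differentiation exchanges them.\<close>

lemma coeff_weak_grad:
  assumes L: "L2 psi" "L2 G" and w: "weak_grad psi G" and k: "k \<in> lattice"
  shows "coeff (\<lambda>y. G y $ j) k = 2 * \<i> * of_real (pi * k $ j) * coeff psi k"
proof -
  interpret hform fscale "{f::real^'n \<Rightarrow> complex. L2 f}" l2form by (rule hform_l2)
  define C S where "C y = complex_of_real (cos (2 * pi * (k \<bullet> y)))" and "S y = complex_of_real (sin (2 * pi * (k \<bullet> y)))" for y
  have per: "cos (2 * pi * (k \<bullet> (y + m))) = cos (2 * pi * (k \<bullet> y))"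
    "sin (2 * pi * (k \<bullet> (y + m))) = sin (2 * pi * (k \<bullet> y))" if "\<forall>i. m $ i \<in> \<int>" for y m
  proof -
    have "chr k (y + m) = chr k y" using periodic_chr[OF k] that by (simp add: periodic_def)
    then show "cos (2 * pi * (k \<bullet> (y + m))) = cos (2 * pi * (k \<bullet> y))"
      "sin (2 * pi * (k \<bullet> (y + m))) = sin (2 * pi * (k \<bullet> y))" by (simp_all add: chr_def complex_eq_iff)
  qed
  have tc: "test_fun (\<lambda>y. cos (2 * pi * (k \<bullet> y))) (\<lambda>y. (- 2 * pi * sin (2 * pi * (k \<bullet> y))) *\<^sub>R k)"
    unfolding test_fun_def
    by (auto simp: periodic_def per intro!: continuous_intros derivative_eq_intros)
  have ts: "test_fun (\<lambda>y. sin (2 * pi * (k \<bullet> y))) (\<lambda>y. (2 * pi * cos (2 * pi * (k \<bullet> y))) *\<^sub>R k)"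
    unfolding test_fun_def
    by (auto simp: periodic_def per intro!: continuous_intros derivative_eq_intros)
  have CS: "C \<in> {f. L2 f}" "S \<in> {f. L2 f}"
    using test_fun_bounded(1)[OF tc] test_fun_bounded(1)[OF ts] by (simp_all add: C_def[abs_def] S_def[abs_def])
  have PG: "psi \<in> {f. L2 f}" "(\<lambda>y. G y $ j) \<in> {f. L2 f}" using L L2_nth by auto
  have chr_eq: "chr k = C + fscale \<i> S"
    by (auto simp: fun_eq_iff chr_def C_def S_def fscale_def complex_eq_iff)
  have co: "coeff f k = l2form f C - \<i> * l2form f S" if "f \<in> {f. L2 f}" for f
    using that CS inX(4)[OF CS(2)] 
    by (simp only: coeff_def l2form_def[symmetric] chr_eq add_right scale_right) simp
  have "l2form psi (fscale (- 2 * of_real (pi * k $ j)) S) = - l2form (\<lambda>y. G y $ j) C"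
    using w[unfolded weak_grad_form, rule_format, OF tc, of j]
    by (simp add: fscale_def[abs_def] C_def[abs_def] S_def[abs_def] algebra_simps)
  then have 1: "l2form (\<lambda>y. G y $ j) C = 2 * of_real (pi * k $ j) * l2form psi S"
    unfolding scale_right[OF CS(2) PG(1)] by (simp add: minus_equation_iff)
  have "l2form psi (fscale (2 * of_real (pi * k $ j)) C) = - l2form (\<lambda>y. G y $ j) S"
    using w[unfolded weak_grad_form, rule_format, OF ts, of j]
    by (simp add: fscale_def[abs_def] C_def[abs_def] S_def[abs_def] algebra_simps)
  then have 2: "l2form (\<lambda>y. G y $ j) S = - 2 * of_real (pi * k $ j) * l2form psi C"
    unfolding scale_right[OF CS(1) PG(1)] by (simp add: minus_equation_iff)
  show ?thesis unfolding co[OF PG(1)] co[OF PG(2)] 1 2 by (simp add: algebra_simps)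
qed

lemma norm_vec_square: "(norm (v :: complex^'n))\<^sup>2 = (\<Sum>j\<in>UNIV. (cmod (v $ j))\<^sup>2)"
  by (simp add: norm_vec_def L2_set_def sum_nonneg)

lemma integral_norm_vec_square:
  fixes G :: "real^'n \<Rightarrow> complex^'n"
  assumes "L2 G"
  shows "(LINT y|cell. (norm (G y))\<^sup>2) = (\<Sum>j\<in>UNIV. LINT y|cell. (cmod (G y $ j))\<^sup>2)"
  unfolding norm_vec_square
  by (rule Bochner_Integration.integral_sum) (use L2_nth[OF assms] in \<open>simp add: L2_def\<close>)

text \<open>Beyond radius \<open>K\<close> a gradient coefficient is at least 2 \<pi> K times as
  large as that of the function, so Bessel's inequality for the gradient controls the tail. Parseval
  enters through a finite set and an arbitrarily small error.\<close>

lemma low_frequency_bound: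
  fixes psi :: "real^'n \<Rightarrow> complex"
  assumes L: "L2 psi" "L2 G" and w: "weak_grad psi G" and K: "K > 0"
  shows "(LINT y|cell. (cmod (psi y))\<^sup>2) \<le> (\<Sum>k | k \<in> lattice \<and> norm k \<le> K. (cmod (coeff psi k))\<^sup>2)
    + (LINT y|cell. (norm (G y))\<^sup>2) / (4 * pi\<^sup>2 * K\<^sup>2)"
proof (rule field_le_epsilon)
  fix e :: real assume "e > 0"
  define B where "B = {k :: real^'n. k \<in> lattice \<and> norm k \<le> K}"
  have finB: "finite B" unfolding B_def by (rule finite_lattice_ball)
  obtain F where F: "finite F" "F \<subseteq> lattice"
    and le: "(LINT y|cell. (cmod (psi y))\<^sup>2) \<le> (\<Sum>k\<in>F. (cmod (coeff psi k))\<^sup>2) + e"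
    using parseval_coeff[OF L(1) \<open>e > 0\<close>] by blast
  have "(\<Sum>k\<in>F - B. (cmod (coeff psi k))\<^sup>2)
      \<le> (\<Sum>k\<in>F - B. (\<Sum>j\<in>UNIV. (cmod (coeff (\<lambda>y. G y $ j) k))\<^sup>2) / (4 * pi\<^sup>2 * K\<^sup>2))"
  proof (rule sum_mono)
    fix k assume k: "k \<in> F - B"
    then have kl: "k \<in> lattice" and "K < norm k" using F by (auto simp: B_def)
    then have kK: "K\<^sup>2 \<le> (norm k)\<^sup>2" using K by (intro power_mono) auto
    have "(\<Sum>j\<in>UNIV. (cmod (coeff (\<lambda>y. G y $ j) k))\<^sup>2) = (\<Sum>j\<in>UNIV. 4 * pi\<^sup>2 * (k $ j)\<^sup>2 * (cmod (coeff psi k))\<^sup>2)"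
      by (intro sum.cong refl) (simp add: coeff_weak_grad[OF L w kl] norm_mult power_mult_distrib)
    also have "\<dots> = 4 * pi\<^sup>2 * (norm k)\<^sup>2 * (cmod (coeff psi k))\<^sup>2"
      by (simp add: norm_vec_def L2_set_def sum_nonneg sum_distrib_left sum_distrib_right)
    also have "\<dots> \<ge> 4 * pi\<^sup>2 * K\<^sup>2 * (cmod (coeff psi k))\<^sup>2"
      by (intro mult_right_mono mult_left_mono kK) auto
    finally show "(cmod (coeff psi k))\<^sup>2 \<le> (\<Sum>j\<in>UNIV. (cmod (coeff (\<lambda>y. G y $ j) k))\<^sup>2) / (4 * pi\<^sup>2 * K\<^sup>2)"
      using K by (simp add: field_simps)
  qed
  also have "\<dots> = (\<Sum>j\<in>UNIV. \<Sum>k\<in>F - B. (cmod (coeff (\<lambda>y. G y $ j) k))\<^sup>2) / (4 * pi\<^sup>2 * K\<^sup>2)"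
    by (subst sum.swap) (simp add: sum_divide_distrib)
  also have "\<dots> \<le> (\<Sum>j\<in>UNIV. LINT y|cell. (cmod (G y $ j))\<^sup>2) / (4 * pi\<^sup>2 * K\<^sup>2)"
    using F by (intro divide_right_mono sum_mono bessel_coeff L2_nth L) auto
  finally have tail: "(\<Sum>k\<in>F - B. (cmod (coeff psi k))\<^sup>2) \<le> (LINT y|cell. (norm (G y))\<^sup>2) / (4 * pi\<^sup>2 * K\<^sup>2)"
    by (simp add: integral_norm_vec_square[OF L(2)])
  have "(\<Sum>k\<in>F. (cmod (coeff psi k))\<^sup>2) = (\<Sum>k\<in>F \<inter> B. (cmod (coeff psi k))\<^sup>2) + (\<Sum>k\<in>F - B. (cmod (coeff psi k))\<^sup>2)"
    using F(1) by (rule sum.Int_Diff)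
  moreover have "(\<Sum>k\<in>F \<inter> B. (cmod (coeff psi k))\<^sup>2) \<le> (\<Sum>k\<in>B. (cmod (coeff psi k))\<^sup>2)"
    by (rule sum_mono2[OF finB]) auto
  ultimately show "(LINT y|cell. (cmod (psi y))\<^sup>2) \<le> (\<Sum>k | k \<in> lattice \<and> norm k \<le> K. (cmod (coeff psi k))\<^sup>2)
    + (LINT y|cell. (norm (G y))\<^sup>2) / (4 * pi\<^sup>2 * K\<^sup>2) + e"
    using le tail unfolding B_def[symmetric] by linarith
qed

section \<open>The Sobolev space as a space of pairs\<close>

text \<open>Each function carries one of its weak gradients, which is determined only up to null
  sets. All operations are then pointwise, and no gradient has to be chosen.\<close>

definition H1 :: "(real^'n \<Rightarrow> complex \<times> (complex^'n)) set" where
  "H1 = {u. H1_grad (\<lambda>y. fst (u y)) (\<lambda>y. snd (u y))}"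

definition pscale :: "complex \<Rightarrow> ('a \<Rightarrow> complex \<times> (complex^'n)) \<Rightarrow> 'a \<Rightarrow> complex \<times> (complex^'n)" where
  "pscale c u = (\<lambda>y. (c * fst (u y), c *s snd (u y)))"

lemma vector_space_pscale: "vector_space pscale"
  by unfold_locales (auto simp: pscale_def fun_eq_iff algebra_simps vec_eq_iff prod_eq_iff)

lemma norm_scale_vec: "norm (c *s (v :: complex^'n)) = cmod c * norm v"
proof (rule power2_eq_imp_eq)
  show "(norm (c *s v))\<^sup>2 = (cmod c * norm v)\<^sup>2"
    unfolding power_mult_distrib norm_vec_square by (simp add: norm_mult power_mult_distrib sum_distrib_left)
qed auto

lemma L2_vscale: "L2 G \<Longrightarrow> L2 (\<lambda>y. c *s (G y :: complex^'n))"
proof (rule L2_bound[where C="cmod c" and f=G])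
  assume "L2 G"
  then have [measurable]: "G \<in> borel_measurable cell" by (rule L2_measurable)
  have "continuous_on UNIV (\<lambda>x :: complex^'n. c *s x)"
    unfolding vector_scalar_mult_def by (intro continuous_intros)
  then show "(\<lambda>y. c *s G y) \<in> borel_measurable cell"
    by (rule borel_measurable_continuous_on) measurable
qed (simp_all add: norm_scale_vec)

lemma subspace_H1: "module.subspace pscale (H1 :: (real^'n \<Rightarrow> complex \<times> (complex^'n)) set)"
proof -
  interpret vector_space "pscale :: complex \<Rightarrow> (real^'n \<Rightarrow> complex \<times> (complex^'n)) \<Rightarrow> _" by (rule vector_space_pscale)
  interpret L: hform fscale "{f::real^'n \<Rightarrow> complex. L2 f}" l2form by (rule hform_l2)
  have add: "l2form (\<lambda>y. f y + g y) h = l2form f h + l2form g h" if "L2 f" "L2 g" "L2 h" for f g h :: "real^'n \<Rightarrow> complex"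
    using L.add_left[of f g h] that by (simp add: plus_fun_def)
  have scale: "l2form (\<lambda>y. c * f y) h = c * l2form f h" if "L2 f" "L2 h" for c and f h :: "real^'n \<Rightarrow> complex"
    using L.scale_left[of f h c] that by (simp add: fscale_def)
  show ?thesis
    unfolding subspace_def
  proof (intro conjI ballI allI)
    show "0 \<in> (H1 :: (real^'n \<Rightarrow> complex \<times> (complex^'n)) set)"
      by (auto simp: H1_def H1_grad_def periodic_def L2_const weak_grad_form l2form_def)
  next
    fix u v :: "real^'n \<Rightarrow> complex \<times> (complex^'n)" assume "u \<in> H1" "v \<in> H1"
    then show "u + v \<in> H1"
      by (auto simp: H1_def H1_grad_def periodic_def L2_add weak_grad_form add L2_nth test_fun_bounded)
  next
    fix u :: "real^'n \<Rightarrow> complex \<times> (complex^'n)" and c assume "u \<in> H1"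
    then show "pscale c u \<in> H1"
      by (auto simp: pscale_def H1_def H1_grad_def periodic_def L2_scale L2_vscale weak_grad_form scale L2_nth test_fun_bounded)
  qed
qed

lemma H1_L2: "u \<in> H1 \<Longrightarrow> L2 u"
proof -
  assume u: "u \<in> H1"
  have [measurable]: "(\<lambda>y. fst (u y)) \<in> borel_measurable cell" "(\<lambda>y. snd (u y)) \<in> borel_measurable cell"
    using u by (auto simp: H1_def H1_grad_def L2_def)
  have "(\<lambda>y. (fst (u y), snd (u y))) \<in> borel_measurable cell" by (rule borel_measurable_Pair) measurable
  moreover have "integrable cell (\<lambda>y. (norm (u y))\<^sup>2)"
    using u by (simp add: H1_def H1_grad_def L2_def norm_prod_def)
  ultimately show ?thesis by (simp add: L2_def)
qed

lemma norm_fst_snd_le: "norm (fst z) \<le> norm z" "norm (snd z) \<le> norm z"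
  using norm_fst_le[of "fst z" "snd z"] norm_snd_le[of "snd z" "fst z"] by simp_all

lemma L2_fst_snd:
  assumes "L2 u"
  shows "L2 (\<lambda>y. fst (u y))" "L2 (\<lambda>y. snd (u y))"
proof -
  have [measurable]: "u \<in> borel_measurable cell" using assms by (rule L2_measurable)
  have m: "(\<lambda>y. fst (u y)) \<in> borel_measurable cell" "(\<lambda>y. snd (u y)) \<in> borel_measurable cell"
    by (rule borel_measurable_continuous_on[of fst] borel_measurable_continuous_on[of snd];
        simp add: continuous_on_fst continuous_on_snd)+
  show "L2 (\<lambda>y. fst (u y))" by (rule L2_bound[OF assms m(1), where C=1]) (simp add: norm_fst_snd_le)
  show "L2 (\<lambda>y. snd (u y))" by (rule L2_bound[OF assms m(2), where C=1]) (simp add: norm_fst_snd_le)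
qed

lemma integral_square_mono:
  fixes f :: "real^'n \<Rightarrow> 'b::euclidean_space" and g :: "real^'n \<Rightarrow> 'c::euclidean_space"
  assumes "L2 f" "L2 g" "\<And>y. norm (f y) \<le> norm (g y)"
  shows "(LINT y|cell. (norm (f y))\<^sup>2) \<le> (LINT y|cell. (norm (g y))\<^sup>2)"
  by (rule integral_mono) (use assms in \<open>auto simp: L2_def intro!: power_mono\<close>)

text \<open>Pairs converge in L^2 to a pair, and the identity defining the weak gradient survives
  because each of its sides is continuous in L^2 for a fixed test function.\<close>

lemma H1_complete:
  fixes u :: "nat \<Rightarrow> real^'n \<Rightarrow> complex \<times> (complex^'n)"
  assumes u: "\<And>n. u n \<in> H1"
    and cauchy: "\<And>e. e > 0 \<Longrightarrow> \<exists>N. \<forall>m\<ge>N. \<forall>n\<ge>N. (LINT x|cell. (norm (u m x - u n x))\<^sup>2) < e"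
  obtains g where "g \<in> H1" "(\<lambda>n. LINT x|cell. (norm (u n x - g x))\<^sup>2) \<longlonglongrightarrow> 0"
proof -
  interpret L: hform fscale "{f::real^'n \<Rightarrow> complex. L2 f}" l2form by (rule hform_l2)
  have uL: "L2 (u n)" for n by (rule H1_L2[OF u])
  have up: "periodic (u n)" for n using u[of n] by (auto simp: H1_def H1_grad_def periodic_def prod_eq_iff)
  obtain g where g0: "L2 g" "(\<forall>n. periodic (u n)) \<longrightarrow> periodic g"
    and lim: "(\<lambda>n. LINT x|cell. (norm (u n x - g x))\<^sup>2) \<longlonglongrightarrow> 0"
    by (rule L2_complete[OF uL cauchy]) (assumption, rule that, assumption, simp, assumption)
  have g: "L2 g" "periodic g" using g0 up by simp_all
  have ud: "L2 (\<lambda>y. u n y - g y)" for n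
    using L2_add[OF uL[of n], of "\<lambda>y. - g y"] L2_bound[OF g(1), of "\<lambda>y. - g y" 1] L2_measurable[OF g(1)] by simp
  \<comment> \<open>\<open>p\<close> stands for the projection to the function or to one component
    of the gradient.\<close>
  have comp: "(\<lambda>n. l2form (\<lambda>y. p (u n y)) w) \<longlonglongrightarrow> l2form (\<lambda>y. p (g y)) w"
    if p: "\<And>x y. p (x - y) = p x - p y" "\<And>x. cmod (p x) \<le> norm x" "\<And>v :: real^'n \<Rightarrow> _. L2 v \<Longrightarrow> L2 (\<lambda>y. p (v y))" and w: "L2 w"
    for p :: "complex \<times> (complex^'n) \<Rightarrow> complex" and w :: "real^'n \<Rightarrow> complex"
  proof (rule L.tendsto_left)
    show "(\<lambda>n. qf l2form ((\<lambda>y. p (u n y)) - (\<lambda>y. p (g y)))) \<longlonglongrightarrow> 0"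
    proof (rule Lim_null_comparison[OF _ lim], intro always_eventually allI)
      fix n
      have "(LINT y|cell. (cmod (p (u n y - g y)))\<^sup>2) \<le> (LINT y|cell. (norm (u n y - g y))\<^sup>2)"
        by (rule integral_square_mono[OF p(3)[OF ud] ud p(2)])
      moreover have "0 \<le> (LINT y|cell. (cmod (p (u n y - g y)))\<^sup>2)"
        by (rule Bochner_Integration.integral_nonneg) simp
      ultimately show "norm (qf l2form ((\<lambda>y. p (u n y)) - (\<lambda>y. p (g y)))) \<le> (LINT y|cell. (norm (u n y - g y))\<^sup>2)"
        by (simp add: qf_l2form p(1))
    qed
  qed (use p w uL g in auto)
  have nle: "cmod (snd x $ j) \<le> norm x" for x :: "complex \<times> (complex^'n)" and j
    using Finite_Cartesian_Product.norm_nth_le[of "snd x" j] norm_fst_snd_le(2)[of x] by linarith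
  have "weak_grad (\<lambda>y. fst (g y)) (\<lambda>y. snd (g y))"
    unfolding weak_grad_form
  proof (intro allI impI)
    fix phi :: "real^'n \<Rightarrow> real" and Dphi j assume t: "test_fun phi Dphi"
    have 1: "(\<lambda>n. l2form (\<lambda>y. fst (u n y)) (\<lambda>y. complex_of_real (Dphi y $ j))) \<longlonglongrightarrow> l2form (\<lambda>y. fst (g y)) (\<lambda>y. complex_of_real (Dphi y $ j))"
      by (rule comp) (auto simp: norm_fst_snd_le L2_fst_snd test_fun_bounded[OF t])
    have 2: "(\<lambda>n. - l2form (\<lambda>y. snd (u n y) $ j) (\<lambda>y. complex_of_real (phi y))) \<longlonglongrightarrow> - l2form (\<lambda>y. snd (g y) $ j) (\<lambda>y. complex_of_real (phi y))"
      by (rule tendsto_minus, rule comp) (auto simp: nle L2_fst_snd test_fun_bounded[OF t] intro!: L2_nth)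
    have "l2form (\<lambda>y. fst (u n y)) (\<lambda>y. complex_of_real (Dphi y $ j)) = - l2form (\<lambda>y. snd (u n y) $ j) (\<lambda>y. complex_of_real (phi y))" for n
      using u[of n] t by (simp add: H1_def H1_grad_def weak_grad_form)
    then show "l2form (\<lambda>y. fst (g y)) (\<lambda>y. complex_of_real (Dphi y $ j)) = - l2form (\<lambda>y. snd (g y) $ j) (\<lambda>y. complex_of_real (phi y))"
      using LIMSEQ_unique[OF 1] 2 by simp
  qed
  then have "g \<in> H1"
    using g L2_fst_snd[OF g(1)] by (auto simp: H1_def H1_grad_def periodic_def)
  then show thesis using that lim by blast
qed

text \<open>The coefficients are bounded and countably many, so a diagonal subsequence makes all of
  them converge. Frequencies above a radius contribute uniformly little by the gradient bound; the
  finitely many below it are handled by convergence.\<close>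

theorem rellich:
  fixes u :: "nat \<Rightarrow> real^'n \<Rightarrow> complex \<times> (complex^'n)"
  assumes u: "\<And>n. u n \<in> H1" and bound: "\<And>n. (LINT y|cell. (norm (u n y))\<^sup>2) \<le> C"
  obtains r :: "nat \<Rightarrow> nat" where "strict_mono r"
    "\<And>e. e > 0 \<Longrightarrow> \<exists>N. \<forall>m\<ge>N. \<forall>n\<ge>N. (LINT y|cell. (cmod (fst (u (r m) y) - fst (u (r n) y)))\<^sup>2) < e"
proof -
  interpret vector_space "pscale :: complex \<Rightarrow> (real^'n \<Rightarrow> complex \<times> (complex^'n)) \<Rightarrow> _" by (rule vector_space_pscale)
  have uL: "L2 (u n)" "L2 (\<lambda>y. fst (u n y))" "L2 (\<lambda>y. snd (u n y))" for n
    using H1_L2[OF u] L2_fst_snd by auto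
  have C0: "C \<ge> 0"
    using bound[of 0] by (rule order_trans[rotated]) (rule Bochner_Integration.integral_nonneg, simp)
  have cb: "cmod (coeff (\<lambda>y. fst (u n y)) k) \<le> sqrt C" if "k \<in> lattice" for n k
  proof (rule real_le_rsqrt)
    have "(cmod (coeff (\<lambda>y. fst (u n y)) k))\<^sup>2 \<le> (LINT y|cell. (cmod (fst (u n y)))\<^sup>2)"
      using bessel_coeff[OF uL(2)[of n], of "{k}"] that by simp
    also have "\<dots> \<le> (LINT y|cell. (norm (u n y))\<^sup>2)"
      by (rule integral_square_mono) (use uL in \<open>auto simp: norm_fst_snd_le\<close>)
    finally show "(cmod (coeff (\<lambda>y. fst (u n y)) k))\<^sup>2 \<le> C" using bound[of n] by simp
  qed
  obtain r :: "nat \<Rightarrow> nat" where r: "strict_mono r"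
    and conv: "\<And>k. k \<in> lattice \<Longrightarrow> \<exists>l. (\<lambda>n. coeff (\<lambda>y. fst (u (r n) y)) k) \<longlonglongrightarrow> l"
    using function_convergent_subsequence[OF countable_lattice, of "\<lambda>n. coeff (\<lambda>y. fst (u n y))" "sqrt C"] cb
    by metis
  show thesis
  proof (rule that[OF r])
    fix e :: real assume e: "e > 0"
    \<comment> \<open>The gradient of a difference has squared norm at most 4 C, so its tail is at
      most C / (\<pi>^2 K^2) \<le> e / \<pi>^2 \<le> e / 2. The added 1 keeps \<open>K\<close>
      positive when \<open>C = 0\<close>.\<close>
    define K where "K = sqrt (C / e) + 1"
    have K: "K > 0" "C / e \<le> K\<^sup>2"
    proof -
      have "sqrt (C / e) \<ge> 0" using C0 e by simp
      then show "K > 0" unfolding K_def by linarith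
      have "C / e = (sqrt (C / e))\<^sup>2" using C0 e by simp
      also have "\<dots> \<le> K\<^sup>2" unfolding K_def using \<open>sqrt (C / e) \<ge> 0\<close> by (intro power_mono) auto
      finally show "C / e \<le> K\<^sup>2" .
    qed
    define B where "B = {k :: real^'n. k \<in> lattice \<and> norm k \<le> K}"
    have finB: "finite B" unfolding B_def by (rule finite_lattice_ball)
    define l where "l k = lim (\<lambda>n. coeff (\<lambda>y. fst (u (r n) y)) k)" for k
    have l: "(\<lambda>n. coeff (\<lambda>y. fst (u (r n) y)) k) \<longlonglongrightarrow> l k" if "k \<in> lattice" for k
      using conv[OF that] unfolding l_def by (metis limI)
    have "(\<lambda>n. \<Sum>k\<in>B. (cmod (coeff (\<lambda>y. fst (u (r n) y)) k - l k))\<^sup>2) \<longlonglongrightarrow> (\<Sum>k\<in>B. (cmod (l k - l k))\<^sup>2)"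
      by (intro tendsto_intros l) (simp add: B_def)
    \<comment> \<open>Two such sums, each doubled by |x + y|^2 \<le> 2 |x|^2 + 2 |y|^2, amount to
      e/2.\<close>
    then have "eventually (\<lambda>n. (\<Sum>k\<in>B. (cmod (coeff (\<lambda>y. fst (u (r n) y)) k - l k))\<^sup>2) < e / 8) sequentially"
      using e by (intro order_tendstoD(2)) auto
    then obtain N where N: "\<And>n. n \<ge> N \<Longrightarrow> (\<Sum>k\<in>B. (cmod (coeff (\<lambda>y. fst (u (r n) y)) k - l k))\<^sup>2) < e / 8"
      unfolding eventually_sequentially by blast
    show "\<exists>N. \<forall>m\<ge>N. \<forall>n\<ge>N. (LINT y|cell. (cmod (fst (u (r m) y) - fst (u (r n) y)))\<^sup>2) < e"
    proof (intro exI[of _ N] allI impI)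
      fix m n assume mn: "N \<le> m" "N \<le> n"
      let ?p = "\<lambda>y. fst (u (r m) y) - fst (u (r n) y)" and ?G = "\<lambda>y. snd (u (r m) y) - snd (u (r n) y)"
      have "u (r m) - u (r n) \<in> H1" by (rule subspace_diff[OF subspace_H1 u u])
      then have H: "L2 ?p" "L2 ?G" "weak_grad ?p ?G" and dL: "L2 (u (r m) - u (r n))"
        using H1_L2[of "u (r m) - u (r n)"] by (simp_all add: H1_def H1_grad_def)
      have co: "coeff ?p k = coeff (\<lambda>y. fst (u (r m) y)) k - coeff (\<lambda>y. fst (u (r n) y)) k" for k
        unfolding coeff_def
        by (subst Bochner_Integration.integral_diff[symmetric]) (auto intro!: L2_mult_integrable uL L2_chr simp: left_diff_distrib)
      have "(\<Sum>k\<in>B. (cmod (coeff ?p k))\<^sup>2) \<le> (\<Sum>k\<in>B. 2 * (cmod (coeff (\<lambda>y. fst (u (r m) y)) k - l k))\<^sup>2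
          + 2 * (cmod (coeff (\<lambda>y. fst (u (r n) y)) k - l k))\<^sup>2)"
      proof (rule sum_mono)
        fix k
        show "(cmod (coeff ?p k))\<^sup>2 \<le> 2 * (cmod (coeff (\<lambda>y. fst (u (r m) y)) k - l k))\<^sup>2
          + 2 * (cmod (coeff (\<lambda>y. fst (u (r n) y)) k - l k))\<^sup>2"
          unfolding co
          using norm_add_square_le[of "coeff (\<lambda>y. fst (u (r m) y)) k - l k" "l k - coeff (\<lambda>y. fst (u (r n) y)) k"]
          by (simp add: norm_minus_commute)
      qed
      also have "\<dots> < e / 2"
        unfolding sum.distrib sum_distrib_left[symmetric] using N[OF mn(1)] N[OF mn(2)] by linarith
      finally have low: "(\<Sum>k\<in>B. (cmod (coeff ?p k))\<^sup>2) < e / 2" .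
      have "(LINT y|cell. (norm (?G y))\<^sup>2) \<le> (LINT y|cell. (norm ((u (r m) - u (r n)) y))\<^sup>2)"
        by (rule integral_square_mono[OF H(2) dL]) (use norm_fst_snd_le(2)[of "u (r m) _ - u (r n) _"] in simp)
      also have "\<dots> \<le> (LINT y|cell. 2 * (norm (u (r m) y))\<^sup>2 + 2 * (norm (u (r n) y))\<^sup>2)"
      proof (rule integral_mono)
        show "integrable cell (\<lambda>y. (norm ((u (r m) - u (r n)) y))\<^sup>2)" using dL by (simp add: L2_def)
        show "integrable cell (\<lambda>y. 2 * (norm (u (r m) y))\<^sup>2 + 2 * (norm (u (r n) y))\<^sup>2)"
          using uL by (simp add: L2_def)
        fix y show "(norm ((u (r m) - u (r n)) y))\<^sup>2 \<le> 2 * (norm (u (r m) y))\<^sup>2 + 2 * (norm (u (r n) y))\<^sup>2"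
          using norm_add_square_le[of "u (r m) y" "- u (r n) y"] by simp
      qed
      also have "\<dots> \<le> 4 * C"
        using bound[of "r m"] bound[of "r n"] uL by (simp add: L2_def)
      finally have "(LINT y|cell. (norm (?G y))\<^sup>2) / (4 * pi\<^sup>2 * K\<^sup>2) \<le> 4 * C / (4 * pi\<^sup>2 * K\<^sup>2)"
        by (intro divide_right_mono) auto
      also have "\<dots> = C / (pi\<^sup>2 * K\<^sup>2)" by simp
      also have "\<dots> \<le> e / 2"
      proof -
        have "2 \<le> pi\<^sup>2"
          using power_mono[OF pi_ge_two, of 2] by simp
        then have "2 * K\<^sup>2 \<le> pi\<^sup>2 * K\<^sup>2" by (intro mult_right_mono) auto
        moreover have "C \<le> e * K\<^sup>2" using K e by (simp add: field_simps)
        moreover have "e * (2 * K\<^sup>2) \<le> e * (pi\<^sup>2 * K\<^sup>2)" using calculation(1) e by (intro mult_left_mono) auto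
        ultimately have "C * 2 \<le> e * (pi\<^sup>2 * K\<^sup>2)" by linarith
        moreover have "pi\<^sup>2 * K\<^sup>2 > 0" using K(1) by simp
        ultimately show ?thesis by (simp add: divide_le_eq field_simps)
      qed
      finally show "(LINT y|cell. (cmod (?p y))\<^sup>2) < e"
        using low_frequency_bound[OF H K(1)] low unfolding B_def by linarith
    qed
  qed
qed

section \<open>The Bloch forms\<close>

text \<open>The maximum \<open>m\<close> of the quadratic form on the unit sphere is attained and is
  an eigenvalue, so \<open>m / r\<close> is one of the roots. Coercivity makes it positive, so that
  its square root enters with its true value.\<close>

lemma rayleigh_le_max_root:
  fixes M :: "real^'n^'n" and \<xi> :: "real^'n"
  assumes sym: "transpose M = M" and r: "r > 0" and al: "\<alpha> > 0"
    and coer: "\<And>\<xi>. (M *v \<xi>) \<bullet> \<xi> \<ge> \<alpha> * (norm \<xi>)\<^sup>2"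
  defines "T \<equiv> {sqrt l | l. det (M - (l * r) *\<^sub>R mat 1) = 0}"
  shows "0 \<le> Max T" "(M *v \<xi>) \<bullet> \<xi> \<le> (Max T)\<^sup>2 * r * (norm \<xi>)\<^sup>2"
proof -
  have self_adj: "(M *v x) \<bullet> y = x \<bullet> (M *v y)" for x y
    using dot_lmul_matrix[of x M y] sym by (metis vector_transpose_matrix)
  have root_iff: "det (M - s *\<^sub>R mat 1) = 0 \<longleftrightarrow> (\<exists>x. x \<noteq> 0 \<and> M *v x = s *\<^sub>R x)" for s
  proof -
    have "det (M - s *\<^sub>R mat 1) = 0 \<longleftrightarrow> rank (M - s *\<^sub>R mat 1) \<noteq> CARD('n)"
      using det_eq_0_rank[of "M - s *\<^sub>R mat 1"] rank_bound[of "M - s *\<^sub>R mat 1"] by auto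
    also have "\<dots> \<longleftrightarrow> (\<exists>x. x \<noteq> 0 \<and> (M - s *\<^sub>R mat 1) *v x = 0)"
      using matrix_nonfull_linear_equations_eq[of "M - s *\<^sub>R mat 1"] by blast
    finally show ?thesis by (simp add: matrix_vector_mult_diff_rdistrib scaleR_matrix_vector_assoc[symmetric])
  qed
  \<comment> \<open>\<open>Max\<close> is informative for finite sets only. Eigenvectors of distinct
    roots are orthogonal, and pairwise orthogonal vectors are finite in number.\<close>
  have fin: "finite {l. det (M - (l * r) *\<^sub>R mat 1) = 0}"
  proof -
    have "\<exists>x. \<forall>l\<in>{l. det (M - (l * r) *\<^sub>R mat 1) = 0}. x l \<noteq> 0 \<and> M *v x l = (l * r) *\<^sub>R x l"
      by (rule bchoice) (simp add: root_iff)
    then obtain x where x: "\<And>l. det (M - (l * r) *\<^sub>R mat 1) = 0 \<Longrightarrow> x l \<noteq> 0"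
        "\<And>l. det (M - (l * r) *\<^sub>R mat 1) = 0 \<Longrightarrow> M *v x l = (l * r) *\<^sub>R x l" by auto
    have orth: "x k \<bullet> x l = 0" if "det (M - (k * r) *\<^sub>R mat 1) = 0" "det (M - (l * r) *\<^sub>R mat 1) = 0" "k \<noteq> l" for k l
    proof -
      have "(k * r) * (x k \<bullet> x l) = (l * r) * (x k \<bullet> x l)"
        using self_adj[of "x k" "x l"] x(2)[OF that(1)] x(2)[OF that(2)] by simp
      then show ?thesis using that(3) r by simp
    qed
    have "inj_on x {l. det (M - (l * r) *\<^sub>R mat 1) = 0}"
    proof (rule inj_onI, rule ccontr)
      fix k l assume "k \<in> {l. det (M - (l * r) *\<^sub>R mat 1) = 0}" "l \<in> {l. det (M - (l * r) *\<^sub>R mat 1) = 0}"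
        "x k = x l" "k \<noteq> l"
      then show False using orth[of k l] x(1)[of k] by simp
    qed
    moreover have "finite (x ` {l. det (M - (l * r) *\<^sub>R mat 1) = 0})"
      by (rule pairwise_orthogonal_imp_finite) (auto simp: pairwise_def orthogonal_def intro!: orth)
    ultimately show ?thesis using finite_imageD by blast
  qed
  have "T = sqrt ` {l. det (M - (l * r) *\<^sub>R mat 1) = 0}" by (auto simp: T_def)
  then have finT: "finite T" using fin by simp
  have "\<exists>x\<in>sphere 0 1. \<forall>y\<in>sphere 0 1. (M *v y) \<bullet> y \<le> (M *v x) \<bullet> (x :: real^'n)"
    by (rule continuous_attains_sup)
       (auto intro!: continuous_on_inner matrix_vector_mult_linear_continuous_on continuous_on_id)
  then obtain x0 :: "real^'n" where x0: "norm x0 = 1" and max: "\<And>y. norm y = 1 \<Longrightarrow> (M *v y) \<bullet> y \<le> (M *v x0) \<bullet> x0"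
    by auto
  define m where "m = (M *v x0) \<bullet> x0"
  have m0: "m > 0" using coer[of x0] x0 al by (simp add: m_def)
  have le: "(M *v y) \<bullet> y \<le> m * (norm y)\<^sup>2" for y
  proof (cases "y = 0")
    case False
    have "(M *v ((1 / norm y) *\<^sub>R y)) \<bullet> ((1 / norm y) *\<^sub>R y) \<le> m"
      unfolding m_def by (rule max) (use False in simp)
    then show ?thesis using False by (simp add: matrix_vector_mult_scaleR field_simps power2_eq_square)
  qed simp
  \<comment> \<open>\<open>w\<close> is half the gradient at \<open>x0\<close> of
    \<open>m |x|^2 - M x \<bullet> x\<close>, a nonnegative function that vanishes at
    \<open>x0\<close>. Moving along \<open>- w\<close> shows that it must be 0.\<close>
  define w where "w = m *\<^sub>R x0 - M *v x0"
  define p where "p = m * (norm w)\<^sup>2 - (M *v w) \<bullet> w"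
  have x00: "x0 \<bullet> x0 = 1" using x0 by (simp add: dot_square_norm)
  have "2 * (norm w)\<^sup>2 \<le> t * p" if "t > 0" for t
  proof -
    have "(M *v (x0 - t *\<^sub>R w)) \<bullet> (x0 - t *\<^sub>R w) \<le> m * (norm (x0 - t *\<^sub>R w))\<^sup>2" by (rule le)
    moreover have "(M *v (x0 - t *\<^sub>R w)) \<bullet> (x0 - t *\<^sub>R w) = m - 2 * t * ((M *v x0) \<bullet> w) + t\<^sup>2 * ((M *v w) \<bullet> w)"
      using self_adj[of w x0]
      by (simp add: matrix_vector_mult_diff_distrib matrix_vector_mult_scaleR inner_diff_left inner_diff_right m_def
          power2_eq_square algebra_simps inner_commute)
    moreover have "m * (norm (x0 - t *\<^sub>R w))\<^sup>2 = m - 2 * t * (m * (x0 \<bullet> w)) + t\<^sup>2 * (m * (norm w)\<^sup>2)"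
      unfolding power2_norm_eq_inner
      by (simp add: inner_diff_left inner_diff_right x00 power2_eq_square[of t] algebra_simps inner_commute[of w x0])
    ultimately have "m - 2 * t * ((M *v x0) \<bullet> w) + t\<^sup>2 * ((M *v w) \<bullet> w)
        \<le> m - 2 * t * (m * (x0 \<bullet> w)) + t\<^sup>2 * (m * (norm w)\<^sup>2)"
      by linarith
    then have "2 * t * (m * (x0 \<bullet> w) - (M *v x0) \<bullet> w) \<le> t\<^sup>2 * p"
      unfolding p_def right_diff_distrib by linarith
    moreover have "m * (x0 \<bullet> w) - (M *v x0) \<bullet> w = (norm w)\<^sup>2"
      by (simp add: w_def power2_norm_eq_inner inner_diff_left)
    ultimately have "2 * t * (norm w)\<^sup>2 \<le> t\<^sup>2 * p" by simp
    then have "t * (2 * (norm w)\<^sup>2) \<le> t * (t * p)" by (simp add: power2_eq_square algebra_simps)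
    then show ?thesis using that by simp
  qed note small = this
  have "(norm w)\<^sup>2 = 0"
  proof (rule ccontr)
    assume "(norm w)\<^sup>2 \<noteq> 0"
    then have w: "(norm w)\<^sup>2 > 0" by simp
    then have p: "p > 0" using small[of 1] by linarith
    \<comment> \<open>The step \<open>t = |w|^2 / p\<close> would give
      \<open>2 |w|^2 \<le> |w|^2\<close>.\<close>
    have "2 * (norm w)\<^sup>2 \<le> (norm w)\<^sup>2 / p * p" using p w by (intro small) simp
    then show False using p w by simp
  qed
  then have "M *v x0 = (m / r * r) *\<^sub>R x0" using r by (simp add: w_def)
  moreover have "x0 \<noteq> 0" using x0 by auto
  ultimately have "det (M - (m / r * r) *\<^sub>R mat 1) = 0" unfolding root_iff by blast
  then have "sqrt (m / r) \<in> T" by (auto simp: T_def)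
  then have maxT: "sqrt (m / r) \<le> Max T" using finT by simp
  have pos: "sqrt (m / r) \<ge> 0" using m0 r by simp
  then show "0 \<le> Max T" using maxT by linarith
  have "m / r = (sqrt (m / r))\<^sup>2" using m0 r by simp
  also have "\<dots> \<le> (Max T)\<^sup>2" by (rule power_mono[OF maxT pos])
  finally have "m \<le> (Max T)\<^sup>2 * r" using r by (simp add: field_simps)
  then have "m * (norm \<xi>)\<^sup>2 \<le> (Max T)\<^sup>2 * r * (norm \<xi>)\<^sup>2" by (intro mult_right_mono) auto
  then show "(M *v \<xi>) \<bullet> \<xi> \<le> (Max T)\<^sup>2 * r * (norm \<xi>)\<^sup>2" using le[of \<xi>] by linarith
qed

section \<open>Real matrices acting on complex vectors\<close>

lemma cdot_add_left: "cdot (u + v) w = cdot u w + cdot v w"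
  by (simp add: cdot_def ring_distribs sum.distrib)

lemma cdot_scale_left: "cdot (c *s u) w = c * cdot u w"
  by (simp add: cdot_def sum_distrib_left mult.assoc)

lemma cdot_scale_right: "cdot u (c *s w) = cnj c * cdot u w"
  by (simp add: cdot_def sum_distrib_left ac_simps)

lemma cmatvec_add: "cmatvec M (u + v) = cmatvec M u + cmatvec M v"
  by (simp add: cmatvec_def vec_eq_iff ring_distribs sum.distrib)

lemma cmatvec_scale: "cmatvec M (c *s v) = c *s cmatvec M v"
  by (simp add: cmatvec_def vec_eq_iff sum_distrib_left ac_simps)

lemma cdot_cmatvec: "cdot (cmatvec M v) w = (\<Sum>i\<in>UNIV. \<Sum>j\<in>UNIV. complex_of_real (M$i$j) * v$j * cnj (w$i))"
  by (simp add: cdot_def cmatvec_def sum_distrib_right)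

lemma cdot_cmatvec_herm:
  assumes "transpose M = M"
  shows "cdot (cmatvec M w) v = cnj (cdot (cmatvec M v) w)"
proof -
  have "M$i$j = M$j$i" for i j using assms by (metis transpose_def vec_lambda_beta)
  then have "cdot (cmatvec M w) v = (\<Sum>i\<in>UNIV. \<Sum>j\<in>UNIV. complex_of_real (M$j$i) * w$j * cnj (v$i))"
    unfolding cdot_cmatvec by simp
  also have "\<dots> = (\<Sum>j\<in>UNIV. \<Sum>i\<in>UNIV. complex_of_real (M$j$i) * w$j * cnj (v$i))" by (rule sum.swap)
  also have "\<dots> = cnj (cdot (cmatvec M v) w)" by (simp add: cdot_cmatvec ac_simps)
  finally show ?thesis .
qed

lemma norm_cdot_cmatvec:
  fixes M :: "real^'n^'n"
  shows "cmod (cdot (cmatvec M v) w) \<le> (real CARD('n))\<^sup>2 * norm M * norm v * norm w"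
proof -
  have entry: "cmod (complex_of_real (M$i$j) * v$j * cnj (w$i)) \<le> norm M * norm v * norm w" for i j
  proof -
    have "\<bar>M$i$j\<bar> \<le> norm M"
      using Finite_Cartesian_Product.norm_nth_le[of "M$i" j] Finite_Cartesian_Product.norm_nth_le[of M i] by simp
    then show ?thesis
      by (auto simp: norm_mult intro!: mult_mono Finite_Cartesian_Product.norm_nth_le)
  qed
  have "cmod (cdot (cmatvec M v) w) \<le> (\<Sum>i\<in>UNIV. \<Sum>j\<in>UNIV. cmod (complex_of_real (M$i$j) * v$j * cnj (w$i)))"
    unfolding cdot_cmatvec by (rule order_trans[OF norm_sum sum_mono[OF norm_sum]])
  also have "\<dots> \<le> (\<Sum>i\<in>(UNIV::'n set). \<Sum>j\<in>(UNIV::'n set). norm M * norm v * norm w)"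
    by (intro sum_mono entry)
  finally show ?thesis by (simp add: power2_eq_square mult.assoc)
qed

text \<open>The matrix is real, so mixed terms of real and imaginary parts are purely imaginary.
  Coercivity and the speed bound, stated for real vectors, carry over to complex ones.\<close>

lemma Re_cdot_cmatvec:
  fixes M :: "real^'n^'n"
  shows "Re (cdot (cmatvec M v) v) = (M *v (\<chi> i. Re (v$i))) \<bullet> (\<chi> i. Re (v$i)) + (M *v (\<chi> i. Im (v$i))) \<bullet> (\<chi> i. Im (v$i))"
  by (simp add: cdot_cmatvec inner_vec_def matrix_vector_mult_def sum_distrib_left sum_distrib_right sum.distrib algebra_simps)

lemma norm_Re_Im_square:
  fixes v :: "complex^'n"
  shows "(norm v)\<^sup>2 = (norm (\<chi> i. Re (v$i)))\<^sup>2 + (norm (\<chi> i. Im (v$i)))\<^sup>2"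
  unfolding norm_vec_square
  by (simp add: norm_vec_def L2_set_def sum_nonneg cmod_power2 sum.distrib)

text \<open>The forms on \<open>H1\<close> arise from weighted L^2 forms along linear maps: the
  twisted gradient for the energy, the first component for the mass.\<close>

lemma hform_pullback:
  assumes "hform sc Y s" "vector_space sc'" "module.subspace sc' X"
    and T: "\<And>u. u \<in> X \<Longrightarrow> T u \<in> Y" "\<And>u v. T (u + v) = T u + T v" "\<And>c u. T (sc' c u) = sc c (T u)"
  shows "hform sc' X (\<lambda>u v. s (T u) (T v))"
proof -
  interpret Y: hform sc Y s by fact
  interpret vector_space sc' by fact
  show ?thesis
  proof
    show "subspace X" by fact
    show "s (T (u + v)) (T w) = s (T u) (T w) + s (T v) (T w)" if "u \<in> X" "v \<in> X" "w \<in> X" for u v w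
      using that T by (simp add: Y.add_left)
    show "s (T (sc' c u)) (T w) = c * s (T u) (T w)" if "u \<in> X" "w \<in> X" for u w c
      using that T by (simp add: Y.scale_left)
    show "s (T v) (T u) = cnj (s (T u) (T v))" if "u \<in> X" "v \<in> X" for u v
      using that T by (intro Y.herm) auto
    show "0 \<le> qf (\<lambda>u v. s (T u) (T v)) u" if "u \<in> X" for u
      using Y.nonneg[OF T(1)[OF that]] by (simp add: qf_def)
  qed
qed

definition vscale :: "complex \<Rightarrow> ('a \<Rightarrow> complex^'n) \<Rightarrow> 'a \<Rightarrow> complex^'n" where
  "vscale c F = (\<lambda>y. c *s F y)"

lemma vector_space_vscale: "vector_space vscale"
  by unfold_locales (auto simp: vscale_def fun_eq_iff algebra_simps vec_eq_iff)

definition shift_vec :: "real^'n \<Rightarrow> complex^'n" where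
  "shift_vec \<theta> = (\<chi> i. 2 * \<i> * complex_of_real pi * complex_of_real (\<theta>$i))"

text \<open>\<open>tgrad\<close> recast as a map on pairs: linear in the pair and affine in
  \<theta>.\<close>

definition bgrad :: "real^'n \<Rightarrow> (real^'n \<Rightarrow> complex \<times> (complex^'n)) \<Rightarrow> real^'n \<Rightarrow> complex^'n" where
  "bgrad \<theta> u = (\<lambda>y. snd (u y) + fst (u y) *s shift_vec \<theta>)"

lemma tgrad_bgrad: "tgrad \<theta> \<psi> G y = bgrad \<theta> (\<lambda>y. (\<psi> y, G y)) y"
  by (simp add: tgrad_def bgrad_def shift_vec_def vec_eq_iff mult.commute)

lemma L2_scale_vec:
  assumes "L2 f"
  shows "L2 (\<lambda>y. f y *s (v :: complex^'n))"
proof (rule L2_bound[OF assms, where C="norm v"])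
  have "continuous_on UNIV (\<lambda>z. z *s v)"
    unfolding vector_scalar_mult_def by (intro continuous_intros)
  then show "(\<lambda>y. f y *s v) \<in> borel_measurable cell"
    by (rule borel_measurable_continuous_on) (rule L2_measurable[OF assms])
qed (simp add: norm_scale_vec mult.commute)

lemma L2_bgrad: "L2 u \<Longrightarrow> L2 (bgrad \<theta> u)"
  unfolding bgrad_def by (intro L2_add L2_scale_vec L2_fst_snd)

text \<open>The bounds \<open>K\<close> and \<open>R\<close> are not declared nonnegative, hence
  their absolute values in the upper estimates below.\<close>

locale bloch =
  fixes A :: "real^'n \<Rightarrow> real^'n^'n" and rho :: "real^'n \<Rightarrow> real" and K R \<alpha> \<rho>\<^sub>0 :: real
  assumes A_meas: "A \<in> borel_measurable cell"
    and A_bdd: "AE y in cell. norm (A y) \<le> K"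
    and A_sym: "AE y in cell. transpose (A y) = A y"
    and alpha: "\<alpha> > 0"
    and A_coer: "AE y in cell. \<forall>\<xi>. (A y *v \<xi>) \<bullet> \<xi> \<ge> \<alpha> * (norm \<xi>)\<^sup>2"
    and rho_meas: "rho \<in> borel_measurable cell"
    and rho_bdd: "AE y in cell. \<bar>rho y\<bar> \<le> R"
    and rho_pos: "\<rho>\<^sub>0 > 0"
    and rho_min: "AE y in cell. rho y \<ge> \<rho>\<^sub>0"
begin

definition aform :: "(real^'n \<Rightarrow> complex^'n) \<Rightarrow> (real^'n \<Rightarrow> complex^'n) \<Rightarrow> complex" where
  "aform F F' = (LINT y|cell. cdot (cmatvec (A y) (F y)) (F' y))"

definition rform :: "(real^'n \<Rightarrow> complex) \<Rightarrow> (real^'n \<Rightarrow> complex) \<Rightarrow> complex" where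
  "rform f g = (LINT y|cell. complex_of_real (rho y) * f y * cnj (g y))"

lemma aform_integrable:
  assumes F: "L2 F" "L2 F'"
  shows "integrable cell (\<lambda>y. cdot (cmatvec (A y) (F y)) (F' y))"
proof (rule L2_bilinear_integrable[OF F, where C="(real CARD('n))\<^sup>2 * K"])
  have m: "(\<lambda>y. A y $ i $ j) \<in> borel_measurable cell" for i j
    by (rule borel_measurable_continuous_on[OF continuous_on_component[OF continuous_on_component[OF continuous_on_id]] A_meas])
  have [measurable]: "(\<lambda>y. complex_of_real (A y $ i $ j)) \<in> borel_measurable cell"
    "(\<lambda>y. F y $ j) \<in> borel_measurable cell" "(\<lambda>y. cnj (F' y $ j)) \<in> borel_measurable cell" for i j
    using borel_measurable_continuous_on[OF continuous_on_of_real[OF continuous_on_id] m]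
      L2_measurable[OF L2_nth[OF F(1)]]
      borel_measurable_continuous_on[OF continuous_on_cnj[OF continuous_on_id] L2_measurable[OF L2_nth[OF F(2)]]]
    by simp_all
  show "(\<lambda>y. cdot (cmatvec (A y) (F y)) (F' y)) \<in> borel_measurable cell"
    unfolding cdot_cmatvec by measurable
  show "AE y in cell. cmod (cdot (cmatvec (A y) (F y)) (F' y)) \<le> (real CARD('n))\<^sup>2 * K * norm (F y) * norm (F' y)"
    using A_bdd
  proof eventually_elim
    case (elim y)
    have "(real CARD('n))\<^sup>2 * norm (A y) * norm (F y) * norm (F' y) \<le> (real CARD('n))\<^sup>2 * K * norm (F y) * norm (F' y)"
      using elim by (intro mult_right_mono mult_left_mono) auto
    then show ?case using norm_cdot_cmatvec[of "A y" "F y" "F' y"] by linarith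
  qed
qed

lemma qf_aform: "L2 F \<Longrightarrow> qf aform F = (LINT y|cell. Re (cdot (cmatvec (A y) (F y)) (F y)))"
  by (simp add: qf_def aform_def integral_Re[OF aform_integrable])

lemma aform_lower:
  assumes "L2 F"
  shows "\<alpha> * (LINT y|cell. (norm (F y))\<^sup>2) \<le> qf aform F"
proof -
  have "(LINT y|cell. \<alpha> * (norm (F y))\<^sup>2) \<le> (LINT y|cell. Re (cdot (cmatvec (A y) (F y)) (F y)))"
  proof (rule integral_mono_AE)
    show "AE y in cell. \<alpha> * (norm (F y))\<^sup>2 \<le> Re (cdot (cmatvec (A y) (F y)) (F y))"
      using A_coer
    proof eventually_elim
      case (elim y)
      show ?case unfolding Re_cdot_cmatvec norm_Re_Im_square[of "F y"] ring_distribs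
        by (intro add_mono elim[rule_format])
    qed
  qed (use assms integrable_Re[OF aform_integrable[OF assms assms]] in \<open>simp_all add: L2_def\<close>)
  then show ?thesis using assms by (simp add: qf_aform)
qed

lemma aform_upper:
  assumes "L2 F"
  shows "qf aform F \<le> (real CARD('n))\<^sup>2 * \<bar>K\<bar> * (LINT y|cell. (norm (F y))\<^sup>2)"
proof -
  have "(LINT y|cell. Re (cdot (cmatvec (A y) (F y)) (F y))) \<le> (LINT y|cell. (real CARD('n))\<^sup>2 * \<bar>K\<bar> * (norm (F y))\<^sup>2)"
  proof (rule integral_mono_AE)
    show "AE y in cell. Re (cdot (cmatvec (A y) (F y)) (F y)) \<le> (real CARD('n))\<^sup>2 * \<bar>K\<bar> * (norm (F y))\<^sup>2"
      using A_bdd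
    proof eventually_elim
      case (elim y)
      have "(real CARD('n))\<^sup>2 * norm (A y) * norm (F y) * norm (F y) \<le> (real CARD('n))\<^sup>2 * \<bar>K\<bar> * norm (F y) * norm (F y)"
        using elim by (intro mult_right_mono mult_left_mono) auto
      then have "Re (cdot (cmatvec (A y) (F y)) (F y)) \<le> (real CARD('n))\<^sup>2 * \<bar>K\<bar> * norm (F y) * norm (F y)"
        using norm_cdot_cmatvec[of "A y" "F y" "F y"] complex_Re_le_cmod[of "cdot (cmatvec (A y) (F y)) (F y)"]
        by linarith
      then show ?case by (simp add: power2_eq_square mult.assoc)
    qed
  qed (use assms integrable_Re[OF aform_integrable[OF assms assms]] in \<open>simp_all add: L2_def\<close>)
  then show ?thesis using assms by (simp add: qf_aform)
qed

lemma hform_aform: "hform vscale {F. L2 F} aform"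
proof -
  interpret vector_space "vscale :: complex \<Rightarrow> (real^'n \<Rightarrow> complex^'n) \<Rightarrow> _" by (rule vector_space_vscale)
  show ?thesis
  proof
    show "subspace {F :: real^'n \<Rightarrow> complex^'n. L2 F}"
      by (auto simp: subspace_def vscale_def zero_fun_def plus_fun_def L2_const L2_add L2_vscale)
  next
    fix u v w :: "real^'n \<Rightarrow> complex^'n" assume "u \<in> {F. L2 F}" "v \<in> {F. L2 F}" "w \<in> {F. L2 F}"
    then show "aform (u + v) w = aform u w + aform v w"
      by (simp add: aform_def cmatvec_add cdot_add_left aform_integrable)
  next
    fix u w :: "real^'n \<Rightarrow> complex^'n" and c
    show "aform (vscale c u) w = c * aform u w"
      by (simp add: aform_def vscale_def cmatvec_scale cdot_scale_left)
  next
    fix u v :: "real^'n \<Rightarrow> complex^'n" assume uv: "u \<in> {F. L2 F}" "v \<in> {F. L2 F}"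
    have "cnj (aform u v) = (LINT y|cell. cnj (cdot (cmatvec (A y) (u y)) (v y)))"
      by (simp only: aform_def Bochner_Integration.integral_cnj)
    also have "\<dots> = aform v u" unfolding aform_def
    proof (rule integral_cong_AE)
      show "AE y in cell. cnj (cdot (cmatvec (A y) (u y)) (v y)) = cdot (cmatvec (A y) (v y)) (u y)"
        using A_sym by eventually_elim (simp add: cdot_cmatvec_herm[of _ "v _" "u _"])
    qed (use uv in \<open>auto intro!: borel_measurable_integrable integrable_cnj aform_integrable\<close>)
    finally show "aform v u = cnj (aform u v)" ..
  next
    fix u :: "real^'n \<Rightarrow> complex^'n" assume "u \<in> {F. L2 F}"
    moreover have "0 \<le> \<alpha> * (LINT y|cell. (norm (u y))\<^sup>2)"
      using alpha by (intro mult_nonneg_nonneg Bochner_Integration.integral_nonneg) auto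
    ultimately show "0 \<le> qf aform u" using aform_lower[of u] by simp
  qed
qed

lemma rform_integrable:
  assumes f: "L2 f" "L2 g"
  shows "integrable cell (\<lambda>y. complex_of_real (rho y) * f y * cnj (g y))"
proof -
  have "L2 (\<lambda>y. complex_of_real (rho y) * f y)"
  proof (rule L2_bound[OF f(1), where C=R])
    have [measurable]: "f \<in> borel_measurable cell" "rho \<in> borel_measurable cell"
      using f rho_meas by (auto intro: L2_measurable)
    show "(\<lambda>y. complex_of_real (rho y) * f y) \<in> borel_measurable cell" by measurable
    show "AE y in cell. cmod (complex_of_real (rho y) * f y) \<le> R * norm (f y)"
      using rho_bdd by eventually_elim (auto simp: norm_mult intro: mult_right_mono)
  qed
  from L2_mult_integrable[OF this f(2)] show ?thesis by simp
qed

lemma rho_cmod_integrable: "L2 f \<Longrightarrow> integrable cell (\<lambda>y. rho y * (cmod (f y))\<^sup>2)"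
proof -
  assume f: "L2 f"
  have "Re (complex_of_real (rho y) * f y * cnj (f y)) = rho y * (cmod (f y))\<^sup>2" for y
    by (simp add: mult.assoc flip: complex_norm_square of_real_mult)
  then show ?thesis using integrable_Re[OF rform_integrable[OF f f]] by simp
qed

lemma qf_rform: "qf rform f = (LINT y|cell. rho y * (cmod (f y))\<^sup>2)"
proof -
  have "rform f f = (LINT y|cell. complex_of_real (rho y * (cmod (f y))\<^sup>2))"
    by (simp only: rform_def of_real_mult complex_norm_square mult.assoc)
  then show ?thesis by (simp only: qf_def integral_complex_of_real Re_complex_of_real)
qed

lemma rform_lower:
  assumes "L2 f"
  shows "\<rho>\<^sub>0 * (LINT y|cell. (cmod (f y))\<^sup>2) \<le> qf rform f"
proof -
  have "(LINT y|cell. \<rho>\<^sub>0 * (cmod (f y))\<^sup>2) \<le> (LINT y|cell. rho y * (cmod (f y))\<^sup>2)"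
  proof (rule integral_mono_AE)
    show "AE y in cell. \<rho>\<^sub>0 * (cmod (f y))\<^sup>2 \<le> rho y * (cmod (f y))\<^sup>2"
      using rho_min by eventually_elim (auto intro: mult_right_mono)
  qed (use assms rho_cmod_integrable[OF assms] in \<open>simp_all add: L2_def\<close>)
  then show ?thesis by (simp add: qf_rform)
qed

lemma rform_upper:
  assumes "L2 f"
  shows "qf rform f \<le> \<bar>R\<bar> * (LINT y|cell. (cmod (f y))\<^sup>2)"
proof -
  have "(LINT y|cell. rho y * (cmod (f y))\<^sup>2) \<le> (LINT y|cell. \<bar>R\<bar> * (cmod (f y))\<^sup>2)"
  proof (rule integral_mono_AE)
    show "AE y in cell. rho y * (cmod (f y))\<^sup>2 \<le> \<bar>R\<bar> * (cmod (f y))\<^sup>2"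
      using rho_bdd by eventually_elim (auto intro!: mult_right_mono)
  qed (use assms rho_cmod_integrable[OF assms] in \<open>simp_all add: L2_def\<close>)
  then show ?thesis by (simp add: qf_rform)
qed

lemma hform_rform: "hform fscale {f. L2 f} rform"
proof -
  interpret vector_space "fscale :: complex \<Rightarrow> (real^'n \<Rightarrow> complex) \<Rightarrow> _" by (rule vector_space_fscale)
  show ?thesis
  proof
    show "subspace {f::real^'n \<Rightarrow> complex. L2 f}" by (rule hform.sub[OF hform_l2])
  next
    fix u v w :: "real^'n \<Rightarrow> complex" assume "u \<in> {f. L2 f}" "v \<in> {f. L2 f}" "w \<in> {f. L2 f}"
    then show "rform (u + v) w = rform u w + rform v w"
      by (simp add: rform_def ring_distribs rform_integrable)
  next
    fix u w :: "real^'n \<Rightarrow> complex" and c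
    have "complex_of_real (rho y) * (c * u y) * cnj (w y) = c * (complex_of_real (rho y) * u y * cnj (w y))" for y
      by simp
    then show "rform (fscale c u) w = c * rform u w"
      by (simp only: rform_def fscale_def integral_mult_right_zero)
  next
    fix u v :: "real^'n \<Rightarrow> complex"
    have "cnj (rform u v) = (LINT y|cell. cnj (complex_of_real (rho y) * u y * cnj (v y)))"
      by (simp only: rform_def Bochner_Integration.integral_cnj)
    then show "rform v u = cnj (rform u v)" by (simp add: rform_def ac_simps)
  next
    fix u :: "real^'n \<Rightarrow> complex" assume "u \<in> {f. L2 f}"
    moreover have "0 \<le> \<rho>\<^sub>0 * (LINT y|cell. (cmod (u y))\<^sup>2)"
      using rho_pos by (intro mult_nonneg_nonneg Bochner_Integration.integral_nonneg) auto
    ultimately show "0 \<le> qf rform u" using rform_lower[of u] by simp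
  qed
qed

end

section \<open>Coercivity and compactness of the Bloch forms\<close>

context bloch
begin

text \<open>The parameter sits in the form and not in the space: \<open>H1\<close> and
  \<open>bloch_b\<close> are the same for all \<theta>, so eigenfunctions at one parameter are
  admissible at another.\<close>

abbreviation bloch_a :: "real^'n \<Rightarrow> (real^'n \<Rightarrow> complex \<times> (complex^'n)) \<Rightarrow> (real^'n \<Rightarrow> complex \<times> (complex^'n)) \<Rightarrow> complex" where
  "bloch_a \<theta> \<equiv> (\<lambda>u v. aform (bgrad \<theta> u) (bgrad \<theta> v))"

abbreviation bloch_b :: "(real^'n \<Rightarrow> complex \<times> (complex^'n)) \<Rightarrow> (real^'n \<Rightarrow> complex \<times> (complex^'n)) \<Rightarrow> complex" where
  "bloch_b \<equiv> (\<lambda>u v. rform (\<lambda>y. fst (u y)) (\<lambda>y. fst (v y)))"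

lemma qf_bloch: "qf (bloch_a \<theta>) u = qf aform (bgrad \<theta> u)" "qf bloch_b u = qf rform (\<lambda>y. fst (u y))"
  by (simp_all add: qf_def)

lemma hform_bloch_a: "hform pscale H1 (bloch_a \<theta>)"
proof (rule hform_pullback[OF hform_aform vector_space_pscale subspace_H1])
  show "bgrad \<theta> u \<in> {F. L2 F}" if "u \<in> H1" for u using L2_bgrad[OF H1_L2[OF that]] by simp
  show "bgrad \<theta> (u + v) = bgrad \<theta> u + bgrad \<theta> v" for u v
    by (simp add: bgrad_def fun_eq_iff vec_eq_iff algebra_simps)
  show "bgrad \<theta> (pscale c u) = vscale c (bgrad \<theta> u)" for c u
    by (simp add: bgrad_def pscale_def vscale_def fun_eq_iff vec_eq_iff algebra_simps)
qed

lemma hform_bloch_b: "hform pscale H1 bloch_b"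
proof (rule hform_pullback[OF hform_rform vector_space_pscale subspace_H1])
  show "(\<lambda>y. fst (u y)) \<in> {f. L2 f}" if "u \<in> H1" for u using L2_fst_snd[OF H1_L2[OF that]] by simp
qed (simp_all add: fun_eq_iff pscale_def fscale_def)

lemma integral_norm_H1:
  assumes "L2 (u :: real^'n \<Rightarrow> complex \<times> (complex^'n))"
  shows "(LINT y|cell. (norm (u y))\<^sup>2) = (LINT y|cell. (cmod (fst (u y)))\<^sup>2) + (LINT y|cell. (norm (snd (u y)))\<^sup>2)"
proof -
  have "(norm (u y))\<^sup>2 = (cmod (fst (u y)))\<^sup>2 + (norm (snd (u y)))\<^sup>2" for y
    by (simp add: norm_prod_def)
  then show ?thesis using L2_fst_snd[OF assms] by (simp add: L2_def)
qed

lemma integral_norm_add_le: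
  fixes F G :: "real^'n \<Rightarrow> 'b::euclidean_space"
  assumes "L2 F" "L2 G"
  shows "(LINT y|cell. (norm (F y + G y))\<^sup>2) \<le> 2 * (LINT y|cell. (norm (F y))\<^sup>2) + 2 * (LINT y|cell. (norm (G y))\<^sup>2)"
proof -
  have "(LINT y|cell. (norm (F y + G y))\<^sup>2) \<le> (LINT y|cell. 2 * (norm (F y))\<^sup>2 + 2 * (norm (G y))\<^sup>2)"
    by (rule integral_mono) (use assms L2_add[OF assms] norm_add_square_le in \<open>auto simp: L2_def\<close>)
  then show ?thesis using assms by (simp add: L2_def)
qed

lemma integral_norm_scale_vec: "(LINT y|cell. (norm (f y *s (v :: complex^'n)))\<^sup>2) = (norm v)\<^sup>2 * (LINT y|cell. (cmod (f y))\<^sup>2)"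
  by (simp only: norm_scale_vec power_mult_distrib integral_mult_left_zero) (rule mult.commute)

text \<open>The gradient is the twisted gradient minus the shift times the function. This costs a
  multiple of the mass, which is why \<open>bloch_b\<close> appears beside the energy;
  \<open>alpha\<close> and \<open>rho_min\<close>, here \<open>\<alpha>\<close> and
  \<open>\<rho>\<^sub>0\<close>, then convert L^2 norms into forms.\<close>

lemma H1_norm_le_forms:
  obtains C where "C > 0" "\<And>u. u \<in> H1 \<Longrightarrow> (LINT y|cell. (norm (u y))\<^sup>2) \<le> C * (qf (bloch_a \<theta>) u + qf bloch_b u)"
proof
  let ?T = "(norm (shift_vec \<theta> :: complex^'n))\<^sup>2"
  let ?C = "2 / \<alpha> + (2 * ?T + 1) / \<rho>\<^sub>0"
  show "?C > 0" using alpha rho_pos by (simp add: add_pos_nonneg)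
  fix u :: "real^'n \<Rightarrow> complex \<times> (complex^'n)" assume u: "u \<in> H1"
  note L = H1_L2[OF u] L2_fst_snd[OF H1_L2[OF u]] L2_bgrad[OF H1_L2[OF u], of \<theta>]
  have a0: "qf (bloch_a \<theta>) u \<ge> 0" and b0: "qf bloch_b u \<ge> 0"
    using hform.nonneg[OF hform_bloch_a u] hform.nonneg[OF hform_bloch_b u] by auto
  have snd_eq: "snd (u y) = bgrad \<theta> u y + fst (u y) *s (- shift_vec \<theta>)" for y
    by (simp add: bgrad_def vec_eq_iff)
  have "(LINT y|cell. (norm (snd (u y)))\<^sup>2)
      \<le> 2 * (LINT y|cell. (norm (bgrad \<theta> u y))\<^sup>2) + 2 * (LINT y|cell. (norm (fst (u y) *s (- shift_vec \<theta>)))\<^sup>2)"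
    unfolding snd_eq by (rule integral_norm_add_le[OF L(4) L2_scale_vec[OF L(2)]])
  then have s: "(LINT y|cell. (norm (snd (u y)))\<^sup>2) \<le> 2 * (LINT y|cell. (norm (bgrad \<theta> u y))\<^sup>2)
      + 2 * ?T * (LINT y|cell. (cmod (fst (u y)))\<^sup>2)"
    unfolding integral_norm_scale_vec by simp
  have a: "(LINT y|cell. (norm (bgrad \<theta> u y))\<^sup>2) \<le> qf (bloch_a \<theta>) u / \<alpha>"
    using aform_lower[OF L(4)] alpha by (simp add: field_simps qf_bloch)
  have b: "(LINT y|cell. (cmod (fst (u y)))\<^sup>2) \<le> qf bloch_b u / \<rho>\<^sub>0"
    using rform_lower[OF L(2)] rho_pos by (simp add: field_simps qf_bloch)
  have "(LINT y|cell. (norm (u y))\<^sup>2) \<le> 2 * (LINT y|cell. (norm (bgrad \<theta> u y))\<^sup>2)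
      + (2 * ?T + 1) * (LINT y|cell. (cmod (fst (u y)))\<^sup>2)"
    using s unfolding integral_norm_H1[OF L(1)] by (simp add: ring_distribs)
  also have "\<dots> \<le> 2 * (qf (bloch_a \<theta>) u / \<alpha>) + (2 * ?T + 1) * (qf bloch_b u / \<rho>\<^sub>0)"
    by (intro add_mono mult_left_mono a b) auto
  also have "\<dots> \<le> ?C * (qf (bloch_a \<theta>) u + qf bloch_b u)"
  proof -
    have "0 \<le> 2 / \<alpha> * qf bloch_b u" "0 \<le> (2 * ?T + 1) / \<rho>\<^sub>0 * qf (bloch_a \<theta>) u"
      using a0 b0 alpha rho_pos by (auto intro!: mult_nonneg_nonneg divide_nonneg_pos)
    then show ?thesis by (simp add: ring_distribs)
  qed
  finally show "(LINT y|cell. (norm (u y))\<^sup>2) \<le> ?C * (qf (bloch_a \<theta>) u + qf bloch_b u)" .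
qed

lemma forms_le_H1_norm:
  obtains C where "\<And>u. u \<in> H1 \<Longrightarrow> qf (bloch_a \<theta>) u + qf bloch_b u \<le> C * (LINT y|cell. (norm (u y))\<^sup>2)"
proof
  let ?T = "(norm (shift_vec \<theta> :: complex^'n))\<^sup>2" and ?N = "(real CARD('n))\<^sup>2 * \<bar>K\<bar>"
  let ?C = "?N * (2 + 2 * ?T) + \<bar>R\<bar>"
  fix u :: "real^'n \<Rightarrow> complex \<times> (complex^'n)" assume u: "u \<in> H1"
  note L = H1_L2[OF u] L2_fst_snd[OF H1_L2[OF u]] L2_bgrad[OF H1_L2[OF u], of \<theta>]
  have f: "(LINT y|cell. (cmod (fst (u y)))\<^sup>2) \<le> (LINT y|cell. (norm (u y))\<^sup>2)"
    by (rule integral_square_mono[OF L(2,1) norm_fst_snd_le(1)])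
  have s: "(LINT y|cell. (norm (snd (u y)))\<^sup>2) \<le> (LINT y|cell. (norm (u y))\<^sup>2)"
    by (rule integral_square_mono[OF L(3,1) norm_fst_snd_le(2)])
  have "(LINT y|cell. (norm (bgrad \<theta> u y))\<^sup>2)
      \<le> 2 * (LINT y|cell. (norm (snd (u y)))\<^sup>2) + 2 * (LINT y|cell. (norm (fst (u y) *s shift_vec \<theta>))\<^sup>2)"
    unfolding bgrad_def by (rule integral_norm_add_le[OF L(3) L2_scale_vec[OF L(2)]])
  also have "\<dots> \<le> 2 * (LINT y|cell. (norm (u y))\<^sup>2) + 2 * (?T * (LINT y|cell. (norm (u y))\<^sup>2))"
    unfolding integral_norm_scale_vec by (intro add_mono mult_left_mono s f) auto
  finally have "(LINT y|cell. (norm (bgrad \<theta> u y))\<^sup>2) \<le> (2 + 2 * ?T) * (LINT y|cell. (norm (u y))\<^sup>2)"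
    by (simp add: ring_distribs)
  then have "?N * (LINT y|cell. (norm (bgrad \<theta> u y))\<^sup>2) \<le> ?N * ((2 + 2 * ?T) * (LINT y|cell. (norm (u y))\<^sup>2))"
    by (intro mult_left_mono) auto
  moreover have "\<bar>R\<bar> * (LINT y|cell. (cmod (fst (u y)))\<^sup>2) \<le> \<bar>R\<bar> * (LINT y|cell. (norm (u y))\<^sup>2)"
    by (intro mult_left_mono f) auto
  ultimately show "qf (bloch_a \<theta>) u + qf bloch_b u \<le> ?C * (LINT y|cell. (norm (u y))\<^sup>2)"
    using aform_upper[OF L(4)] rform_upper[OF L(2)] unfolding qf_bloch distrib_right mult.assoc by linarith
qed

text \<open>Energy plus mass is equivalent to the squared H^1 norm by the two preceding estimates,
  so Rellich's theorem and the completeness of \<open>H1\<close> transfer to the forms.\<close>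

lemma hpair_bloch: "hpair pscale H1 (bloch_a \<theta>) bloch_b"
proof -
  interpret A: hform pscale H1 "bloch_a \<theta>" by (rule hform_bloch_a)
  interpret B: hform pscale H1 bloch_b by (rule hform_bloch_b)
  obtain C1 where C1: "C1 > 0"
    "\<And>u. u \<in> H1 \<Longrightarrow> (LINT y|cell. (norm (u y))\<^sup>2) \<le> C1 * (qf (bloch_a \<theta>) u + qf bloch_b u)"
    using H1_norm_le_forms[of \<theta>] by blast
  obtain C2 where C2:
    "\<And>u. u \<in> H1 \<Longrightarrow> qf (bloch_a \<theta>) u + qf bloch_b u \<le> C2 * (LINT y|cell. (norm (u y))\<^sup>2)"
    using forms_le_H1_norm[of \<theta>] by blast
  show ?thesis
  proof
    fix f :: "nat \<Rightarrow> real^'n \<Rightarrow> complex \<times> (complex^'n)" and C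
    assume f: "\<And>n. f n \<in> H1" and bd: "\<And>n. qf (bloch_a \<theta>) (f n) + qf bloch_b (f n) \<le> C"
    have "(LINT y|cell. (norm (f n y))\<^sup>2) \<le> C1 * C" for n
      using C1(2)[OF f[of n]] mult_left_mono[OF bd[of n], of C1] C1(1) by linarith
    then obtain r :: "nat \<Rightarrow> nat" where r: "strict_mono r"
      and c: "\<And>e. e > 0 \<Longrightarrow> \<exists>N. \<forall>m\<ge>N. \<forall>n\<ge>N. (LINT y|cell. (cmod (fst (f (r m) y) - fst (f (r n) y)))\<^sup>2) < e"
      by (rule rellich[of f, OF f]) blast
    have "qcauchy (qf bloch_b) (\<lambda>n. f (r n))" unfolding qcauchy_def
    proof (intro allI impI)
      fix e :: real assume "e > 0"
      then have "e / (\<bar>R\<bar> + 1) > 0" by (simp add: add_nonneg_pos)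
      then obtain N where N: "\<And>m n. N \<le> m \<Longrightarrow> N \<le> n \<Longrightarrow>
          (LINT y|cell. (cmod (fst (f (r m) y) - fst (f (r n) y)))\<^sup>2) < e / (\<bar>R\<bar> + 1)"
        using c by blast
      show "\<exists>N. \<forall>m\<ge>N. \<forall>n\<ge>N. qf bloch_b (f (r m) - f (r n)) < e"
      proof (intro exI[of _ N] allI impI)
        fix m n assume mn: "N \<le> m" "N \<le> n"
        let ?I = "LINT y|cell. (cmod (fst (f (r m) y) - fst (f (r n) y)))\<^sup>2"
        have "L2 (\<lambda>y. fst ((f (r m) - f (r n)) y))"
          by (intro L2_fst_snd H1_L2 A.inX f)
        from rform_upper[OF this] have "qf bloch_b (f (r m) - f (r n)) \<le> \<bar>R\<bar> * ?I"
          by (simp add: qf_bloch)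
        also have "\<dots> \<le> (\<bar>R\<bar> + 1) * ?I"
          by (intro mult_right_mono Bochner_Integration.integral_nonneg) auto
        also have "\<dots> < e" using N[OF mn] by (simp add: field_simps add_nonneg_pos)
        finally show "qf bloch_b (f (r m) - f (r n)) < e" .
      qed
    qed
    then show "\<exists>r::nat \<Rightarrow> nat. strict_mono r \<and> qcauchy (qf bloch_b) (\<lambda>n. f (r n))" using r by blast
  next
    fix f :: "nat \<Rightarrow> real^'n \<Rightarrow> complex \<times> (complex^'n)"
    assume f: "\<And>n. f n \<in> H1" and c: "qcauchy (\<lambda>u. qf (bloch_a \<theta>) u + qf bloch_b u) f"
    have "\<exists>N. \<forall>m\<ge>N. \<forall>n\<ge>N. (LINT x|cell. (norm (f m x - f n x))\<^sup>2) < e" if "e > 0" for e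
    proof -
      have "e / C1 > 0" using that C1 by simp
      then obtain N where N: "\<And>m n. N \<le> m \<Longrightarrow> N \<le> n \<Longrightarrow>
          qf (bloch_a \<theta>) (f m - f n) + qf bloch_b (f m - f n) < e / C1"
        using c unfolding qcauchy_def by blast
      have "(LINT x|cell. (norm (f m x - f n x))\<^sup>2) < e" if "N \<le> m" "N \<le> n" for m n
      proof -
        have "(LINT x|cell. (norm ((f m - f n) x))\<^sup>2) \<le> C1 * (qf (bloch_a \<theta>) (f m - f n) + qf bloch_b (f m - f n))"
          by (rule C1(2)) (intro A.inX f)
        also have "\<dots> < e" using N[OF that] C1(1) by (simp add: field_simps)
        finally show ?thesis by simp
      qed
      then show ?thesis by blast
    qed
    then obtain g where g: "g \<in> H1" and lim: "(\<lambda>n. LINT x|cell. (norm (f n x - g x))\<^sup>2) \<longlonglongrightarrow> 0"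
      by (rule H1_complete[of f, OF f]) blast
    have lim2: "(\<lambda>n. C2 * (LINT x|cell. (norm (f n x - g x))\<^sup>2)) \<longlonglongrightarrow> 0"
      using tendsto_mult_left[OF lim, of C2] by simp
    have "(\<lambda>n. qf (bloch_a \<theta>) (f n - g) + qf bloch_b (f n - g)) \<longlonglongrightarrow> 0"
    proof (rule Lim_null_comparison[OF _ lim2], intro always_eventually allI)
      fix n
      have d: "f n - g \<in> H1" by (intro A.inX f g)
      then show "norm (qf (bloch_a \<theta>) (f n - g) + qf bloch_b (f n - g)) \<le> C2 * (LINT x|cell. (norm (f n x - g x))\<^sup>2)"
        using C2[OF d] A.nonneg[OF d] B.nonneg[OF d] by simp
    qed
    then show "\<exists>g\<in>H1. (\<lambda>n. qf (bloch_a \<theta>) (f n - g) + qf bloch_b (f n - g)) \<longlonglongrightarrow> 0"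
      using g by blast
  qed
qed

section \<open>Lipschitz dependence of the eigenvalues on \<theta>\<close>

text \<open>The shift vector is i times the real vector 2 \<pi> \<xi>, so the integrand is 4 \<pi>^2
  |f|^2 times \<open>A \<xi> \<bullet> \<xi>\<close>. This is where the maximal speed and the factor
  2 \<pi> enter.\<close>

lemma qf_aform_constant_vec:
  assumes speed: "AE y in cell. \<forall>\<xi>. (A y *v \<xi>) \<bullet> \<xi> \<le> c\<^sup>2 * rho y * (norm \<xi>)\<^sup>2" and f: "L2 f"
  shows "qf aform (\<lambda>y. f y *s shift_vec \<xi>) \<le> (2 * pi * c * norm \<xi>)\<^sup>2 * qf rform f"
proof -
  have L: "L2 (\<lambda>y. f y *s shift_vec \<xi>)" by (rule L2_scale_vec[OF f])
  have pt: "Re (cdot (cmatvec M (z *s shift_vec \<xi>)) (z *s shift_vec \<xi>)) = (cmod z)\<^sup>2 * (4 * pi\<^sup>2 * ((M *v \<xi>) \<bullet> \<xi>))" for M z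
  proof -
    have "(\<chi> i. Re (shift_vec \<xi> $ i)) = 0" "(\<chi> i. Im (shift_vec \<xi> $ i)) = (2 * pi) *\<^sub>R \<xi>"
      by (simp_all add: shift_vec_def vec_eq_iff)
    then have "Re (cdot (cmatvec M (shift_vec \<xi>)) (shift_vec \<xi>)) = 4 * pi\<^sup>2 * ((M *v \<xi>) \<bullet> \<xi>)"
      unfolding Re_cdot_cmatvec by (simp add: matrix_vector_mult_scaleR power2_eq_square)
    moreover have "cdot (cmatvec M (z *s shift_vec \<xi>)) (z *s shift_vec \<xi>) = of_real ((cmod z)\<^sup>2) * cdot (cmatvec M (shift_vec \<xi>)) (shift_vec \<xi>)"
      by (simp only: cmatvec_scale cdot_scale_left cdot_scale_right complex_norm_square ac_simps)
    ultimately show ?thesis by simp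
  qed
  have "(LINT y|cell. Re (cdot (cmatvec (A y) (f y *s shift_vec \<xi>)) (f y *s shift_vec \<xi>)))
      \<le> (LINT y|cell. (2 * pi * c * norm \<xi>)\<^sup>2 * (rho y * (cmod (f y))\<^sup>2))"
  proof (rule integral_mono_AE)
    show "AE y in cell. Re (cdot (cmatvec (A y) (f y *s shift_vec \<xi>)) (f y *s shift_vec \<xi>))
        \<le> (2 * pi * c * norm \<xi>)\<^sup>2 * (rho y * (cmod (f y))\<^sup>2)"
      using speed
    proof eventually_elim
      case (elim y)
      have "(cmod (f y))\<^sup>2 * (4 * pi\<^sup>2 * ((A y *v \<xi>) \<bullet> \<xi>)) \<le> (cmod (f y))\<^sup>2 * (4 * pi\<^sup>2 * (c\<^sup>2 * rho y * (norm \<xi>)\<^sup>2))"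
        using elim by (intro mult_left_mono) auto
      then show ?case unfolding pt by (simp add: power_mult_distrib ac_simps)
    qed
  qed (use integrable_Re[OF aform_integrable[OF L L]] rho_cmod_integrable[OF f] in simp_all)
  then show ?thesis by (simp add: qf_aform[OF L] qf_rform)
qed

text \<open>Minkowski's inequality, as \<open>bgrad\<close> depends affinely on \<open>\<theta>\<close>.\<close>
lemma sqrt_bloch_a_lipschitz:
  assumes speed: "AE y in cell. \<forall>\<xi>. (A y *v \<xi>) \<bullet> \<xi> \<le> c\<^sup>2 * rho y * (norm \<xi>)\<^sup>2" and c: "c \<ge> 0"
    and u: "u \<in> H1"
  shows "sqrt (qf (bloch_a \<theta>) u) \<le> sqrt (qf (bloch_a \<theta>') u) + 2 * pi * c * norm (\<theta> - \<theta>') * sqrt (qf bloch_b u)"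
proof -
  interpret hform vscale "{F. L2 F}" aform by (rule hform_aform)
  note L = H1_L2[OF u] L2_fst_snd[OF H1_L2[OF u]]
  have eq: "bgrad \<theta> u = bgrad \<theta>' u + (\<lambda>y. fst (u y) *s shift_vec (\<theta> - \<theta>'))"
    by (simp add: bgrad_def fun_eq_iff vec_eq_iff shift_vec_def algebra_simps)
  have "sqrt (qf aform (bgrad \<theta> u)) \<le> sqrt (qf aform (bgrad \<theta>' u)) + sqrt (qf aform (\<lambda>y. fst (u y) *s shift_vec (\<theta> - \<theta>')))"
    unfolding eq by (rule triangle) (simp_all add: L2_bgrad L L2_scale_vec)
  also have "sqrt (qf aform (\<lambda>y. fst (u y) *s shift_vec (\<theta> - \<theta>'))) \<le> sqrt ((2 * pi * c * norm (\<theta> - \<theta>'))\<^sup>2 * qf bloch_b u)"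
    unfolding qf_bloch by (rule real_sqrt_le_mono[OF qf_aform_constant_vec[OF speed L(2)]])
  also have "\<dots> = 2 * pi * c * norm (\<theta> - \<theta>') * sqrt (qf bloch_b u)"
    using c by (simp add: real_sqrt_mult)
  finally show ?thesis by (simp add: qf_bloch)
qed

text \<open>Members of this set, rather than its infimum, are carried from one parameter to another:
  attainment plays no part, and emptiness is carried along too.\<close>

definition ev_bounds :: "real^'n \<Rightarrow> nat \<Rightarrow> real set" where
  "ev_bounds \<theta> n = {lam. \<exists>psi mu. (\<forall>i<n. bloch_eig A rho \<theta> (mu i) (psi i) \<and> mu i \<le> lam) \<and> ae_indep n psi}"

lemma bloch_ev_Inf: "bloch_ev A rho \<theta> n = Inf (ev_bounds \<theta> n)"
  by (simp add: bloch_ev_def ev_bounds_def)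

lemma bloch_eigD:
  assumes "bloch_eig A rho \<theta> lam psi"
  obtains v where "v \<in> H1" "\<And>y. fst (v y) = psi y" "\<And>w. w \<in> H1 \<Longrightarrow> bloch_a \<theta> v w = of_real lam * bloch_b v w"
proof -
  obtain G where G: "H1_grad psi G" and eig: "\<And>phi Gphi. H1_grad phi Gphi \<Longrightarrow>
      (LINT y|cell. cdot (cmatvec (A y) (tgrad \<theta> psi G y)) (tgrad \<theta> phi Gphi y))
      = complex_of_real lam * (LINT y|cell. complex_of_real (rho y) * psi y * cnj (phi y))"
    using assms unfolding bloch_eig_def by blast
  show thesis
  proof (rule that[of "\<lambda>y. (psi y, G y)"])
    fix w :: "real^'n \<Rightarrow> complex \<times> (complex^'n)" assume "w \<in> H1"
    then show "bloch_a \<theta> (\<lambda>y. (psi y, G y)) w = of_real lam * bloch_b (\<lambda>y. (psi y, G y)) w"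
      using eig[of "\<lambda>y. fst (w y)" "\<lambda>y. snd (w y)"] by (simp add: H1_def aform_def rform_def tgrad_bgrad)
  qed (use G in \<open>simp_all add: H1_def\<close>)
qed

text \<open>As the density is bounded below, length 0 for the mass means vanishing almost
  everywhere; this translates between \<open>ae_indep\<close> and independence in the abstract
  forms.\<close>

lemma rform_eq_0_iff:
  assumes "L2 f"
  shows "qf rform f = 0 \<longleftrightarrow> (AE y in cell. f y = 0)"
proof -
  have "qf rform f = 0 \<longleftrightarrow> (AE y in cell. rho y * (cmod (f y))\<^sup>2 = 0)"
    unfolding qf_rform
  proof (rule integral_nonneg_eq_0_iff_AE[OF rho_cmod_integrable[OF assms]])
    show "AE y in cell. 0 \<le> rho y * (cmod (f y))\<^sup>2"
      using rho_min by eventually_elim (use rho_pos in auto)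
  qed
  also have "\<dots> \<longleftrightarrow> (AE y in cell. f y = 0)"
  proof
    assume "AE y in cell. rho y * (cmod (f y))\<^sup>2 = 0"
    then show "AE y in cell. f y = 0"
      using rho_min by eventually_elim (use rho_pos in auto)
  next
    assume "AE y in cell. f y = 0"
    then show "AE y in cell. rho y * (cmod (f y))\<^sup>2 = 0" by eventually_elim simp
  qed
  finally show ?thesis .
qed

lemma sum_pscale_apply: "(\<Sum>i<(n::nat). pscale (c i) (v i)) y = (\<Sum>i<n. (c i * fst (v i y), c i *s snd (v i y)))"
  by (induction n) (simp_all add: pscale_def zero_prod_def)

lemma fst_sum_pscale: "fst ((\<Sum>i<(n::nat). pscale (c i) (v i)) y) = (\<Sum>i<n. c i * fst (v i y))"
  unfolding sum_pscale_apply by (simp add: fst_sum)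

lemma ev_bounds_nonneg:
  assumes "n \<ge> 1" "lam \<in> ev_bounds \<theta> n"
  shows "lam \<ge> 0"
proof -
  \<comment> \<open>\<open>n \<ge> 1\<close> provides an eigenfunction; for \<open>n = 0\<close>
    every real number would be a bound.\<close>
  obtain psi mu where eig: "bloch_eig A rho \<theta> mu psi" and le: "mu \<le> lam"
    using assms by (fastforce simp: ev_bounds_def)
  obtain v where v: "v \<in> H1" "\<And>y. fst (v y) = psi y" "\<And>w. w \<in> H1 \<Longrightarrow> bloch_a \<theta> v w = of_real mu * bloch_b v w"
    using bloch_eigD[OF eig] by blast
  have "L2 psi" using L2_fst_snd(1)[OF H1_L2[OF v(1)]] by (simp add: v(2))
  moreover have "\<not> (AE y in cell. psi y = 0)" using eig unfolding bloch_eig_def by blast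
  ultimately have "qf bloch_b v \<noteq> 0" using rform_eq_0_iff[of psi] by (simp add: qf_bloch v(2))
  then have b: "qf bloch_b v > 0" using hform.nonneg[OF hform_bloch_b v(1)] by simp
  have "qf (bloch_a \<theta>) v = mu * qf bloch_b v" using v(3)[OF v(1)] by (simp add: qf_def)
  then have "0 \<le> mu * qf bloch_b v" using hform.nonneg[OF hform_bloch_a v(1)] by metis
  then show ?thesis using b le by (simp add: zero_le_mult_iff)
qed

text \<open>The span of the eigenfunctions at \<open>\<theta>'\<close> is a trial space for the min-max principle at \<open>\<theta>\<close>.\<close>
lemma ev_bounds_transfer:
  assumes speed: "AE y in cell. \<forall>\<xi>. (A y *v \<xi>) \<bullet> \<xi> \<le> c\<^sup>2 * rho y * (norm \<xi>)\<^sup>2" and c: "c \<ge> 0"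
    and n: "n \<ge> 1" and lam: "lam \<in> ev_bounds \<theta>' n"
  shows "(sqrt lam + 2 * pi * c * norm (\<theta> - \<theta>'))\<^sup>2 \<in> ev_bounds \<theta> n"
proof -
  interpret B: hform pscale H1 bloch_b by (rule hform_bloch_b)
  interpret P': hpair pscale H1 "bloch_a \<theta>'" bloch_b by (rule hpair_bloch)
  interpret P: hpair pscale H1 "bloch_a \<theta>" bloch_b by (rule hpair_bloch)
  define d where "d = 2 * pi * c * norm (\<theta> - \<theta>')"
  have d0: "d \<ge> 0" using c by (simp add: d_def)
  have lam0: "lam \<ge> 0" by (rule ev_bounds_nonneg[OF n lam])
  obtain psi mu where eig: "\<And>i. i < n \<Longrightarrow> bloch_eig A rho \<theta>' (mu i) (psi i)" "\<And>i. i < n \<Longrightarrow> mu i \<le> lam"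
    and indep: "ae_indep n psi" using lam by (auto simp: ev_bounds_def)
  have "\<exists>v. v \<in> H1 \<and> (\<forall>y. fst (v y) = psi i y) \<and> (\<forall>w\<in>H1. bloch_a \<theta>' v w = of_real (mu i) * bloch_b v w)"
    if "i < n" for i
    using bloch_eigD[OF eig(1)[OF that]] by metis
  then obtain v where v: "\<And>i. i < n \<Longrightarrow> v i \<in> H1" "\<And>i y. i < n \<Longrightarrow> fst (v i y) = psi i y"
    "\<And>i w. i < n \<Longrightarrow> w \<in> H1 \<Longrightarrow> bloch_a \<theta>' (v i) w = of_real (mu i) * bloch_b (v i) w"
    by metis
  let ?V = "\<lambda>k. \<Sum>i<n. pscale (k i) (v i)"
  have VX: "?V k \<in> H1" for k by (intro P.inX v) auto
  \<comment> \<open>At \<open>\<theta>'\<close> the span of eigenfunctions has Rayleigh quotient at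
    most \<open>lam\<close>; the change of parameter adds \<open>d\<close> to its square
    root.\<close>
  have span: "qf (bloch_a \<theta>) (?V k) \<le> (sqrt lam + d)\<^sup>2 * qf bloch_b (?V k)" for k
  proof -
    have b0: "qf bloch_b (?V k) \<ge> 0" by (rule B.nonneg[OF VX])
    have "qf (bloch_a \<theta>') (?V k) \<le> lam * qf bloch_b (?V k)"
      by (rule P'.eigen_span_le[OF v(1) eig(2) v(3)])
    then have "sqrt (qf (bloch_a \<theta>') (?V k)) \<le> sqrt lam * sqrt (qf bloch_b (?V k))"
      by (simp flip: real_sqrt_mult)
    then have "sqrt (qf (bloch_a \<theta>) (?V k)) \<le> (sqrt lam + d) * sqrt (qf bloch_b (?V k))"
      using sqrt_bloch_a_lipschitz[OF speed c VX, of \<theta> k \<theta>'] by (simp add: d_def ring_distribs)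
    then have "(sqrt (qf (bloch_a \<theta>) (?V k)))\<^sup>2 \<le> ((sqrt lam + d) * sqrt (qf bloch_b (?V k)))\<^sup>2"
      by (rule power_mono) (simp add: P.A.nonneg[OF VX])
    then show ?thesis using b0 P.A.nonneg[OF VX] by (simp add: power_mult_distrib)
  qed
  have ind: "\<forall>i<n. k i = 0" if "qf bloch_b (?V k) = 0" for k
  proof -
    have "AE y in cell. fst (?V k y) = 0"
      using that rform_eq_0_iff[OF L2_fst_snd(1)[OF H1_L2[OF VX]]] unfolding qf_bloch by blast
    then have "AE y in cell. (\<Sum>i<n. k i * psi i y) = 0"
      by eventually_elim (simp add: fst_sum_pscale v(2))
    then show ?thesis using indep unfolding ae_indep_def by blast
  qed
  obtain e \<mu> where e: "\<And>i. i < n \<Longrightarrow> e i \<in> H1" "\<And>i. i < n \<Longrightarrow> \<mu> i \<le> (sqrt lam + d)\<^sup>2"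
      "\<And>i w. i < n \<Longrightarrow> w \<in> H1 \<Longrightarrow> bloch_a \<theta> (e i) w = of_real (\<mu> i) * bloch_b (e i) w"
    and on: "\<And>i j. i < n \<Longrightarrow> j < n \<Longrightarrow> bloch_b (e i) (e j) = (if i = j then 1 else 0)"
    using P.eigenvectors[OF v(1) span ind] by blast
  have eL: "L2 (\<lambda>y. fst (e i y))" if "i < n" for i by (rule L2_fst_snd[OF H1_L2[OF e(1)[OF that]]])
  have "bloch_eig A rho \<theta> (\<mu> i) (\<lambda>y. fst (e i y))" if i: "i < n" for i
    unfolding bloch_eig_def
  proof (intro exI[of _ "\<lambda>y. snd (e i y)"] conjI allI impI)
    show "H1_grad (\<lambda>y. fst (e i y)) (\<lambda>y. snd (e i y))" using e(1)[OF i] by (simp add: H1_def)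
    have "qf rform (\<lambda>y. fst (e i y)) = 1" using on[OF i i] by (simp add: qf_def)
    then show "\<not> (AE y in cell. fst (e i y) = 0)" using rform_eq_0_iff[OF eL[OF i]] by simp
    fix phi Gphi assume "H1_grad phi (Gphi :: real^'n \<Rightarrow> complex^'n)"
    then have "(\<lambda>y. (phi y, Gphi y)) \<in> H1" by (simp add: H1_def)
    from e(3)[OF i this]
    show "(LINT y|cell. cdot (cmatvec (A y) (tgrad \<theta> (\<lambda>y. fst (e i y)) (\<lambda>y. snd (e i y)) y)) (tgrad \<theta> phi Gphi y))
      = complex_of_real (\<mu> i) * (LINT y|cell. complex_of_real (rho y) * fst (e i y) * cnj (phi y))"
      by (simp add: aform_def rform_def tgrad_bgrad)
  qed
  moreover have "ae_indep n (\<lambda>i y. fst (e i y))"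
    unfolding ae_indep_def
  proof (intro allI impI)
    fix k j assume 0: "AE y in cell. (\<Sum>i<n. k i * fst (e i y)) = 0" and j: "j < n"
    let ?E = "\<Sum>i<n. pscale (k i) (e i)"
    have EX: "?E \<in> H1" by (intro P.inX e) auto
    have "AE y in cell. fst (?E y) = 0" using 0 by eventually_elim (simp add: fst_sum_pscale)
    then have "qf bloch_b ?E = 0"
      unfolding qf_bloch using rform_eq_0_iff[OF L2_fst_snd(1)[OF H1_L2[OF EX]]] by blast
    \<comment> \<open>A combination that vanishes almost everywhere has length 0, hence is
      orthogonal to \<open>e j\<close>, and by orthonormality this product is its j-th
      coefficient.\<close>
    then have "bloch_b ?E (e j) = 0" using B.Cauchy_Schwarz[OF EX e(1)[OF j]] by simp
    moreover have "bloch_b ?E (e j) = (\<Sum>i<n. k i * bloch_b (e i) (e j))"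
      using e(1) j by (subst B.sum_left) (auto simp: P.inX B.scale_left)
    moreover have "\<dots> = (\<Sum>i<n. if i = j then k j else 0)"
      by (intro sum.cong refl) (use on j in auto)
    ultimately show "k j = 0" using j by simp
  qed
  ultimately show ?thesis
    unfolding ev_bounds_def d_def[symmetric] using e(2) by (auto intro!: exI[of _ "\<lambda>i y. fst (e i y)"] exI[of _ \<mu>])
qed

text \<open>Every bound at \<open>\<theta>'\<close> limits the eigenvalue at
  \<open>\<theta>\<close>, and the infimum over these bounds is taken last. Nonemptiness ensures
  that this infimum is a meaningful value.\<close>

lemma bloch_ev_lipschitz:
  assumes speed: "AE y in cell. \<forall>\<xi>. (A y *v \<xi>) \<bullet> \<xi> \<le> c\<^sup>2 * rho y * (norm \<xi>)\<^sup>2" and c: "c \<ge> 0"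
    and n: "n \<ge> 1" and ne: "ev_bounds \<theta>' n \<noteq> {}"
  shows "sqrt (bloch_ev A rho \<theta> n) \<le> sqrt (bloch_ev A rho \<theta>' n) + 2 * pi * c * norm (\<theta> - \<theta>')"
proof -
  define d where "d = 2 * pi * c * norm (\<theta> - \<theta>')"
  have d0: "d \<ge> 0" using c by (simp add: d_def)
  have bdd: "bdd_below (ev_bounds \<theta> n)" for \<theta> by (rule bdd_belowI[of _ 0]) (rule ev_bounds_nonneg[OF n])
  have le: "sqrt (bloch_ev A rho \<theta> n) - d \<le> sqrt lam" if lam: "lam \<in> ev_bounds \<theta>' n" for lam
  proof -
    have "bloch_ev A rho \<theta> n \<le> (sqrt lam + d)\<^sup>2"
      unfolding bloch_ev_Inf d_def by (rule cInf_lower[OF ev_bounds_transfer[OF speed c n lam] bdd])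
    then have "sqrt (bloch_ev A rho \<theta> n) \<le> sqrt lam + d"
      using d0 ev_bounds_nonneg[OF n lam] by (intro real_le_lsqrt) auto
    then show ?thesis by simp
  qed
  have "sqrt (bloch_ev A rho \<theta> n) - d \<le> sqrt (bloch_ev A rho \<theta>' n)"
  \<comment> \<open>Squaring, which brings the infimum out of the root, needs a nonnegative
    left-hand side; a negative one is below any square root of a nonnegative number.\<close>
  proof (cases "sqrt (bloch_ev A rho \<theta> n) - d \<ge> 0")
    case True
    have "(sqrt (bloch_ev A rho \<theta> n) - d)\<^sup>2 \<le> bloch_ev A rho \<theta>' n"
      unfolding bloch_ev_Inf[of \<theta>']
    proof (rule cInf_greatest[OF ne])
      fix lam assume lam: "lam \<in> ev_bounds \<theta>' n"
      have "(sqrt (bloch_ev A rho \<theta> n) - d)\<^sup>2 \<le> (sqrt lam)\<^sup>2" by (rule power_mono[OF le[OF lam] True])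
      then show "(sqrt (bloch_ev A rho \<theta> n) - d)\<^sup>2 \<le> lam" using ev_bounds_nonneg[OF n lam] by simp
    qed
    then show ?thesis by (rule real_le_rsqrt)
  next
    case False
    have "0 \<le> bloch_ev A rho \<theta>' n"
      unfolding bloch_ev_Inf by (rule cInf_greatest[OF ne]) (rule ev_bounds_nonneg[OF n])
    then show ?thesis using False by (meson le_cases order_trans real_sqrt_ge_zero)
  qed
  then show ?thesis by (simp add: d_def)
qed

end

section \<open>From the Lipschitz bound to the gradient\<close>

text \<open>Along \<open>g\<close> the derivative of \<open>sqrt F\<close> is
  \<open>|g|^2 / (2 sqrt (F x))\<close>, and the Lipschitz bound limits it by \<open>L |g|\<close>.
  Positivity of \<open>F x\<close> keeps the square root differentiable.\<close>

lemma derivative_le_of_lipschitz: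
  fixes F :: "real^'n \<Rightarrow> real"
  assumes F: "(F has_derivative (\<lambda>h. g \<bullet> h)) (at x)" and pos: "F x > 0" and L: "L \<ge> 0"
    and lip: "\<And>y. sqrt (F y) \<le> sqrt (F x) + L * norm (y - x)"
  shows "norm g \<le> 2 * sqrt (F x) * L"
proof (cases "g = 0")
  case True
  then show ?thesis using pos L by simp
next
  case False
  have "((\<lambda>t::real. F (x + t *\<^sub>R g)) has_derivative (\<lambda>t. g \<bullet> (t *\<^sub>R g))) (at 0)"
  proof (rule has_derivative_compose[where f="\<lambda>t. x + t *\<^sub>R g" and f'="\<lambda>t. t *\<^sub>R g" and g=F])
    show "((\<lambda>t. x + t *\<^sub>R g) has_derivative (\<lambda>t. t *\<^sub>R g)) (at 0)"
      by (auto intro!: derivative_eq_intros)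
  qed (use F in simp)
  then have "((\<lambda>t::real. F (x + t *\<^sub>R g)) has_field_derivative (g \<bullet> g)) (at 0)"
    unfolding has_field_derivative_def by (simp add: mult.commute[of _ "g \<bullet> g"])
  then have "((\<lambda>t. sqrt (F (x + t *\<^sub>R g))) has_field_derivative (inverse (sqrt (F x)) / 2 * (g \<bullet> g))) (at 0)"
    by (intro DERIV_chain2[where f=sqrt]) (use DERIV_real_sqrt[OF pos] in simp_all)
  then have "((\<lambda>h. (sqrt (F (x + h *\<^sub>R g)) - sqrt (F x)) / h) \<longlongrightarrow> inverse (sqrt (F x)) / 2 * (g \<bullet> g)) (at 0)"
    by (simp add: DERIV_def)
  then have "((\<lambda>h. (sqrt (F (x + h *\<^sub>R g)) - sqrt (F x)) / h) \<longlongrightarrow> inverse (sqrt (F x)) / 2 * (g \<bullet> g)) (at_right 0)"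
    \<comment> \<open>Only the limit from the right is kept, since dividing the bound by
      \<open>h\<close> preserves its direction for positive \<open>h\<close>.\<close>
    by (rule filterlim_mono[OF _ order_refl at_le]) simp
  then have "inverse (sqrt (F x)) / 2 * (g \<bullet> g) \<le> L * norm g"
  proof (rule tendsto_upperbound)
    show "eventually (\<lambda>h. (sqrt (F (x + h *\<^sub>R g)) - sqrt (F x)) / h \<le> L * norm g) (at_right 0)"
      using eventually_at_right_less[of "0::real"]
    proof eventually_elim
      case (elim h)
      have "sqrt (F (x + h *\<^sub>R g)) - sqrt (F x) \<le> L * norm g * h"
        using lip[of "x + h *\<^sub>R g"] elim by (simp add: ac_simps)
      then show ?case using elim by (simp add: divide_le_eq)
    qed
  qed simp
  then have "norm g * norm g \<le> norm g * (2 * sqrt (F x) * L)"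
    using pos by (simp add: dot_square_norm power2_eq_square field_simps)
  then show ?thesis using False by simp
qed

lemma speed_bound_AE:
  fixes A :: "real^'n \<Rightarrow> real^'n^'n"
  assumes sym: "AE y in cell. transpose (A y) = A y" and al: "\<alpha> > 0"
    and coer: "AE y in cell. \<forall>\<xi>. (A y *v \<xi>) \<bullet> \<xi> \<ge> \<alpha> * (norm \<xi>)\<^sup>2"
    and r0: "\<rho>\<^sub>0 > 0" and rho: "AE y in cell. rho y \<ge> \<rho>\<^sub>0" and fin: "c_max A rho \<noteq> \<infinity>"
  obtains c where "c_max A rho = ereal c" "c \<ge> 0"
    "AE y in cell. \<forall>\<xi>. (A y *v \<xi>) \<bullet> \<xi> \<le> c\<^sup>2 * rho y * (norm \<xi>)\<^sup>2"
proof -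
  have le: "AE y in cell. ereal (local_speed A rho y) \<le> c_max A rho"
    unfolding c_max_def by (rule esssup_AE)
  have loc: "AE y in cell. 0 \<le> local_speed A rho y \<and>
      (\<forall>\<xi>. (A y *v \<xi>) \<bullet> \<xi> \<le> (local_speed A rho y)\<^sup>2 * rho y * (norm \<xi>)\<^sup>2)"
    using sym coer rho
  proof eventually_elim
    case (elim y)
    have "rho y > 0" using elim r0 by simp
    then show ?case
      using rayleigh_le_max_root[OF elim(1) _ al elim(2)[rule_format], of "rho y"]
      unfolding local_speed_def by blast
  qed
  \<comment> \<open>The cell has measure 1, so properties that hold almost everywhere hold together
    at some point. One such point shows that the essential supremum is nonnegative and thus a real
    number.\<close>
  have "\<exists>y. 0 \<le> local_speed A rho y \<and> ereal (local_speed A rho y) \<le> c_max A rho"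
  proof (rule ccontr)
    assume no: "\<nexists>y. 0 \<le> local_speed A rho y \<and> ereal (local_speed A rho y) \<le> c_max A rho"
    have "AE y in (cell :: (real^'n) measure). False"
      using le loc by eventually_elim (use no in blast)
    then have "emeasure (cell :: (real^'n) measure) (space cell) = 0" by (simp add: AE_iff_null null_sets_def)
    then show False by (simp add: emeasure_cell)
  qed
  then obtain y where y: "0 \<le> local_speed A rho y" "ereal (local_speed A rho y) \<le> c_max A rho" by blast
  obtain c where c: "c_max A rho = ereal c" using y(2) fin by (cases "c_max A rho") auto
  show thesis
  proof (rule that[OF c])
    show "c \<ge> 0" using y c by simp
    show "AE y in cell. \<forall>\<xi>. (A y *v \<xi>) \<bullet> \<xi> \<le> c\<^sup>2 * rho y * (norm \<xi>)\<^sup>2"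
      using le loc rho
    proof eventually_elim
      case (elim y)
      have "(local_speed A rho y)\<^sup>2 \<le> c\<^sup>2" using elim(1,2) c by (intro power_mono) auto
      then have "(local_speed A rho y)\<^sup>2 * rho y * (norm \<xi>)\<^sup>2 \<le> c\<^sup>2 * rho y * (norm \<xi>)\<^sup>2" for \<xi> :: "real^'n"
        using elim(3) r0 by (intro mult_right_mono) auto
      then show ?case using elim(2) order_trans by blast
    qed
  qed
qed

theorem theorem1:
  fixes A0 :: "real^'n \<Rightarrow> real^'n^'n" and rho0 :: "real^'n \<Rightarrow> real"
    and theta0 g :: "real^'n" and n :: nat and alpha rho_min :: real
  assumes A0_meas: "A0 \<in> borel_measurable lebesgue"
    and A0_per: "periodic A0"
    and A0_bdd: "\<exists>M. AE y in lebesgue. norm (A0 y) \<le> M"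
    and A0_sym: "AE y in lebesgue. transpose (A0 y) = A0 y"
    and alpha_pos: "alpha > 0"
    and A0_coer: "AE y in lebesgue. \<forall>\<xi>. (A0 y *v \<xi>) \<bullet> \<xi> \<ge> alpha * (norm \<xi>)^2"
    and rho0_meas: "rho0 \<in> borel_measurable lebesgue"
    and rho0_per: "periodic rho0"
    and rho0_bdd: "\<exists>M. AE y in lebesgue. \<bar>rho0 y\<bar> \<le> M"
    and rho_min_pos: "rho_min > 0"
    and rho0_min: "AE y in lebesgue. rho0 y \<ge> rho_min"
    and theta0: "\<forall>i. 0 \<le> theta0 $ i \<and> theta0 $ i < 1"
    and n_pos: "n \<ge> 1"
    and simple: "simple_eig A0 rho0 theta0 (bloch_ev A0 rho0 theta0 n)"
    and ev_pos: "bloch_ev A0 rho0 theta0 n > 0"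
    and grad: "((\<lambda>theta. bloch_ev A0 rho0 theta n) has_derivative (\<lambda>h. g \<bullet> h)) (at theta0)"
  shows "ereal (norm (- (1 / (4 * pi * sqrt (bloch_ev A0 rho0 theta0 n))) *\<^sub>R g)) \<le> c_max A0 rho0"
proof (cases "c_max A0 rho0 = \<infinity>")
  \<comment> \<open>An infinite maximal speed bounds everything, and the closing \<open>simp\<close>
    settles that case.\<close>
  case False
  obtain M M' where M: "AE y in lebesgue. norm (A0 y) \<le> M" "AE y in lebesgue. \<bar>rho0 y\<bar> \<le> M'"
    using A0_bdd rho0_bdd by blast
  interpret bloch A0 rho0 M M' alpha rho_min
    by unfold_locales (use M assms in \<open>simp_all add: borel_measurable_cell AE_cell\<close>)
  obtain c where c: "c_max A0 rho0 = ereal c" "c \<ge> 0"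
    and speed: "AE y in cell. \<forall>\<xi>. (A0 y *v \<xi>) \<bullet> \<xi> \<le> c\<^sup>2 * rho0 y * (norm \<xi>)\<^sup>2"
    using speed_bound_AE[OF A_sym alpha A_coer rho_pos rho_min False] by blast
  let ?w = "sqrt (bloch_ev A0 rho0 theta0 n)"
  have w: "?w > 0" using ev_pos by simp
  \<comment> \<open>The factor \<open>2 * ?w\<close> is the chain rule for the square of
    \<open>?w\<close>, and \<open>2 * pi * c\<close> is the Lipschitz constant of the root; division
    by \<open>4 * pi * ?w\<close> leaves \<open>c\<close>.\<close>
  have "norm g \<le> 2 * ?w * (2 * pi * c)"
  proof (cases "ev_bounds theta0 n = {}")
    case True
    text \<open>Then there are too few eigenfunctions at every \<open>\<theta>\<close>, and the infimum is a constant junk value.\<close>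
    have "ev_bounds theta n = {}" for theta
      using ev_bounds_transfer[OF speed c(2) n_pos, of _ theta theta0] True by blast
    then have "bloch_ev A0 rho0 theta n = bloch_ev A0 rho0 theta0 n" for theta
      using True by (simp add: bloch_ev_Inf)
    then have "(\<lambda>theta. bloch_ev A0 rho0 theta n) = (\<lambda>_. bloch_ev A0 rho0 theta0 n)" by blast
    then have "((\<lambda>theta. bloch_ev A0 rho0 theta n) has_derivative (\<lambda>_. 0)) (at theta0)" by simp
    from has_derivative_unique[OF grad this] have "g \<bullet> g = 0" by meson
    then show ?thesis using w c(2) by simp
  next
    case False
    show ?thesis
      by (rule derivative_le_of_lipschitz[OF grad ev_pos])
        (use bloch_ev_lipschitz[OF speed c(2) n_pos False] c(2) in simp_all)
  qed
  then have "norm g / (4 * pi * ?w) \<le> c" using w by (simp add: field_simps)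
  then show ?thesis using w by (simp add: c(1))
qed simp

end
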